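(* Let $D$ be a regular discriminant form of even signature and level $N=\prod_{p\mid N}p^{\nu_p}$, and suppose $D$ carries a weakly reflective modular form $F=\sum_{\gamma\in D}F_\gamma e^\gamma$ of weight $k$ whose $0$-component $F_0$ is singular. Then \[ \frac{-k}{12}\prod_{p\mid N}\mu_p(N)\;\le\; 2^{\omega(N)}, \] where for a prime $p$ \[ \mu_p(N)=\begin{cases} p^{\nu_p-1} & \text{if } \nu_p\ge 2,\\ p+1 & \text{if } \nu_p=1,\\ 1 & \text{if } \nu_p=0,\end{cases}\] and $\omega(N)$ denotes the number of primes $p$ that are Hall divisors of $N$ (i.e. $p\mid N$ but $p^2\nmid N$).
   Context: A discriminant form is a finite abelian group $D$ with a quadratic form $q:D\to\mathbb{Q}/\mathbb{Z}$ whose associated bilinear form $(\beta,\gamma)=q(\beta+\gamma)-q(\beta)-q(\gamma)\bmod 1$ is non-degenerate. Its level is the smallest positive integer $N$ with $Nq(\gamma)=0$ for all $\gamma\in D$. Its signature $\operatorname{sign}(D)\in\mathbb{Z}/8\mathbb{Z}$ is the signature mod $8$ of any even lattice $L$ with $L'/L\cong D$ (with $q(\gamma)=\gamma^2/2 \bmod 1$). For $c\in\mathbb{Z}$ let $D_c$ be the kernel and $D^c$ the image of multiplication by $c$ on $D$, and $D_{c,x}=\{\gamma\in D_c: q(\gamma)=x\bmod 1\}$. $D$ is called regular if for every prime $p\mid N$ the group $D^{N/p}$ contains a non-zero isotropic element. For $D$ of even signature, the Weil representation $\rho_D$ of $\mathrm{SL}_2(\mathbb{Z})$ on $\mathbb{C}[D]$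 (basis $e^\gamma$) is defined by $\rho_D(T)e^\gamma=e(-q(\gamma))e^\gamma$ and $\rho_D(S)e^\gamma=\frac{e(\operatorname{sign}(D)/8)}{\sqrt{|D|}}\sum_{\beta\in D}e((\gamma,\beta))e^\beta$, where $e(x)=e^{2\pi i x}$, $T=\begin{pmatrix}1&1\\0&1\end{pmatrix}$, $S=\begin{pmatrix}0&-1\\1&0\end{pmatrix}$. A modular form of (integral) weight $k$ for $\rho_D$ is a holomorphic function $F=\sum_\gamma F_\gamma e^\gamma$ on the upper half plane with values in $\mathbb{C}[D]$ such that $F(M\tau)=(c\tau+d)^k\rho_D(M)F(\tau)$ for all $M=\begin{pmatrix}a&b\\c&d\end{pmatrix}\in\mathrm{SL}_2(\mathbb{Z})$ and $F$ is meromorphic at $\infty$; a component $F_\gamma$ is called singular if it has a pole at $\infty$. Such an $F$ (with $D$ of level $N$ and even signature) is weakly reflective if (i) there is an even lattice $L$ of signature $(n,2)$ with $n>2$ and $k=1-n/2$ such that $D\cong L'/L$, and (ii) whenever $F_\gamma$ has a pole at $\infty$, there is a divisor $d\mid N$ with $\gamma\in D_{d,1/d}$ and $F_\gamma(\tau)=c_\gamma q^{-1/d}+(\text{higher powers of }q)$ with $c_\gamma\in\mathbb{Q}$ ($q=e(\tau)$). *)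

theory Defs
  imports
    "HOL-Analysis.Analysis"
    "HOL-Algebra.Coset"
    "HOL-Computational_Algebra.Primes"
begin

section \<open>Discriminant forms\<close>

text \<open>
  A discriminant form is a finite abelian group, given by a type of sort
  \<open>{ab_group_add, finite}\<close>, with a quadratic form to \<open>\<rat>/\<int>\<close>. The quadratic form is given by
  a function \<open>q\<close> choosing rational representatives; every condition on \<open>q\<close> below is
  invariant under changing values of \<open>q\<close> by integers.
\<close>

definition eq_mod1 :: "rat \<Rightarrow> rat \<Rightarrow> bool" where
  "eq_mod1 x y \<longleftrightarrow> x - y \<in> \<int>"

definition zmul :: "int \<Rightarrow> 'a::ab_group_add \<Rightarrow> 'a" where
  "zmul c g = (if c \<ge> 0 then (\<Sum>i<nat c. g) else - (\<Sum>i<nat (- c). g))"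

definition bilin :: "('a::ab_group_add \<Rightarrow> rat) \<Rightarrow> 'a \<Rightarrow> 'a \<Rightarrow> rat" where
  "bilin q b g = q (b + g) - q b - q g"

definition discriminant_form :: "('a::{ab_group_add,finite} \<Rightarrow> rat) \<Rightarrow> bool" where
  "discriminant_form q \<longleftrightarrow>
     (\<forall>c g. eq_mod1 (q (zmul c g)) (of_int (c ^ 2) * q g)) \<and>
     (\<forall>a b g. eq_mod1 (bilin q (a + b) g) (bilin q a g + bilin q b g)) \<and>
     (\<forall>b. (\<forall>g. eq_mod1 (bilin q b g) 0) \<longrightarrow> b = 0)"

definition level :: "('a::{ab_group_add,finite} \<Rightarrow> rat) \<Rightarrow> nat" where
  "level q = (LEAST N. N > 0 \<and> (\<forall>g. eq_mod1 (of_nat N * q g) 0))"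

definition mult_kernel :: "int \<Rightarrow> 'a::ab_group_add set" where
  "mult_kernel c = {g. zmul c g = 0}"

definition mult_image :: "int \<Rightarrow> 'a::ab_group_add set" where
  "mult_image c = range (zmul c)"

definition mult_kernel_norm :: "('a::ab_group_add \<Rightarrow> rat) \<Rightarrow> int \<Rightarrow> rat \<Rightarrow> 'a set" where
  "mult_kernel_norm q c x = {g \<in> mult_kernel c. eq_mod1 (q g) x}"

definition regular_form :: "('a::{ab_group_add,finite} \<Rightarrow> rat) \<Rightarrow> bool" where
  "regular_form q \<longleftrightarrow>
     (\<forall>p. prime p \<and> p dvd level q \<longrightarrow>
        (\<exists>g \<in> mult_image (int (level q div p)). g \<noteq> 0 \<and> eq_mod1 (q g) 0))"

section \<open>Even lattices and the signature\<close>

text \<open>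
  A lattice of rank \<open>m\<close> is presented, in a basis, as \<open>\<int>\<^sup>m\<close> with Gram matrix \<open>(A i j)\<close>, \<open>i, j < m\<close>.
  Its ambient space \<open>\<rat>\<^sup>m\<close> consists of the functions \<open>nat \<Rightarrow> rat\<close> vanishing from \<open>m\<close> on.
\<close>

definition gram_form :: "nat \<Rightarrow> (nat \<Rightarrow> nat \<Rightarrow> int) \<Rightarrow>
    (nat \<Rightarrow> 'b::field_char_0) \<Rightarrow> (nat \<Rightarrow> 'b) \<Rightarrow> 'b" where
  "gram_form m A x y = (\<Sum>i<m. \<Sum>j<m. x i * of_int (A i j) * y j)"

definition rat_space :: "nat \<Rightarrow> (nat \<Rightarrow> rat) set" where
  "rat_space m = {x. \<forall>i\<ge>m. x i = 0}"

definition std_lattice :: "nat \<Rightarrow> (nat \<Rightarrow> rat) set" where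
  "std_lattice m = {x \<in> rat_space m. \<forall>i. x i \<in> \<int>}"

definition even_lattice :: "nat \<Rightarrow> (nat \<Rightarrow> nat \<Rightarrow> int) \<Rightarrow> bool" where
  "even_lattice m A \<longleftrightarrow>
     (\<forall>i<m. \<forall>j<m. A i j = A j i) \<and>
     (\<forall>x \<in> rat_space m. (\<forall>y \<in> rat_space m. gram_form m A x y = 0) \<longrightarrow> x = (\<lambda>i. 0)) \<and>
     (\<forall>x \<in> std_lattice m. \<exists>k::int. gram_form m A x x = of_int (2 * k))"

definition dual_lattice :: "nat \<Rightarrow> (nat \<Rightarrow> nat \<Rightarrow> int) \<Rightarrow> (nat \<Rightarrow> rat) set" where
  "dual_lattice m A = {x \<in> rat_space m. \<forall>y \<in> std_lattice m. gram_form m A x y \<in> \<int>}"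

definition dual_group :: "nat \<Rightarrow> (nat \<Rightarrow> nat \<Rightarrow> int) \<Rightarrow> (nat \<Rightarrow> rat) monoid" where
  "dual_group m A = \<lparr>carrier = dual_lattice m A, mult = (\<lambda>x y i. x i + y i), one = (\<lambda>i. 0)\<rparr>"

definition additive_group :: "'a::ab_group_add monoid" where
  "additive_group = \<lparr>carrier = UNIV, mult = (+), one = 0\<rparr>"

definition lattice_disc_iso ::
    "nat \<Rightarrow> (nat \<Rightarrow> nat \<Rightarrow> int) \<Rightarrow> ('a::{ab_group_add,finite} \<Rightarrow> rat) \<Rightarrow> bool" where
  "lattice_disc_iso m A q \<longleftrightarrow>
     (\<exists>\<phi> \<in> iso (dual_group m A Mod std_lattice m) additive_group.
        \<forall>x \<in> dual_lattice m A.
          eq_mod1 (q (\<phi> (std_lattice m #>\<^bsub>dual_group m A\<^esub> x))) (gram_form m A x x / 2))"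

text \<open>
  Signature \<open>(r, s)\<close>, for a Gram matrix of rank \<open>r + s\<close>: the associated real quadratic space has an
  orthogonal basis of \<open>r\<close> vectors of norm \<open>1\<close> and \<open>s\<close> vectors of norm \<open>-1\<close>. Linear independence of
  the \<open>b i\<close> is implied by the orthogonality relations.
\<close>

definition has_signature :: "(nat \<Rightarrow> nat \<Rightarrow> int) \<Rightarrow> nat \<Rightarrow> nat \<Rightarrow> bool" where
  "has_signature A r s \<longleftrightarrow>
     (\<exists>b :: nat \<Rightarrow> nat \<Rightarrow> real. \<forall>i<r+s. \<forall>j<r+s.
        gram_form (r + s) A (b i) (b j) = (if i \<noteq> j then 0 else if i < r then 1 else - 1))"

text \<open>
  The signature modulo 8, as a representative in \<open>{0..7}\<close>. It does not depend on the lattice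
  chosen, by Milgram's formula.
\<close>

definition disc_sign :: "('a::{ab_group_add,finite} \<Rightarrow> rat) \<Rightarrow> int" where
  "disc_sign q = (SOME t. \<exists>A r s. even_lattice (r + s) A \<and> has_signature A r s \<and>
     lattice_disc_iso (r + s) A q \<and> t = (int r - int s) mod 8)"

section \<open>The Weil representation\<close>

definition ee :: "complex \<Rightarrow> complex" where
  "ee x = exp (2 * of_real pi * \<i> * x)"

definition SL2Z :: "(int^2^2) set" where
  "SL2Z = {M. det M = 1}"

definition T_mat :: "int^2^2" where
  "T_mat = vector [vector [1, 1], vector [0, 1]]"

definition S_mat :: "int^2^2" where
  "S_mat = vector [vector [0, - 1], vector [1, 0]]"

text \<open>
  The group algebra \<open>\<complex>[D]\<close> is \<open>complex^'a\<close>, with basis vectors \<open>axis g 1\<close>. Since \<open>S\<close> and \<open>T\<close>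
  generate the modular group, the conditions determine \<open>\<rho>\<close> uniquely on \<open>SL2Z\<close>.
\<close>

definition weil_representation ::
    "('a::{ab_group_add,finite} \<Rightarrow> rat) \<Rightarrow> (int^2^2 \<Rightarrow> complex^('a::{ab_group_add,finite})^('a::{ab_group_add,finite})) \<Rightarrow> bool" where
  "weil_representation q \<rho> \<longleftrightarrow>
     \<rho> (mat 1) = mat 1 \<and>
     (\<forall>M \<in> SL2Z. \<forall>M' \<in> SL2Z. \<rho> (M ** M') = \<rho> M ** \<rho> M') \<and>
     (\<forall>g. \<rho> T_mat *v axis g 1 = ee (- of_rat (q g)) *s axis g 1) \<and>
     (\<forall>g. \<rho> S_mat *v axis g 1 =
        (ee (of_int (disc_sign q) / 8) / of_real (sqrt (real CARD('a)))) *s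
          (\<Sum>b\<in>UNIV. ee (of_rat (bilin q g b)) *s axis b 1))"

section \<open>Modular forms for the Weil representation\<close>

definition upper_half_plane :: "complex set" where
  "upper_half_plane = {\<tau>. Im \<tau> > 0}"

definition autfactor :: "int^2^2 \<Rightarrow> complex \<Rightarrow> complex" where
  "autfactor M \<tau> = of_int (M $ 2 $ 1) * \<tau> + of_int (M $ 2 $ 2)"

definition mobius :: "int^2^2 \<Rightarrow> complex \<Rightarrow> complex" where
  "mobius M \<tau> = (of_int (M $ 1 $ 1) * \<tau> + of_int (M $ 1 $ 2)) / autfactor M \<tau>"

text \<open>
  \<open>a m\<close> is the coefficient of \<open>q\<close> to the power \<open>m / N\<close>. For \<open>N\<close> the level, every component of a
  modular form for the Weil representation is invariant under translation by \<open>N\<close>, so only such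
  exponents occur.
\<close>

definition q_expansion :: "nat \<Rightarrow> (complex \<Rightarrow> complex) \<Rightarrow> (int \<Rightarrow> complex) \<Rightarrow> bool" where
  "q_expansion N f a \<longleftrightarrow>
     (\<exists>m0. \<forall>m<m0. a m = 0) \<and>
     (\<forall>\<tau> \<in> upper_half_plane. ((\<lambda>m. a m * ee (of_int m * \<tau> / of_nat N)) has_sum f \<tau>) UNIV)"

definition pole_at_infinity :: "nat \<Rightarrow> (complex \<Rightarrow> complex) \<Rightarrow> bool" where
  "pole_at_infinity N f \<longleftrightarrow> (\<exists>a. q_expansion N f a \<and> (\<exists>m<0. a m \<noteq> 0))"

definition modular_form ::
    "('a::{ab_group_add,finite} \<Rightarrow> rat) \<Rightarrow> (int^2^2 \<Rightarrow> complex^('a::{ab_group_add,finite})^('a::{ab_group_add,finite})) \<Rightarrow> int \<Rightarrow>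
      (complex \<Rightarrow> complex^('a::{ab_group_add,finite})) \<Rightarrow> bool" where
  "modular_form q \<rho> k F \<longleftrightarrow>
     (\<forall>g. (\<lambda>\<tau>. F \<tau> $ g) holomorphic_on upper_half_plane) \<and>
     (\<forall>M \<in> SL2Z. \<forall>\<tau> \<in> upper_half_plane.
        F (mobius M \<tau>) = (autfactor M \<tau> powi k) *s (\<rho> M *v F \<tau>)) \<and>
     (\<forall>g. \<exists>a. q_expansion (level q) (\<lambda>\<tau>. F \<tau> $ g) a)"

definition weakly_reflective ::
    "('a::{ab_group_add,finite} \<Rightarrow> rat) \<Rightarrow> (int^2^2 \<Rightarrow> complex^('a::{ab_group_add,finite})^('a::{ab_group_add,finite})) \<Rightarrow> int \<Rightarrow>
      (complex \<Rightarrow> complex^('a::{ab_group_add,finite})) \<Rightarrow> bool" where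
  "weakly_reflective q \<rho> k F \<longleftrightarrow>
     modular_form q \<rho> k F \<and>
     (\<exists>n A. n > 2 \<and> even_lattice (n + 2) A \<and> has_signature A n 2 \<and>
        real_of_int k = 1 - real n / 2 \<and> lattice_disc_iso (n + 2) A q) \<and>
     (\<forall>g. pole_at_infinity (level q) (\<lambda>\<tau>. F \<tau> $ g) \<longrightarrow>
        (\<exists>d a. d dvd level q \<and> g \<in> mult_kernel_norm q (int d) (1 / of_nat d) \<and>
           q_expansion (level q) (\<lambda>\<tau>. F \<tau> $ g) a \<and>
           (\<forall>m < - int (level q div d). a m = 0) \<and>
           a (- int (level q div d)) \<in> \<rat>))"

section \<open>Arithmetic functions\<close>

definition mu :: "nat \<Rightarrow> nat \<Rightarrow> nat" where
  "mu p N = (if multiplicity p N \<ge> 2 then p ^ (multiplicity p N - 1)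
             else if multiplicity p N = 1 then p + 1 else 1)"

definition hall_omega :: "nat \<Rightarrow> nat" where
  "hall_omega N = card {p. prime p \<and> p dvd N \<and> \<not> p ^ 2 dvd N}"

end

theory Submission
  imports Defs "HOL-Complex_Analysis.Complex_Analysis" "HOL-Number_Theory.Cong"
begin

no_notation fps_nth (infixl \<open>$\<close> 75)

text \<open>
  Regularity provides an element \<open>\<mu>\<close> whose multiples \<open>(N/p) \<mu>\<close> are non-zero for all \<open>p | N\<close> and for which
  \<open>\<kappa> = (N/r) \<mu>\<close> is isotropic, where \<open>r\<close> is the radical of \<open>N\<close>. Put \<open>v = \<Sum> c\<^sub>r(i) e\<^bsup>i\<kappa>\<^esup>\<close> with Ramanujan
  sums \<open>c\<^sub>r(i)\<close> as coefficients. Up to roots of unity \<open>v\<close> is fixed by \<open>\<Gamma>\<^sub>1(N)\<close>, and since non-zero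
  isotropic components of \<open>F\<close> are regular at infinity, the pole of \<open>F\<^sub>0\<close> shows \<open>f = \<langle>v, F\<rangle> \<noteq> 0\<close>. The product of
  the translates of \<open>f\<close> over the pairs \<open>(c, d)\<close> modulo \<open>N\<close> is modular for \<open>SL\<^sub>2(\<int>)\<close> up to constants of modulus
  \<open>1\<close>, so that its weight bounds its pole order at infinity from below (valence inequality).

  The pole order is bounded from above cusp by cusp. The Heisenberg operators that fix or kill \<open>v\<close> are
  permuted by \<open>SL\<^sub>2(\<int>)\<close>, which restricts the support of \<open>v|M\<close>: if \<open>\<gamma>\<close> lies in it and
  \<open>\<gamma> \<in> D\<^bsub>\<delta>,1/\<delta>\<^esub>\<close>, then for \<open>p\<^sup>\<nu>\<close> exactly dividing \<open>N\<close> the \<open>p\<close>-part of \<open>\<delta>\<close> is \<open>p\<^sup>\<nu>\<close> when \<open>p\<close> does not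
  divide \<open>c\<close>, and no such \<open>\<gamma>\<close> exists when \<open>p | c\<close> and \<open>p\<^bsup>\<nu>-1\<^esup>\<close> does not divide \<open>c\<close>, with a single
  exception for \<open>p\<^sup>\<nu> = 8\<close>, which is controlled by Gauss sums. Summing over all pairs \<open>(c, d)\<close> gives the bound.
\<close>

section \<open>The valence inequality\<close>

text \<open>The Ramanujan weights are essential to the bound. At a cusp with c = 1, the vector e^0
  alone would spread over all of D, and equal weights on the multiples of \<kappa> would spread over
  the orthogonal complement of \<kappa>; both contain \<gamma> of small order, hence poles of large
  order. Since the weights sum to 0 over every coset of the subgroup of order p, the support shrinks
  to \<gamma> not orthogonal to (N/p)\<mu>, and N/p does not kill such a \<gamma>. One factor for
  each pair (c, d), rather than one for each cusp, turns widths of cusps into plain counting: -k/12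
  is at most the average of the bounds over all pairs, and pairs and bounds factor over the primes
  of N. Up to the common factor p^\<nu> - p^(\<nu>-1), there are p^(\<nu>-1) (p+1) pairs at p,
  against a total bound of p+1 if \<nu> >= 2 and of 2 if \<nu> = 1. The ratios are mu_p(N) and
  mu_p(N)/2 respectively, whence the theorem. Only absolute values enter the valence inequality, so
  the multipliers of modulus 1 never have to be computed.\<close>

lemma open_upper_half_plane: "open upper_half_plane"
  unfolding upper_half_plane_def by (simp add: open_halfspace_Im_gt)

lemma convex_upper_half_plane: "convex upper_half_plane"
  unfolding upper_half_plane_def by (simp add: convex_halfspace_Im_gt)

section \<open>Reduction theory and functions of negative weight\<close>

lemma translate_int:
  fixes u :: "complex \<Rightarrow> 'b"
  assumes T: "\<And>\<tau>. Im \<tau> > 0 \<Longrightarrow> u (\<tau> + 1) = u \<tau>" and "Im \<tau> > 0"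
  shows "u (\<tau> + of_int n) = u \<tau>"
proof -
  have Tn: "u (\<sigma> + of_nat n) = u \<sigma>" if "Im \<sigma> > 0" for \<sigma> n
  proof (induction n)
    case (Suc n)
    then show ?case using T[of "\<sigma> + of_nat n"] that by (simp add: add_ac)
  qed auto
  show ?thesis
  proof (cases "n \<ge> 0")
    case True
    then show ?thesis using Tn[of \<tau> "nat n"] assms(2) by simp
  next
    case False
    then show ?thesis using Tn[of "\<tau> + of_int n" "nat (-n)"] assms(2) by simp
  qed
qed

lemma translate_to_strip:
  fixes u :: "complex \<Rightarrow> 'b"
  assumes T: "\<And>\<tau>. Im \<tau> > 0 \<Longrightarrow> u (\<tau> + 1) = u \<tau>" and "Im \<tau> > 0"
  shows "\<exists>\<tau>'. Im \<tau>' = Im \<tau> \<and> \<bar>Re \<tau>'\<bar> \<le> 1/2 \<and> u \<tau>' = u \<tau>"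
  using translate_int[where u = u, OF T \<open>Im \<tau> > 0\<close>, of "- round (Re \<tau>)"] of_int_round_abs_le[of "Re \<tau>"]
  by (intro exI[of _ "\<tau> + of_int (- round (Re \<tau>))"]) (simp add: abs_minus_commute)

text \<open>After centring, a point with \<open>Im \<tau> < 1/2\<close> satisfies |\<tau>|^2 <= 1/2,
  so inversion at least doubles its imaginary part; the induction counts the doublings needed to
  reach height 1/2. The strip is larger than a fundamental domain, but cut off at a finite height it
  is compact, as a maximum argument requires.\<close>

lemma reduce_to_strip:
  fixes u :: "complex \<Rightarrow> 'b"
  assumes T: "\<And>\<tau>. Im \<tau> > 0 \<Longrightarrow> u (\<tau> + 1) = u \<tau>"
    and S: "\<And>\<tau>. Im \<tau> > 0 \<Longrightarrow> u (- 1 / \<tau>) = u \<tau>"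
    and "Im \<tau> > 0"
  shows "\<exists>\<tau>'. Im \<tau>' \<ge> 1/2 \<and> \<bar>Re \<tau>'\<bar> \<le> 1/2 \<and> u \<tau>' = u \<tau>"
proof -
  note center = translate_to_strip[of u, OF T]
  have main: "\<exists>\<tau>'. Im \<tau>' \<ge> 1/2 \<and> \<bar>Re \<tau>'\<bar> \<le> 1/2 \<and> u \<tau>' = u \<sigma>"
    if "Im \<sigma> > 0" "Im \<sigma> * 2 ^ n \<ge> 1/2" for \<sigma> n
    using that
  proof (induction n arbitrary: \<sigma>)
    case 0
    then show ?case using center[of \<sigma>] by (metis mult.right_neutral power_0)
  next
    case (Suc n)
    obtain \<sigma>' where s: "Im \<sigma>' = Im \<sigma>" "\<bar>Re \<sigma>'\<bar> \<le> 1/2" "u \<sigma>' = u \<sigma>"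
      using center Suc.prems by blast
    show ?case
    proof (cases "Im \<sigma> \<ge> 1/2")
      case True
      then show ?thesis using s by metis
    next
      case False
      have n0: "\<sigma>' \<noteq> 0" using s Suc.prems by auto
      have "(Re \<sigma>')\<^sup>2 \<le> (1/2)\<^sup>2" using s(2) by (metis abs_ge_zero power2_abs power_mono)
      moreover have "(Im \<sigma>')\<^sup>2 \<le> (1/2)\<^sup>2" using s(1) False Suc.prems
        by (intro power_mono) auto
      ultimately have le: "(Re \<sigma>')\<^sup>2 + (Im \<sigma>')\<^sup>2 \<le> 1/2" by (simp add: power2_eq_square)
      have pos: "(Re \<sigma>')\<^sup>2 + (Im \<sigma>')\<^sup>2 > 0" using s(1) Suc.prems(1)
        by (simp add: sum_power2_gt_zero_iff)
      have im: "Im (- 1 / \<sigma>') = Im \<sigma> / ((Re \<sigma>')\<^sup>2 + (Im \<sigma>')\<^sup>2)"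
        using s(1) by (simp add: Im_divide)
      have "Im (- 1 / \<sigma>') \<ge> 2 * Im \<sigma>"
        unfolding im using mult_left_mono[OF le, of "2 * Im \<sigma>"] Suc.prems(1)
        by (simp add: pos_le_divide_eq[OF pos])
      then have "(2 * Im \<sigma>) * 2 ^ n \<le> Im (-1/\<sigma>') * 2 ^ n" and "Im (-1/\<sigma>') > 0"
        using Suc.prems(1) by (intro mult_right_mono, simp_all)
      moreover from this(1) have "Im (-1/\<sigma>') * 2 ^ n \<ge> 1/2"
        using Suc.prems(2) by (simp add: mult_ac)
      ultimately have "Im (-1/\<sigma>') * 2 ^ n \<ge> 1/2" "Im (-1/\<sigma>') > 0" by auto
      from Suc.IH[OF this(2,1)] show ?thesis using S[of \<sigma>'] s Suc.prems(1) by auto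
    qed
  qed
  obtain n where "(1/2) / Im \<tau> < 2 ^ n" using real_arch_pow[of 2] by auto
  then have "Im \<tau> * 2 ^ n \<ge> 1/2" using assms(3) by (simp add: field_simps)
  from main[OF assms(3) this] show ?thesis .
qed

text \<open>If the invariant function \<open>|\<Psi>| y\<^bsup>-s/2\<^esup>\<close> attains its maximum at \<open>\<tau>\<^sub>0\<close>, then so does the modulus of
  the holomorphic function \<open>\<Psi> / (\<tau> - cnj \<tau>\<^sub>0)\<^sup>s\<close>, because \<open>4 y y\<^sub>0 \<le> |\<tau> - cnj \<tau>\<^sub>0|\<^sup>2\<close> with equality
  only at \<open>\<tau>\<^sub>0\<close>.\<close>

lemma negative_weight_vanishes:
  fixes \<Psi> :: "complex \<Rightarrow> complex" and s :: nat
  assumes hol: "\<Psi> holomorphic_on upper_half_plane"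
    and T: "\<And>\<tau>. Im \<tau> > 0 \<Longrightarrow> cmod (\<Psi> (\<tau> + 1)) = cmod (\<Psi> \<tau>)"
    and S: "\<And>\<tau>. Im \<tau> > 0 \<Longrightarrow> cmod (\<Psi> (- 1 / \<tau>)) * cmod \<tau> ^ s = cmod (\<Psi> \<tau>)"
    and s: "s > 0"
    and bd: "\<And>\<tau>. Im \<tau> \<ge> 1 \<Longrightarrow> cmod (\<Psi> \<tau>) \<le> C"
    and "Im \<tau>1 > 0"
  shows "\<Psi> \<tau>1 = 0"
proof (rule ccontr)
  assume nz: "\<Psi> \<tau>1 \<noteq> 0"
  define u where "u \<tau> = (cmod (\<Psi> \<tau>))\<^sup>2 / Im \<tau> ^ s" for \<tau>
  have uT: "u (\<tau> + 1) = u \<tau>" if "Im \<tau> > 0" for \<tau> using T[OF that] by (simp add: u_def)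
  have uS: "u (- 1 / \<tau>) = u \<tau>" if "Im \<tau> > 0" for \<tau>
  proof -
    have n: "cmod \<tau> > 0" using that by auto
    have im: "Im (- 1 / \<tau>) = Im \<tau> / (cmod \<tau>)\<^sup>2"
      by (simp add: Im_divide cmod_power2)
    show ?thesis unfolding u_def im S[OF that, symmetric] using n that
      by (simp add: power_divide power_mult_distrib field_simps flip: power_mult power_add)
        
  qed
  have u1: "u \<tau>1 > 0" using nz assms(6) by (simp add: u_def)
  have C0: "C \<ge> 0" using bd[of \<i>] by (smt (verit) imaginary_unit.simps(2) norm_ge_zero)
  \<comment> \<open>As s > 0, the function \<open>u\<close> is at most C^2 / B above height B, so
    its maximum has to be looked for only in the compact rectangle \<open>K\<close> below.\<close>
  obtain B where B: "B \<ge> 1" "C\<^sup>2 / B < u \<tau>1"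
  proof -
    define B where "B = max 1 (C\<^sup>2 / u \<tau>1 + 1)"
    have "B \<ge> 1" "B > C\<^sup>2 / u \<tau>1" by (auto simp: B_def)
    then show ?thesis using that[of B] u1 by (simp add: field_simps)
  qed
  have small: "u \<tau> < u \<tau>1" if "Im \<tau> \<ge> B" for \<tau>
  proof -
    have "(cmod (\<Psi> \<tau>))\<^sup>2 \<le> C\<^sup>2" using bd[of \<tau>] that B by (intro power_mono) auto
    moreover have "Im \<tau> ^ s \<ge> B"
      using that B s by (smt (verit, best) One_nat_def Suc_leI power_increasing power_one_right)
    ultimately have "u \<tau> \<le> C\<^sup>2 / B" unfolding u_def using B by (intro frac_le) auto
    then show ?thesis using B by simp
  qed
  define K where "K = cbox (Complex (-1/2) (1/2)) (Complex (1/2) B)"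
  have Kiff: "\<tau> \<in> K \<longleftrightarrow> \<bar>Re \<tau>\<bar> \<le> 1/2 \<and> 1/2 \<le> Im \<tau> \<and> Im \<tau> \<le> B" for \<tau>
    unfolding K_def in_cbox_complex_iff by auto
  have contu: "continuous_on K u"
  proof -
    have "continuous_on K \<Psi>"
      using holomorphic_on_imp_continuous_on[OF hol]
      by (rule continuous_on_subset) (auto simp: Kiff upper_half_plane_def)
    then show ?thesis unfolding u_def by (intro continuous_intros) (auto simp: Kiff)
  qed
  have "Complex 0 1 \<in> K" using B by (auto simp: Kiff)
  then obtain \<tau>0 where t0: "\<tau>0 \<in> K" "\<And>\<tau>. \<tau> \<in> K \<Longrightarrow> u \<tau> \<le> u \<tau>0"
    using continuous_attains_sup[OF _ _ contu] unfolding K_def by (metis compact_cbox empty_iff)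
  \<comment> \<open>A point that reduces to height above B only gets the bound
    \<open>u \<tau>1\<close>, and this strictly, which is impossible for \<tau>1 itself. So the
    second conjunct gives \<open>u \<tau>1 \<le> u \<tau>0\<close>, which turns the first one into
    the maximum property.\<close>
  have le1: "u \<tau> \<le> max (u \<tau>0) (u \<tau>1) \<and> (\<tau> = \<tau>1 \<longrightarrow> u \<tau> \<le> u \<tau>0)" if "Im \<tau> > 0" for \<tau>
  proof -
    obtain \<tau>' where t: "Im \<tau>' \<ge> 1/2" "\<bar>Re \<tau>'\<bar> \<le> 1/2" "u \<tau>' = u \<tau>"
      using reduce_to_strip[of u \<tau>] uT uS \<open>Im \<tau> > 0\<close> by blast
    show ?thesis
    proof (cases "Im \<tau>' \<le> B")
      case True
      then have "\<tau>' \<in> K" using t by (auto simp: Kiff)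
      then show ?thesis using t0(2)[of \<tau>'] t by auto
    next
      case False
      then show ?thesis using small[of \<tau>'] t by auto
    qed
  qed
  have max: "u \<tau> \<le> u \<tau>0" if "Im \<tau> > 0" for \<tau>
    using le1[OF that] le1[OF assms(6)] by auto
  have u0: "u \<tau>0 > 0" using u1 max[OF assms(6)] by simp
  define y0 where "y0 = Im \<tau>0"
  have y0: "y0 > 0" using t0(1) by (auto simp: Kiff y0_def)
  define g where "g \<tau> = \<Psi> \<tau> / (\<tau> - cnj \<tau>0) ^ s" for \<tau>
  have d: "(cmod (\<tau> - cnj \<tau>0))\<^sup>2 = 4 * Im \<tau> * y0 + (cmod (\<tau> - \<tau>0))\<^sup>2" for \<tau>
    by (simp add: cmod_power2 y0_def) algebra
  have dpos: "cmod (\<tau> - cnj \<tau>0) > 0" if "Im \<tau> > 0" for \<tau>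
    using that y0 by (auto simp: complex_eq_iff y0_def)
  have gle: "(cmod (g \<tau>))\<^sup>2 \<le> u \<tau>0 / (4 * y0) ^ s * (4 * Im \<tau> * y0 / (cmod (\<tau> - cnj \<tau>0))\<^sup>2) ^ s"
    if "Im \<tau> > 0" for \<tau>
  proof -
    have "(cmod (\<Psi> \<tau>))\<^sup>2 \<le> u \<tau>0 * Im \<tau> ^ s"
      using max[OF that] that unfolding u_def[of \<tau>] by (simp add: field_simps)
    then have "(cmod (g \<tau>))\<^sup>2 \<le> u \<tau>0 * Im \<tau> ^ s / ((cmod (\<tau> - cnj \<tau>0))\<^sup>2) ^ s"
      unfolding g_def norm_divide norm_power power_divide
      using dpos[OF that] by (simp add: divide_right_mono mult.commute flip: power_mult)
    also have "\<dots> = u \<tau>0 / (4 * y0) ^ s * (4 * Im \<tau> * y0 / (cmod (\<tau> - cnj \<tau>0))\<^sup>2) ^ s"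
      using y0 by (simp add: power_divide power_mult_distrib)
    finally show ?thesis .
  qed
  have g0: "(cmod (g \<tau>0))\<^sup>2 = u \<tau>0 / (4 * y0) ^ s"
  proof -
    have "(cmod (\<tau>0 - cnj \<tau>0))\<^sup>2 = 4 * y0 * y0" using d[of \<tau>0] by (simp add: y0_def)
    then have "((cmod (\<tau>0 - cnj \<tau>0)) ^ s)\<^sup>2 = (4 * y0) ^ s * y0 ^ s"
      by (metis mult.commute power_mult power_mult_distrib)
    then show ?thesis
      unfolding g_def norm_divide norm_power power_divide by (simp add: u_def y0_def)
  qed
  have frac: "4 * Im \<tau> * y0 / (cmod (\<tau> - cnj \<tau>0))\<^sup>2 \<le> 1"
    "\<tau> \<noteq> \<tau>0 \<Longrightarrow> 4 * Im \<tau> * y0 / (cmod (\<tau> - cnj \<tau>0))\<^sup>2 < 1"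
    "0 \<le> 4 * Im \<tau> * y0 / (cmod (\<tau> - cnj \<tau>0))\<^sup>2" if "Im \<tau> > 0" for \<tau>
  proof -
    have p: "4 * Im \<tau> * y0 > 0" using that y0 by simp
    show "4 * Im \<tau> * y0 / (cmod (\<tau> - cnj \<tau>0))\<^sup>2 \<le> 1"
      unfolding d using p by (subst divide_le_eq_1_pos) (auto simp: add_pos_nonneg)
    show "4 * Im \<tau> * y0 / (cmod (\<tau> - cnj \<tau>0))\<^sup>2 < 1" if "\<tau> \<noteq> \<tau>0"
      unfolding d using p that by (subst divide_less_eq_1_pos) (auto simp: add_pos_nonneg)
    show "0 \<le> 4 * Im \<tau> * y0 / (cmod (\<tau> - cnj \<tau>0))\<^sup>2" using p by simp
  qed
  have c0: "u \<tau>0 / (4 * y0) ^ s > 0" using u0 y0 by simp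
  have gmax: "cmod (g \<tau>) \<le> cmod (g \<tau>0)" if "Im \<tau> > 0" for \<tau>
  proof -
    have "(cmod (g \<tau>))\<^sup>2 \<le> (cmod (g \<tau>0))\<^sup>2"
      using gle[OF that] frac[OF that] c0 unfolding g0
      by (meson less_imp_le mult_left_le order_trans power_le_one)
    then show ?thesis by (rule power2_le_imp_le) simp
  qed
  have glt: "cmod (g \<tau>) < cmod (g \<tau>0)" if "Im \<tau> > 0" "\<tau> \<noteq> \<tau>0" for \<tau>
  proof -
    have "(4 * Im \<tau> * y0 / (cmod (\<tau> - cnj \<tau>0))\<^sup>2) ^ s < 1"
      using frac[OF that(1)] that(2) s by (subst power_less_one_iff) auto
    then have "(cmod (g \<tau>))\<^sup>2 < (cmod (g \<tau>0))\<^sup>2"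
      using gle[OF that(1)] mult_strict_left_mono[OF _ c0] unfolding g0 by fastforce
    then show ?thesis by (rule power2_less_imp_less) simp
  qed
  have holg: "g holomorphic_on upper_half_plane"
    unfolding g_def using hol dpos
    by (intro holomorphic_intros) (auto simp: upper_half_plane_def)
  have "g constant_on upper_half_plane"
  proof (rule maximum_modulus_principle[OF holg open_upper_half_plane _ open_upper_half_plane order_refl])
    show "connected upper_half_plane" by (simp add: convex_connected convex_upper_half_plane)
    show "\<tau>0 \<in> upper_half_plane" using y0 by (simp add: upper_half_plane_def y0_def)
    show "norm (g z) \<le> norm (g \<tau>0)" if "z \<in> upper_half_plane" for z
      using gmax that by (simp add: upper_half_plane_def)
  qed
  moreover have "\<tau>0 \<in> upper_half_plane" "\<tau>0 + 1 \<in> upper_half_plane"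
    using y0 by (auto simp: upper_half_plane_def y0_def)
  ultimately have "g (\<tau>0 + 1) = g \<tau>0" unfolding constant_on_def by metis
  then show False using glt[of "\<tau>0 + 1"] y0 by (simp add: y0_def)
qed

section \<open>Eisenstein series: convergence, transformation and limit at infinity\<close>

definition inv_sq :: "int \<Rightarrow> real" where
  "inv_sq m = 1 / (max 1 \<bar>of_int m\<bar>)\<^sup>2"

lemma inv_sq_pos: "inv_sq m > 0"
  by (simp add: inv_sq_def)

text \<open>The exact total is wanted because the non-vanishing of E_4 at i comes down to a
  numerical comparison with it.\<close>

lemma has_sum_inv_sq: "(inv_sq has_sum (1 + pi\<^sup>2 / 3)) UNIV"
proof -
  have nn: "\<And>n. 0 \<le> 1 / (real n + 1)\<^sup>2" by simp
  have s: "((\<lambda>n::nat. 1 / (real n + 1)\<^sup>2) has_sum (pi\<^sup>2 / 6)) UNIV"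
    using inverse_squares_sums sums_nonneg_imp_has_sum[OF inverse_squares_sums] nn by (simp add: add.commute)
  have pos: "(inv_sq has_sum (pi\<^sup>2/6)) {1..}"
  proof -
    have "bij_betw (\<lambda>n::nat. int n + 1) UNIV {1..}"
      by (rule bij_betwI[where g = "\<lambda>m. nat (m - 1)"]) auto
    from has_sum_reindex_bij_betw[OF this, of inv_sq "pi\<^sup>2/6"]
    show ?thesis using s by (simp add: inv_sq_def max_def algebra_simps)
  qed
  have neg: "(inv_sq has_sum (pi\<^sup>2/6)) {..-1}"
  proof -
    have "bij_betw (\<lambda>n::int. - n) {1..} {..-1}"
      by (rule bij_betwI[where g = "\<lambda>n. -n"]) auto
    from has_sum_reindex_bij_betw[OF this, of inv_sq "pi\<^sup>2/6"]
    moreover have "inv_sq (- n) = inv_sq n" for n by (simp add: inv_sq_def)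
    ultimately show ?thesis using pos by simp
  qed
  have zero: "(inv_sq has_sum 1) {0}"
    using has_sum_finite[of "{0}" inv_sq] by (simp add: inv_sq_def)
  have "(inv_sq has_sum (1 + pi\<^sup>2/6)) ({0} \<union> {1..})"
    by (rule has_sum_Un_disjoint[OF zero pos]) auto
  then have "(inv_sq has_sum ((1 + pi\<^sup>2/6) + pi\<^sup>2/6)) (({0} \<union> {1..}) \<union> {..-1})"
    by (rule has_sum_Un_disjoint[OF _ neg]) auto
  moreover have "({0} \<union> {1..}) \<union> {..-1} = (UNIV :: int set)" by auto
  ultimately show ?thesis by (simp add: algebra_simps)
qed

definition inv_sq2 :: "int \<times> int \<Rightarrow> real" where
  "inv_sq2 = (\<lambda>(m, n). inv_sq m * inv_sq n)"

lemma inv_sq2_pos: "inv_sq2 x > 0"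
  by (cases x) (simp add: inv_sq2_def inv_sq_pos)

lemma has_sum_inv_sq2: "(inv_sq2 has_sum (1 + pi\<^sup>2 / 3)\<^sup>2) UNIV"
proof -
  have 1: "((\<lambda>n. inv_sq2 (m, n)) has_sum (inv_sq m * (1 + pi\<^sup>2/3))) UNIV" for m
    using has_sum_cmult_right[OF has_sum_inv_sq, of "inv_sq m"] by (simp add: inv_sq2_def)
  have 2: "((\<lambda>m. inv_sq m * (1 + pi\<^sup>2/3)) has_sum ((1 + pi\<^sup>2/3) * (1 + pi\<^sup>2/3))) UNIV"
    using has_sum_cmult_left[OF has_sum_inv_sq, of "1 + pi\<^sup>2/3"] .
  have "inv_sq2 summable_on Sigma UNIV (\<lambda>_. UNIV)"
    by (rule summable_on_SigmaI[OF 1]) (use 2 has_sum_imp_summable inv_sq2_pos in \<open>auto intro: less_imp_le\<close>)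
  then have "(inv_sq2 has_sum ((1 + pi\<^sup>2/3) * (1 + pi\<^sup>2/3))) (Sigma UNIV (\<lambda>_. UNIV))"
    by (intro has_sum_SigmaI[OF 1 2])
  then show ?thesis by (simp add: power2_eq_square)
qed

lemma summable_inv_sq2: "inv_sq2 summable_on A"
  by (rule summable_on_subset_banach[OF has_sum_imp_summable[OF has_sum_inv_sq2]]) simp

definition nonzero_pairs :: "(int \<times> int) set" where
  "nonzero_pairs = UNIV - {(0, 0)}"

definition eis_term :: "nat \<Rightarrow> complex \<Rightarrow> int \<times> int \<Rightarrow> complex" where
  "eis_term k \<tau> = (\<lambda>(m, n). 1 / (of_int m * \<tau> + of_int n) ^ k)"

definition eisenstein :: "nat \<Rightarrow> complex \<Rightarrow> complex" where
  "eisenstein k \<tau> = (\<Sum>\<^sub>\<infinity>x\<in>nonzero_pairs. eis_term k \<tau> x)"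

text \<open>The imaginary part of m\<tau> + n controls m; once m is controlled, the real part
  controls n.\<close>

lemma lattice_norm_lower_bound:
  assumes "Im \<tau> \<ge> \<epsilon>" "\<epsilon> > 0" "\<bar>Re \<tau>\<bar> \<le> R" 
  shows "\<bar>of_int m\<bar> * Im \<tau> \<le> cmod (of_int m * \<tau> + of_int n)"
    and "\<bar>of_int n\<bar> \<le> (1 + R / \<epsilon>) * cmod (of_int m * \<tau> + of_int n)"
proof -
  let ?z = "of_int m * \<tau> + of_int n"
  have "\<bar>Im ?z\<bar> \<le> cmod ?z" by (rule abs_Im_le_cmod)
  then show 1: "\<bar>of_int m\<bar> * Im \<tau> \<le> cmod ?z" using assms by (simp add: abs_mult)
  have "\<bar>of_int n\<bar> = \<bar>Re ?z - of_int m * Re \<tau>\<bar>" by simp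
  also have "\<dots> \<le> cmod ?z + \<bar>of_int m\<bar> * \<bar>Re \<tau>\<bar>"
    using abs_Re_le_cmod[of ?z] abs_triangle_ineq4[of "Re ?z" "of_int m * Re \<tau>"] by (simp add: abs_mult)
  also have "\<bar>of_int m\<bar> * \<bar>Re \<tau>\<bar> \<le> (cmod ?z / \<epsilon>) * R"
  proof (rule mult_mono)
    have "\<bar>of_int m\<bar> * \<epsilon> \<le> cmod ?z" using 1 assms(1) mult_left_mono[of \<epsilon> "Im \<tau>" "\<bar>of_int m\<bar>"] by linarith
    then show "\<bar>of_int m\<bar> \<le> cmod ?z / \<epsilon>" using assms by (simp add: field_simps)
  qed (use assms in auto)
  finally show "\<bar>of_int n\<bar> \<le> (1 + R / \<epsilon>) * cmod ?z" by (simp add: algebra_simps)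
qed

text \<open>Both max 1 |m| and max 1 |n| are at most a constant times |m\<tau> + n|, so the product
  of their squares is bounded by a fourth power; this is where k >= 4 enters. The constant depends
  only on \<epsilon> and R, which makes the bound uniform on discs, as the Weierstrass test
  needs.\<close>

lemma eis_term_bound:
  assumes "Im \<tau> \<ge> \<epsilon>" "\<epsilon> > 0" "\<bar>Re \<tau>\<bar> \<le> R" "k \<ge> 4" "x \<in> nonzero_pairs"
  shows "cmod (eis_term k \<tau> x) \<le> (1 / \<epsilon> + 1 + R / \<epsilon>) ^ k * inv_sq2 x"
proof -
  obtain m n where x: "x = (m, n)" by (cases x)
  let ?z = "of_int m * \<tau> + of_int n"
  define A where "A = 1 / \<epsilon> + 1 + R / \<epsilon>"
  define a where "a = max 1 \<bar>real_of_int m\<bar>"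
  define b where "b = max 1 \<bar>real_of_int n\<bar>"
  have A: "A \<ge> 1" using assms by (auto simp: A_def)
  have "\<bar>of_int m\<bar> * \<epsilon> \<le> cmod ?z" 
    using lattice_norm_lower_bound(1)[OF assms(1-3), of m n] assms(1)
      mult_left_mono[of \<epsilon> "Im \<tau>" "\<bar>of_int m\<bar>"] by linarith
  then have m: "\<bar>of_int m\<bar> \<le> 1 / \<epsilon> * cmod ?z" using assms by (simp add: field_simps)
  have n: "\<bar>of_int n\<bar> \<le> (1 + R / \<epsilon>) * cmod ?z" using lattice_norm_lower_bound(2)[OF assms(1-3)] .
  have sum: "\<bar>real_of_int m\<bar> + \<bar>real_of_int n\<bar> \<le> A * cmod ?z"
    using m n unfolding A_def by (simp add: algebra_simps)
  have nz: "m \<noteq> 0 \<or> n \<noteq> 0" using assms(5) x by (auto simp: nonzero_pairs_def)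
  have i1: "m = 0 \<or> \<bar>real_of_int m\<bar> \<ge> 1" "n = 0 \<or> \<bar>real_of_int n\<bar> \<ge> 1" by linarith+
  have a1: "a \<ge> 1" "b \<ge> 1" by (auto simp: a_def b_def)
  have ab: "a \<le> \<bar>real_of_int m\<bar> + \<bar>real_of_int n\<bar>" "b \<le> \<bar>real_of_int m\<bar> + \<bar>real_of_int n\<bar>"
    using i1 nz by (auto simp: a_def b_def)
  have "a\<^sup>2 * b\<^sup>2 \<le> (A * cmod ?z)\<^sup>2 * (A * cmod ?z)\<^sup>2"
    using ab sum a1 by (intro mult_mono power_mono) auto
  also have "\<dots> = (A * cmod ?z) ^ 4" by (simp add: power4_eq_xxxx power2_eq_square)
  also have "\<dots> \<le> (A * cmod ?z) ^ k"
    using assms(4) ab sum a1 by (intro power_increasing) linarith+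
  finally have le: "a\<^sup>2 * b\<^sup>2 \<le> A ^ k * cmod ?z ^ k" by (simp add: power_mult_distrib)
  have ab0: "a\<^sup>2 * b\<^sup>2 > 0" using a1 by simp
  have zk: "cmod ?z ^ k > 0"
    using le ab0 A by (smt (verit) mult_nonneg_nonpos zero_le_power)
  have "cmod (eis_term k \<tau> x) = 1 / cmod ?z ^ k" by (simp add: x eis_term_def norm_divide norm_power)
  also have "\<dots> \<le> A ^ k / (a\<^sup>2 * b\<^sup>2)" using le ab0 zk by (simp add: field_simps)
  also have "\<dots> = A ^ k * inv_sq2 x" by (simp add: x inv_sq2_def inv_sq_def a_def b_def)
  finally show ?thesis by (simp add: A_def)
qed

lemma eis_term_summable:
  assumes "Im \<tau> > 0" "k \<ge> 4"
  shows "eis_term k \<tau> summable_on nonzero_pairs"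
proof -
  have "(\<lambda>x. norm (eis_term k \<tau> x)) summable_on nonzero_pairs"
  proof (rule Infinite_Sum.abs_summable_on_comparison_test'[where g = "\<lambda>x. (1 / Im \<tau> + 1 + \<bar>Re \<tau>\<bar> / Im \<tau>) ^ k * inv_sq2 x"])
    show "(\<lambda>x. (1 / Im \<tau> + 1 + \<bar>Re \<tau>\<bar> / Im \<tau>) ^ k * inv_sq2 x) summable_on nonzero_pairs"
      by (intro summable_on_cmult_right summable_inv_sq2)
  qed (use eis_term_bound[of "Im \<tau>" \<tau> "\<bar>Re \<tau>\<bar>"] assms in auto)
  then show ?thesis by (rule abs_summable_summable)
qed

lemma eisenstein_holomorphic:
  assumes "k \<ge> 4"
  shows "eisenstein k holomorphic_on upper_half_plane"
proof -
  have "\<exists>r>0. ball z r \<subseteq> upper_half_plane \<and> eisenstein k holomorphic_on ball z r" if "Im z > 0" for z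
  proof -
    define r where "r = Im z / 2"
    have r: "r > 0" using that by (simp add: r_def)
    define C where "C = (1 / r + 1 + (\<bar>Re z\<bar> + r) / r) ^ k"
    have reg: "Im \<tau> \<ge> r \<and> \<bar>Re \<tau>\<bar> \<le> \<bar>Re z\<bar> + r" if "\<tau> \<in> cball z r" for \<tau>
    proof -
      have "cmod (z - \<tau>) \<le> r" using that by (simp add: dist_norm)
      then have "\<bar>Re (z - \<tau>)\<bar> \<le> r" "\<bar>Im (z - \<tau>)\<bar> \<le> r"
        using abs_Re_le_cmod abs_Im_le_cmod order_trans by blast+
      moreover have "Im z = 2 * r" by (simp add: r_def)
      ultimately show ?thesis by auto
    qed
    have ul: "uniform_limit (cball z r) (\<lambda>X \<tau>. \<Sum>x\<in>X. eis_term k \<tau> x) (\<lambda>\<tau>. \<Sum>\<^sub>\<infinity>x\<in>nonzero_pairs. eis_term k \<tau> x)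
        (finite_subsets_at_top nonzero_pairs)"
    proof (rule Weierstrass_m_test_general[where M = "\<lambda>x. C * inv_sq2 x"])
      show "norm (eis_term k \<tau> x) \<le> C * inv_sq2 x" if "x \<in> nonzero_pairs" "\<tau> \<in> cball z r" for x \<tau>
        unfolding C_def using eis_term_bound[of r \<tau> "\<bar>Re z\<bar> + r" k x] reg[OF that(2)] r assms that by auto
      show "(\<lambda>x. C * inv_sq2 x) summable_on nonzero_pairs"
        by (intro summable_on_cmult_right summable_inv_sq2)
    qed
    have nz: "of_int m * \<tau> + of_int n \<noteq> (0::complex)" if "(m, n) \<in> nonzero_pairs" "\<tau> \<in> cball z r" for m n \<tau>
    proof
      assume eq: "of_int m * \<tau> + of_int n = (0::complex)"
      then have "of_int m * Im \<tau> = 0" by (simp add: complex_eq_iff)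
      then have "m = 0" using reg[OF that(2)] r by auto
      with eq that(1) show False by (auto simp: nonzero_pairs_def)
    qed
    have holt: "(\<lambda>\<tau>. eis_term k \<tau> x) holomorphic_on cball z r" if "x \<in> nonzero_pairs" for x
    proof -
      obtain m n where x: "x = (m, n)" by (cases x)
      show ?thesis unfolding eis_term_def x using nz that x
        by (auto intro!: holomorphic_intros)
    qed
    have ev: "\<forall>\<^sub>F X in finite_subsets_at_top nonzero_pairs.
        continuous_on (cball z r) (\<lambda>\<tau>. \<Sum>x\<in>X. eis_term k \<tau> x) \<and> (\<lambda>\<tau>. \<Sum>x\<in>X. eis_term k \<tau> x) holomorphic_on ball z r"
    proof (rule eventually_finite_subsets_at_top_weakI)
      fix X assume X: "finite X" "X \<subseteq> nonzero_pairs"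
      then have h: "(\<lambda>\<tau>. \<Sum>x\<in>X. eis_term k \<tau> x) holomorphic_on cball z r"
        using holt by (intro holomorphic_on_sum) auto
      then show "continuous_on (cball z r) (\<lambda>\<tau>. \<Sum>x\<in>X. eis_term k \<tau> x) \<and> (\<lambda>\<tau>. \<Sum>x\<in>X. eis_term k \<tau> x) holomorphic_on ball z r"
        using holomorphic_on_imp_continuous_on holomorphic_on_subset[OF h ball_subset_cball] by auto
    qed
    have "(\<lambda>\<tau>. \<Sum>\<^sub>\<infinity>x\<in>nonzero_pairs. eis_term k \<tau> x) holomorphic_on ball z r"
      using holomorphic_uniform_limit[OF ev ul] by auto
    then have "eisenstein k holomorphic_on ball z r" by (simp add: eisenstein_def[abs_def])
    moreover have "ball z r \<subseteq> upper_half_plane"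
      proof
      fix \<tau> assume "\<tau> \<in> ball z r"
      then have "\<tau> \<in> cball z r" using ball_subset_cball by blast
      then show "\<tau> \<in> upper_half_plane" using reg r by (force simp: upper_half_plane_def)
    qed
    ultimately show ?thesis using r by blast
  qed
  then have "eisenstein k analytic_on upper_half_plane"
    unfolding analytic_on_def upper_half_plane_def by blast
  then show ?thesis by (rule analytic_imp_holomorphic)
qed

lemma eisenstein_plus1: "eisenstein k (\<tau> + 1) = eisenstein k \<tau>"
proof -
  have "bij_betw (\<lambda>(m, n). (m, n + m)) nonzero_pairs nonzero_pairs"
    by (rule bij_betwI[where g = "\<lambda>(m, n). (m, n - m)"]) (auto simp: nonzero_pairs_def)
  from infsum_reindex_bij_betw[OF this, of "eis_term k \<tau>"]
  show ?thesis unfolding eisenstein_def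
    by (simp add: eis_term_def case_prod_unfold algebra_simps)
qed

lemma eisenstein_inversion:
  assumes "Im \<tau> > 0"
  shows "eisenstein k (- 1 / \<tau>) = \<tau> ^ k * eisenstein k \<tau>"
proof -
  have t0: "\<tau> \<noteq> 0" using assms by auto
  have "bij_betw (\<lambda>(m, n). (n, - m)) nonzero_pairs nonzero_pairs"
    by (rule bij_betwI[where g = "\<lambda>(m, n). (- n, m)"]) (auto simp: nonzero_pairs_def)
  from infsum_reindex_bij_betw[OF this, of "eis_term k \<tau>"]
  have r: "(\<Sum>\<^sub>\<infinity>x\<in>nonzero_pairs. eis_term k \<tau> (case x of (m, n) \<Rightarrow> (n, - m))) = eisenstein k \<tau>"
    by (simp add: eisenstein_def)
  have eq: "eis_term k (- 1 / \<tau>) x = \<tau> ^ k * eis_term k \<tau> (case x of (m, n) \<Rightarrow> (n, - m))" for x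
  proof -
    obtain m n where x: "x = (m, n)" by (cases x)
    have "of_int m * (- 1 / \<tau>) + of_int n = (of_int n * \<tau> + of_int (- m)) / \<tau>"
      using t0 by (simp add: field_simps)
    then show ?thesis unfolding x eis_term_def by (simp add: power_divide)
  qed
  have "eisenstein k (- 1 / \<tau>) = (\<Sum>\<^sub>\<infinity>x\<in>nonzero_pairs. \<tau> ^ k * eis_term k \<tau> (case x of (m, n) \<Rightarrow> (n, - m)))"
    unfolding eisenstein_def eq ..
  then show ?thesis using r by (simp add: infsum_cmult_right')
qed

text \<open>The terms with m = 0 do not depend on \<tau>, so they may be evaluated at \<tau> = 0.
  For even k the value is 2 zeta(k).\<close>

definition eis_limit :: "nat \<Rightarrow> complex" where
  "eis_limit k = (\<Sum>\<^sub>\<infinity>x\<in>{x\<in>nonzero_pairs. fst x = 0}. eis_term k 0 x)"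

text \<open>For m non-zero, |m\<tau> + n| >= |m| Im \<tau>, and the square of this inequality
  supplies the factor 1 / (Im \<tau>)^2. So slow a decay is enough: holomorphy and periodicity later
  turn mere convergence to 0 into exponential decay.\<close>

lemma eisenstein_minus_limit_bound:
  assumes "Im \<tau> \<ge> 1" "k \<ge> 4"
  shows "cmod (eisenstein k \<tau> - eis_limit k) \<le> 3 ^ k * (1 + pi\<^sup>2 / 3)\<^sup>2 / (Im \<tau>)\<^sup>2"
proof -
  obtain \<sigma> where s: "Im \<sigma> = Im \<tau>" "\<bar>Re \<sigma>\<bar> \<le> 1/2" "eisenstein k \<sigma> = eisenstein k \<tau>"
    using translate_to_strip[of "eisenstein k" \<tau>] eisenstein_plus1[of k] assms by auto
  define y where "y = Im \<tau>"
  have y: "y \<ge> 1" using assms by (simp add: y_def)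
  define X where "X = {x\<in>nonzero_pairs. fst x = 0}"
  define Z where "Z = {x\<in>nonzero_pairs. fst x \<noteq> 0}"
  have sm: "eis_term k \<sigma> summable_on nonzero_pairs"
    using eis_term_summable[of \<sigma> k] s assms by simp
  then have smX: "eis_term k \<sigma> summable_on X" and smZ: "eis_term k \<sigma> summable_on Z"
    using summable_on_subset_banach[OF sm] by (auto simp: X_def Z_def)
  have "eisenstein k \<sigma> = infsum (eis_term k \<sigma>) (X \<union> Z)"
    unfolding eisenstein_def by (rule arg_cong[where f = "infsum _"]) (auto simp: X_def Z_def)
  also have "\<dots> = infsum (eis_term k \<sigma>) X + infsum (eis_term k \<sigma>) Z"
    by (rule infsum_Un_disjoint[OF smX smZ]) (auto simp: X_def Z_def)
  also have "infsum (eis_term k \<sigma>) X = eis_limit k"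
    unfolding eis_limit_def X_def by (rule infsum_cong) (auto simp: eis_term_def)
  finally have eq: "eisenstein k \<tau> - eis_limit k = infsum (eis_term k \<sigma>) Z" using s(3) by simp
  have bound: "cmod (eis_term k \<sigma> x) \<le> 3 ^ k / y\<^sup>2 * inv_sq2 x" if "x \<in> Z" for x
  proof -
    obtain m n where x: "x = (m, n)" by (cases x)
    let ?z = "of_int m * \<sigma> + of_int n"
    have m0: "m \<noteq> 0" using that x by (auto simp: Z_def)
    then have m1: "\<bar>real_of_int m\<bar> \<ge> 1" by linarith
    define a where "a = max 1 \<bar>real_of_int m\<bar>"
    define b where "b = max 1 \<bar>real_of_int n\<bar>"
    have a: "a = \<bar>real_of_int m\<bar>" "a \<ge> 1" "b \<ge> 1" using m1 by (auto simp: a_def b_def)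
    have ay: "a * y \<le> cmod ?z"
      using lattice_norm_lower_bound(1)[of 1 \<sigma> "1/2" m n] s y by (simp add: a y_def)
    have ge1: "cmod ?z \<ge> 1" using ay a y mult_mono[of 1 a 1 y] by simp
    have bz: "b \<le> 3 * cmod ?z"
      using lattice_norm_lower_bound(2)[of 1 \<sigma> "1/2" n m] s y ge1 by (auto simp: b_def y_def)
    have ay3: "a * y \<le> 3 * cmod ?z" "0 \<le> a * y" using ay ge1 a y by auto
    have "(a * y)\<^sup>2 * b\<^sup>2 \<le> (3 * cmod ?z)\<^sup>2 * (3 * cmod ?z)\<^sup>2"
      using a(3) bz by (intro mult_mono power_mono[OF ay3] power_mono) auto
    also have "\<dots> = (3 * cmod ?z) ^ 4" by (simp add: power4_eq_xxxx power2_eq_square)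
    also have "\<dots> \<le> (3 * cmod ?z) ^ k" using assms(2) ge1 by (intro power_increasing) auto
    finally have le: "y\<^sup>2 * (a\<^sup>2 * b\<^sup>2) \<le> 3 ^ k * cmod ?z ^ k" by (simp add: power_mult_distrib mult_ac)
    have pos: "y\<^sup>2 * (a\<^sup>2 * b\<^sup>2) > 0" using a y by simp
    have zk: "cmod ?z ^ k > 0" using ge1 by (intro zero_less_power) linarith
    have "cmod (eis_term k \<sigma> x) = 1 / cmod ?z ^ k" by (simp add: x eis_term_def norm_divide norm_power)
    also have "\<dots> \<le> 3 ^ k / (y\<^sup>2 * (a\<^sup>2 * b\<^sup>2))" using le pos zk by (simp add: field_simps)
    also have "\<dots> = 3 ^ k / y\<^sup>2 * inv_sq2 x" by (simp add: x inv_sq2_def inv_sq_def a_def b_def)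
    finally show ?thesis .
  qed
  have "cmod (infsum (eis_term k \<sigma>) Z) \<le> 3 ^ k / y\<^sup>2 * infsum inv_sq2 Z"
    using norm_infsum_le[OF has_sum_infsum[OF smZ] has_sum_cmult_right[OF has_sum_infsum[OF summable_inv_sq2]] bound] .
  also have "\<dots> \<le> 3 ^ k / y\<^sup>2 * infsum inv_sq2 UNIV"
    using inv_sq2_pos y
    by (intro mult_left_mono infsum_mono_neutral summable_inv_sq2) (auto intro: less_imp_le)
  also have "infsum inv_sq2 UNIV = (1 + pi\<^sup>2/3)\<^sup>2" using has_sum_inv_sq2 by (rule infsumI)
  finally show ?thesis unfolding eq by (simp add: y_def)
qed

lemma eisenstein_tendsto:
  assumes "k \<ge> 4"
  shows "(eisenstein k \<longlongrightarrow> eis_limit k) (filtercomap Im at_top)"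
proof -
  define C where "C = 3 ^ k * (1 + pi\<^sup>2 / 3)\<^sup>2"
  have "filterlim (\<lambda>\<tau>. C / (Im \<tau>)\<^sup>2) (nhds 0) (filtercomap Im at_top)"
  proof -
    have "((\<lambda>y::real. C / y\<^sup>2) \<longlongrightarrow> 0) at_top" by real_asymp
    then show ?thesis by (rule filterlim_compose[OF _ filterlim_filtercomap])
  qed
  moreover have "\<forall>\<^sub>F \<tau> in filtercomap Im at_top. norm (eisenstein k \<tau> - eis_limit k) \<le> C / (Im \<tau>)\<^sup>2"
    unfolding eventually_filtercomap_at_top_linorder
    using eisenstein_minus_limit_bound[OF _ assms] C_def by (metis times_divide_eq_left)
  ultimately have "((\<lambda>\<tau>. eisenstein k \<tau> - eis_limit k) \<longlongrightarrow> 0) (filtercomap Im at_top)"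
    by (rule Lim_null_comparison[rotated])
  then show ?thesis by (simp add: LIM_zero_iff)
qed

text \<open>For even k all terms 1/n^k are positive and cannot cancel.\<close>

lemma eis_limit_nonzero:
  assumes "even k" "k \<ge> 4"
  shows "eis_limit k \<noteq> 0"
proof -
  define X where "X = {x\<in>nonzero_pairs. fst x = 0}"
  have sm: "eis_term k 0 summable_on X"
  proof -
    have "eis_term k \<i> summable_on X"
      using summable_on_subset_banach[OF eis_term_summable[of \<i> k]] assms by (auto simp: X_def)
    then show ?thesis by (rule summable_on_cong[THEN iffD1, rotated]) (auto simp: X_def eis_term_def)
  qed
  have val: "eis_term k 0 x = of_real (1 / \<bar>real_of_int (snd x)\<bar> ^ k)" for x
    using assms(1) by (simp add: eis_term_def case_prod_unfold power_even_abs)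
  have smr: "(\<lambda>x. 1 / \<bar>real_of_int (snd x)\<bar> ^ k) summable_on X"
    using sm[unfolded summable_on_iff_abs_summable_on_complex] unfolding val norm_of_real by simp
  have "sum (\<lambda>x. 1 / \<bar>real_of_int (snd x)\<bar> ^ k) {(0::int,1::int)} \<le> (\<Sum>\<^sub>\<infinity>x\<in>X. 1 / \<bar>real_of_int (snd x)\<bar> ^ k)"
    using smr by (intro finite_sum_le_infsum) (auto simp: X_def nonzero_pairs_def)
  then have "(\<Sum>\<^sub>\<infinity>x\<in>X. 1 / \<bar>real_of_int (snd x)\<bar> ^ k) \<noteq> 0" by auto
  moreover have "eis_limit k = of_real (\<Sum>\<^sub>\<infinity>x\<in>X. 1 / \<bar>real_of_int (snd x)\<bar> ^ k)"
    unfolding eis_limit_def X_def[symmetric] val by (intro infsumI has_sum_of_real has_sum_infsum smr)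
  ultimately show ?thesis by simp
qed

text \<open>The four units contribute \<open>4\<close> to \<open>\<Sum> (m \<i> + n)\<^bsup>-4\<^esup>\<close>; the other terms have modulus at most
  \<open>inv_sq m * inv_sq n / 4\<close>, and these bounds add up to less than \<open>4\<close>.\<close>

lemma eisenstein_4_ii_nonzero: "eisenstein 4 \<i> \<noteq> 0"
proof -
  define U where "U = {(1, 0), (-1, 0), (0, 1), (0, - 1) :: int \<times> int}"
  have U: "U \<subseteq> nonzero_pairs" "finite U" by (auto simp: U_def nonzero_pairs_def)
  have sm: "eis_term 4 \<i> summable_on nonzero_pairs" by (rule eis_term_summable) auto
  then have smZ: "eis_term 4 \<i> summable_on (nonzero_pairs - U)"
    by (rule summable_on_subset_banach) auto
  have "eisenstein 4 \<i> = infsum (eis_term 4 \<i>) (U \<union> (nonzero_pairs - U))"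
    unfolding eisenstein_def using U by (intro arg_cong[where f = "infsum _"]) auto
  also have "\<dots> = infsum (eis_term 4 \<i>) U + infsum (eis_term 4 \<i>) (nonzero_pairs - U)"
    using U smZ by (intro infsum_Un_disjoint) auto
  also have "infsum (eis_term 4 \<i>) U = 4"
    by (simp add: U_def eis_term_def)
  finally have eq: "eisenstein 4 \<i> = 4 + infsum (eis_term 4 \<i>) (nonzero_pairs - U)" .
  have bound: "cmod (eis_term 4 \<i> x) \<le> 1/4 * inv_sq2 x" if xU: "x \<in> nonzero_pairs - U" for x
  proof -
    obtain m n where x: "x = (m, n)" by (cases x)
    define a where "a = real_of_int m"
    define b where "b = real_of_int n"
    have cm: "cmod (of_int m * \<i> + of_int n) ^ 4 = (a\<^sup>2 + b\<^sup>2)\<^sup>2"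
    proof -
      have "(cmod (of_int m * \<i> + of_int n))\<^sup>2 = a\<^sup>2 + b\<^sup>2"
        by (simp add: cmod_power2 a_def b_def add.commute)
      then show ?thesis by (metis mult_2 numeral_Bit0 power_mult power2_eq_square power_add)
    qed
    have le: "4 * ((max 1 \<bar>a\<bar>)\<^sup>2 * (max 1 \<bar>b\<bar>)\<^sup>2) \<le> (a\<^sup>2 + b\<^sup>2)\<^sup>2"
    proof -
      consider "m \<noteq> 0" "n \<noteq> 0" | "m = 0" "\<bar>n\<bar> \<ge> 2" | "n = 0" "\<bar>m\<bar> \<ge> 2"
        using xU x by (cases "m = 0"; cases "n = 0") (auto simp: U_def nonzero_pairs_def)
      then show ?thesis
      proof cases
        case 1
        then have "\<bar>a\<bar> \<ge> 1" "\<bar>b\<bar> \<ge> 1" unfolding a_def b_def by linarith+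
        then have "max 1 \<bar>a\<bar> = \<bar>a\<bar>" "max 1 \<bar>b\<bar> = \<bar>b\<bar>" by auto
        moreover have "(a\<^sup>2 + b\<^sup>2)\<^sup>2 - 4 * (a\<^sup>2 * b\<^sup>2) = (a\<^sup>2 - b\<^sup>2)\<^sup>2" by algebra
        ultimately show ?thesis using zero_le_power2[of "a\<^sup>2 - b\<^sup>2"]
          by (simp only: power2_abs)
      next
        case 2
        then have b: "\<bar>b\<bar> \<ge> 2" unfolding b_def by linarith
        then have "max 1 \<bar>b\<bar> = \<bar>b\<bar>" by auto
        moreover have "b\<^sup>2 \<ge> 2\<^sup>2" using b by (metis abs_numeral abs_le_square_iff)
        ultimately show ?thesis using 2 mult_right_mono[of 4 "b\<^sup>2" "b\<^sup>2"]
          by (simp add: a_def power2_eq_square[of "b\<^sup>2"])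
      next
        case 3
        then have b: "\<bar>a\<bar> \<ge> 2" unfolding a_def by linarith
        then have "max 1 \<bar>a\<bar> = \<bar>a\<bar>" by auto
        moreover have "a\<^sup>2 \<ge> 2\<^sup>2" using b by (metis abs_numeral abs_le_square_iff)
        ultimately show ?thesis using 3 mult_right_mono[of 4 "a\<^sup>2" "a\<^sup>2"]
          by (simp add: b_def power2_eq_square[of "a\<^sup>2"])
      qed
    qed
    have pos: "(max 1 \<bar>a\<bar>)\<^sup>2 * (max 1 \<bar>b\<bar>)\<^sup>2 > 0" by simp
    have "cmod (eis_term 4 \<i> x) = 1 / (a\<^sup>2 + b\<^sup>2)\<^sup>2"
      using cm by (simp add: x eis_term_def norm_divide norm_power)
    also have "\<dots> \<le> 1 / (4 * ((max 1 \<bar>a\<bar>)\<^sup>2 * (max 1 \<bar>b\<bar>)\<^sup>2))"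
      using le pos by (intro frac_le) auto
    also have "\<dots> = 1/4 * inv_sq2 x" by (simp add: x inv_sq2_def inv_sq_def a_def b_def)
    finally show ?thesis .
  qed
  have "cmod (infsum (eis_term 4 \<i>) (nonzero_pairs - U)) \<le> 1/4 * infsum inv_sq2 (nonzero_pairs - U)"
    using norm_infsum_le[OF has_sum_infsum[OF smZ] has_sum_cmult_right[OF has_sum_infsum[OF summable_inv_sq2]] bound] .
  also have "infsum inv_sq2 (nonzero_pairs - U) = (1 + pi\<^sup>2/3)\<^sup>2 - 5"
  proof -
    have "infsum inv_sq2 UNIV = infsum inv_sq2 (insert (0,0) U \<union> (nonzero_pairs - U))"
      by (intro arg_cong[where f = "infsum _"]) (auto simp: nonzero_pairs_def)
    also have "\<dots> = infsum inv_sq2 (insert (0,0) U) + infsum inv_sq2 (nonzero_pairs - U)"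
      by (intro infsum_Un_disjoint summable_inv_sq2) (auto simp: nonzero_pairs_def)
    also have "infsum inv_sq2 (insert (0,0) U) = 5"
      by (simp add: U_def inv_sq2_def inv_sq_def)
    finally show ?thesis using infsumI[OF has_sum_inv_sq2] by simp
  qed
  also have "1/4 * ((1 + pi\<^sup>2/3)\<^sup>2 - 5) < 4"
  proof -
    have "pi \<le> 3.15" using pi_approx by simp
    then have "pi\<^sup>2 \<le> 3.15\<^sup>2" by (intro power_mono) auto
    then have "1 + pi\<^sup>2/3 \<le> 4.31" by (simp add: power2_eq_square)
    then have "(1 + pi\<^sup>2/3)\<^sup>2 \<le> 4.31\<^sup>2" by (intro power_mono) auto
    moreover have "(4.31::real)\<^sup>2 < 21" by (simp add: power2_eq_square)
    ultimately have "(1 + pi\<^sup>2/3)\<^sup>2 < 21" by (rule le_less_trans)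
    then show ?thesis by simp
  qed
  finally have "cmod (infsum (eis_term 4 \<i>) (nonzero_pairs - U)) < 4" .
  moreover have "cmod (infsum (eis_term 4 \<i>) (nonzero_pairs - U)) = 4" if "eisenstein 4 \<i> = 0"
  proof -
    have "infsum (eis_term 4 \<i>) (nonzero_pairs - U) = - 4"
      using eq that by (metis add_eq_0_iff)
    then show ?thesis by simp
  qed
  ultimately show ?thesis by linarith
qed

section \<open>Exponential decay and the cusp form of weight 12\<close>

lemma periodic_eq:
  assumes T: "\<And>\<tau>. Im \<tau> > 0 \<Longrightarrow> f (\<tau> + 1) = f \<tau>"
    and "Im \<tau> > 0" "ee \<tau> = ee \<sigma>"
  shows "f \<tau> = f \<sigma>"
proof -
  obtain n :: int where "2 * of_real pi * \<i> * \<tau> = 2 * of_real pi * \<i> * \<sigma> + of_int (2 * n) * (of_real pi * \<i>)"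
    using assms(3) unfolding ee_def exp_eq by auto
  then have "(2 * of_real pi * \<i>) * \<tau> = (2 * of_real pi * \<i>) * (\<sigma> + of_int n)" by (simp add: algebra_simps)
  then have "\<tau> = \<sigma> + of_int n" by simp
  then have "\<sigma> = \<tau> + of_int (- n)" by simp
  then show ?thesis using translate_int[of f \<tau> "- n"] T assms(2) by simp
qed

lemma norm_ee: "cmod (ee \<tau>) = exp (- 2 * pi * Im \<tau>)"
  by (simp add: ee_def)

text \<open>f is a function of e(\<tau>) on the punctured unit disc. As it tends to 0, the puncture
  is removable with value 0, and a bound for the derivative on the disc of radius e^(-2 pi) gives an
  estimate linear in |e(\<tau>)|.\<close>

lemma periodic_decay:
  assumes hol: "f holomorphic_on upper_half_plane"
    and T: "\<And>\<tau>. Im \<tau> > 0 \<Longrightarrow> f (\<tau> + 1) = f \<tau>"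
    and lim: "(f \<longlongrightarrow> 0) (filtercomap Im at_top)"
  shows "\<exists>C\<ge>0. \<forall>\<tau>. Im \<tau> \<ge> 1 \<longrightarrow> cmod (f \<tau>) \<le> C * exp (- 2 * pi * Im \<tau>)"
proof -
  define lg where "lg z = Ln z / (2 * of_real pi * \<i>)" for z
  define g where "g z = f (lg z)" for z
  have ee_lg: "ee (lg z) = z" if "z \<noteq> 0" for z using that by (simp add: ee_def lg_def)
  have Im_pos: "Im \<tau> > 0" if "cmod (ee \<tau>) < 1" for \<tau>
  proof -
    have "- 2 * pi * Im \<tau> < 0" using that by (simp only: norm_ee exp_less_one_iff)
    then have "pi * Im \<tau> > 0" by linarith
    then show ?thesis by (simp add: zero_less_mult_iff)
  qed
  have g_eq: "f \<tau> = g z" if "ee \<tau> = z" "cmod z < 1" for \<tau> z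
  proof -
    have "z \<noteq> 0" using that by (auto simp: ee_def)
    then show ?thesis unfolding g_def using periodic_eq[of f \<tau> "lg z"] T that Im_pos ee_lg by auto
  qed
  have holg: "g holomorphic_on ball 0 1 - {0}"
  proof -
    have "\<exists>r>0. g holomorphic_on ball z0 r" if z0: "z0 \<in> ball 0 1 - {0}" for z0
    proof -
      define r where "r = min (cmod z0) (1 - cmod z0)"
      have r: "r > 0" using z0 by (auto simp: r_def)
      \<comment> \<open>A branch of the logarithm near \<open>z0\<close>: the principal
        \<open>Ln\<close> jumps on the negative axis, but z / z0 stays in the right half plane. By
        periodicity \<open>g\<close> does not see the choice of branch.\<close>
      define h where "h z = lg z0 + lg (z / z0)" for z
      have eh: "ee (h z) = z" if "z \<noteq> 0" for z
        using z0 ee_lg[of z0] ee_lg[of "z / z0"] that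
        by (simp add: h_def ee_def ring_distribs exp_add)
      have inb: "z \<noteq> 0" "cmod z < 1" "z / z0 \<notin> \<real>\<^sub>\<le>\<^sub>0" if "z \<in> ball z0 r" for z
      proof -
        have d: "cmod (z0 - z) < cmod z0" "cmod (z0 - z) < 1 - cmod z0" using that by (auto simp: r_def dist_norm)
        show "z \<noteq> 0" using d by auto
        show "cmod z < 1" using d norm_triangle_ineq2[of z z0] by (simp add: norm_minus_commute)
        have "cmod (1 - z / z0) < 1"
          using d z0 by (simp add: field_simps flip: norm_divide) (metis d(1) diff_divide_distrib divide_less_eq_1 norm_divide norm_le_zero_iff not_le divide_self_if)
        then have "Re (z / z0) > 0" using complex_Re_le_cmod[of "1 - z / z0"] by simp
        then show "z / z0 \<notin> \<real>\<^sub>\<le>\<^sub>0" by (auto simp: complex_nonpos_Reals_iff)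
      qed
      have "h holomorphic_on ball z0 r"
        unfolding h_def lg_def using inb z0 by (intro holomorphic_intros) auto
      moreover have "h ` ball z0 r \<subseteq> upper_half_plane"
        using inb eh Im_pos by (auto simp: upper_half_plane_def)
      ultimately have "(f \<circ> h) holomorphic_on ball z0 r"
        using hol by (intro holomorphic_on_compose_gen[of h _ f upper_half_plane])
      moreover have "(f \<circ> h) z = g z" if "z \<in> ball z0 r" for z
        using g_eq eh inb that by simp
      ultimately have "g holomorphic_on ball z0 r" by (rule holomorphic_transform)
      then show ?thesis using r by blast
    qed
    then have "g analytic_on ball 0 1 - {0}" unfolding analytic_on_def by blast
    then show ?thesis by (rule analytic_imp_holomorphic)
  qed
  have limg: "g \<midarrow>0\<rightarrow> 0"
  proof (rule LIM_I)
    fix \<epsilon> :: real assume e: "\<epsilon> > 0"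
    have "\<forall>\<^sub>F \<tau> in filtercomap Im at_top. cmod (f \<tau>) < \<epsilon>"
      using tendstoD[OF lim e] by simp
    then obtain Y where Y: "\<And>\<tau>. Im \<tau> > Y \<Longrightarrow> cmod (f \<tau>) < \<epsilon>"
      unfolding eventually_filtercomap_at_top_dense by blast
    have "cmod (g z - 0) < \<epsilon>" if "z \<noteq> 0" "cmod (z - 0) < exp (- 2 * pi * Y)" for z
    proof -
      have "exp (- 2 * pi * Im (lg z)) < exp (- 2 * pi * Y)"
        using that ee_lg[of z] norm_ee[of "lg z"] by simp
      then have "Im (lg z) > Y" by (simp add: mult_less_cancel_left_pos)
      then show ?thesis using Y by (simp add: g_def)
    qed
    then show "\<exists>s>0. \<forall>x. x \<noteq> 0 \<and> cmod (x - 0) < s \<longrightarrow> cmod (g x - 0) < \<epsilon>"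
      by (intro exI[of _ "exp (- 2 * pi * Y)"]) auto
  qed
  define G where "G z = (if z = 0 then 0 else g z)" for z
  have holG: "G holomorphic_on ball 0 1"
    unfolding G_def using removable_singularity[OF holg open_ball limg] .
  define R where "R = exp (- 2 * pi)"
  have R: "R > 0" "R < 1" by (auto simp: R_def)
  have holG': "deriv G holomorphic_on ball 0 1" using holG by (intro holomorphic_deriv) auto
  have "continuous_on (cball 0 R) (deriv G)"
    using holomorphic_on_imp_continuous_on[OF holG'] by (rule continuous_on_subset) (use R in auto)
  then have "compact (deriv G ` cball 0 R)" by (intro compact_continuous_image) auto
  then have "bounded (deriv G ` cball 0 R)" by (rule compact_imp_bounded)
  then obtain B where B: "\<And>z. z \<in> cball 0 R \<Longrightarrow> cmod (deriv G z) \<le> B"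
    unfolding bounded_iff by blast
  have "cmod (f \<tau>) \<le> B * exp (- 2 * pi * Im \<tau>)" if "Im \<tau> \<ge> 1" for \<tau>
  proof -
    define z where "z = ee \<tau>"
    have n: "cmod z = exp (- 2 * pi * Im \<tau>)" by (simp add: z_def norm_ee)
    have zR: "z \<in> cball 0 R" using n that by (simp add: R_def)
    have "cmod (G z - G 0) \<le> B * cmod (z - 0)"
    proof (rule field_differentiable_bound[where S = "cball 0 R" and f' = "deriv G"])
      show "(G has_field_derivative deriv G w) (at w within cball 0 R)" if "w \<in> cball 0 R" for w
        using holomorphic_derivI[OF holG open_ball, of w] that R by (auto intro: has_field_derivative_at_within)
    qed (use zR R B in auto)
    moreover have "z \<noteq> 0" by (simp add: z_def ee_def)
    moreover have "f \<tau> = g z" using g_eq[of \<tau> z] zR R by (auto simp: z_def)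
    ultimately show ?thesis using n by (simp add: G_def)
  qed
  moreover have "B \<ge> 0" using B[of 0] R norm_ge_zero[of "deriv G 0"] by (simp del: norm_ge_zero)
  ultimately show ?thesis by blast
qed

text \<open>A multiple of the modular discriminant. The limits of E_4^3 and E_6^2 at infinity are
  cross-multiplied so that they cancel, which avoids computing zeta values.\<close>

definition cusp12 :: "complex \<Rightarrow> complex" where
  "cusp12 \<tau> = eis_limit 6 ^ 2 * eisenstein 4 \<tau> ^ 3 - eis_limit 4 ^ 3 * eisenstein 6 \<tau> ^ 2"

lemma cusp12_holomorphic: "cusp12 holomorphic_on upper_half_plane"
  unfolding cusp12_def by (intro holomorphic_intros eisenstein_holomorphic) auto

lemma cusp12_plus1: "cusp12 (\<tau> + 1) = cusp12 \<tau>"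
  by (simp add: cusp12_def eisenstein_plus1)

lemma cusp12_inversion: "Im \<tau> > 0 \<Longrightarrow> cusp12 (- 1 / \<tau>) = \<tau> ^ 12 * cusp12 \<tau>"
  unfolding cusp12_def eisenstein_inversion power_mult_distrib power_mult[symmetric]
  by (simp add: algebra_simps)

lemma cusp12_decay:
  obtains C where "C \<ge> 0" "\<And>\<tau>. Im \<tau> \<ge> 1 \<Longrightarrow> cmod (cusp12 \<tau>) \<le> C * exp (- 2 * pi * Im \<tau>)"
proof -
  have "(cusp12 \<longlongrightarrow> eis_limit 6 ^ 2 * eis_limit 4 ^ 3 - eis_limit 4 ^ 3 * eis_limit 6 ^ 2) (filtercomap Im at_top)"
    unfolding cusp12_def by (intro tendsto_intros eisenstein_tendsto) auto
  then have "(cusp12 \<longlongrightarrow> 0) (filtercomap Im at_top)" by simp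
  from periodic_decay[OF cusp12_holomorphic cusp12_plus1 this] show ?thesis using that by blast
qed

text \<open>The point i is fixed by inversion and i^6 = -1, so E_6 vanishes there and only the E_4
  term is left.\<close>

lemma cusp12_ii_nonzero: "cusp12 \<i> \<noteq> 0"
proof -
  have "eisenstein 6 \<i> = - eisenstein 6 \<i>"
    using eisenstein_inversion[of \<i> 6] by (simp add: power_numeral_reduce flip: minus_divide_left)
  then have "eisenstein 6 \<i> = 0" by simp
  then show ?thesis
    using eisenstein_4_ii_nonzero eis_limit_nonzero[of 6] by (simp add: cusp12_def)
qed

text \<open>Otherwise some rational b/a lies strictly between E and -K/12. Then f^a times the b-th
  power of the cusp form has negative weight and is bounded at infinity, hence vanishes. So f is 0
  wherever the cusp form is not, and everywhere by analytic continuation.\<close>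

theorem valence_inequality:
  fixes f :: "complex \<Rightarrow> complex" and K :: int
  assumes hol: "f holomorphic_on upper_half_plane"
    and T: "\<And>\<tau>. Im \<tau> > 0 \<Longrightarrow> cmod (f (\<tau> + 1)) = cmod (f \<tau>)"
    and S: "\<And>\<tau>. Im \<tau> > 0 \<Longrightarrow> cmod (f (- 1 / \<tau>)) = cmod \<tau> powi K * cmod (f \<tau>)"
    and bd: "\<And>\<tau>. Im \<tau> \<ge> 1 \<Longrightarrow> cmod (f \<tau>) \<le> C * exp (2 * pi * E * Im \<tau>)"
    and E: "E \<ge> 0"
    and nz: "Im \<tau>1 > 0" "f \<tau>1 \<noteq> 0"
  shows "- real_of_int K / 12 \<le> E"
proof (rule ccontr)
  assume "\<not> ?thesis"
  then have "E < - real_of_int K / 12" by simp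
  then obtain r where r: "r \<in> \<rat>" "E < r" "r < - real_of_int K / 12"
    using Rats_dense_in_real by blast
  have "\<exists>b a :: nat. a \<noteq> 0 \<and> \<bar>r\<bar> = real b / real a"
    using r(1) by (elim Rats_abs_nat_div_natE) blast
  then obtain a b :: nat where ab: "r = real b / real a" "a \<noteq> 0"
    using r(2) E by (auto simp: abs_if split: if_splits)
  have ba: "12 * int b < - K * int a"
  proof -
    have "12 * real b < - real_of_int K * real a" using r ab by (simp add: field_simps)
    then have "real_of_int (12 * int b) < real_of_int (- K * int a)" by simp
    then show ?thesis using of_int_less_iff by blast
  qed
  define s where "s = nat (- (K * int a + 12 * int b))"
  have s: "s > 0" "int s = - (K * int a + 12 * int b)" using ba by (auto simp: s_def)
  obtain C' where C': "C' \<ge> 0" "\<And>\<tau>. Im \<tau> \<ge> 1 \<Longrightarrow> cmod (cusp12 \<tau>) \<le> C' * exp (- 2 * pi * Im \<tau>)"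
    using cusp12_decay by blast
  define \<Psi> where "\<Psi> \<tau> = f \<tau> ^ a * cusp12 \<tau> ^ b" for \<tau>
  have C0: "C \<ge> 0"
  proof -
    have "0 \<le> C * exp (2 * pi * E)" using bd[of \<i>] norm_ge_zero[of "f \<i>"] by (simp del: norm_ge_zero)
    then show ?thesis by (simp add: zero_le_mult_iff)
  qed
  have "\<Psi> \<tau> = 0" if "Im \<tau> > 0" for \<tau>
  proof (rule negative_weight_vanishes[OF _ _ _ s(1) _ that])
    show "\<Psi> holomorphic_on upper_half_plane"
      unfolding \<Psi>_def by (intro holomorphic_intros hol cusp12_holomorphic)
    show "cmod (\<Psi> (\<tau> + 1)) = cmod (\<Psi> \<tau>)" if "Im \<tau> > 0" for \<tau>
      using T[OF that] by (simp add: \<Psi>_def norm_mult norm_power cusp12_plus1)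
    show "cmod (\<Psi> (- 1 / \<tau>)) * cmod \<tau> ^ s = cmod (\<Psi> \<tau>)" if t: "Im \<tau> > 0" for \<tau>
    proof -
      have c0: "cmod \<tau> \<noteq> 0" using t by auto
      have "cmod (\<Psi> (- 1 / \<tau>)) * cmod \<tau> ^ s =
        (cmod \<tau> powi K) ^ a * (cmod \<tau> ^ 12) ^ b * cmod \<tau> ^ s * cmod (\<Psi> \<tau>)"
        by (simp add: \<Psi>_def norm_mult norm_power S[OF t, simplified] cusp12_inversion[OF t, simplified] power_mult_distrib)
      also have "(cmod \<tau> powi K) ^ a * (cmod \<tau> ^ 12) ^ b * cmod \<tau> ^ s
          = cmod \<tau> powi (K * int a + 12 * int b + int s)"
        using c0 by (simp add: power_int_add power_int_mult power_int_power power_mult)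
      also have "\<dots> = 1" using s by simp
      finally show ?thesis by simp
    qed
    show "cmod (\<Psi> \<tau>) \<le> C ^ a * C' ^ b" if t: "Im \<tau> \<ge> 1" for \<tau>
    proof -
      have "cmod (\<Psi> \<tau>) \<le> (C * exp (2 * pi * E * Im \<tau>)) ^ a * (C' * exp (- 2 * pi * Im \<tau>)) ^ b"
        unfolding \<Psi>_def norm_mult norm_power using bd[OF t] C'(2)[OF t] C0
        by (intro mult_mono power_mono) auto
      also have "\<dots> = (C ^ a * C' ^ b) * exp (2 * pi * Im \<tau> * (E * real a - real b))"
        by (simp add: power_mult_distrib algebra_simps exp_diff exp_minus field_simps flip: exp_of_nat_mult)
      also have "\<dots> \<le> (C ^ a * C' ^ b) * 1"
      proof (intro mult_left_mono)
        have "E * real a - real b \<le> 0" using r ab by (simp add: field_simps)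
        then show "exp (2 * pi * Im \<tau> * (E * real a - real b)) \<le> 1"
          using t by (simp add: mult_nonneg_nonpos)
      qed (use C0 C'(1) in auto)
      finally show ?thesis by simp
    qed
  qed
  then have prod0: "f \<tau> = 0 \<or> cusp12 \<tau> = 0" if "Im \<tau> > 0" for \<tau> using that by (fastforce simp: \<Psi>_def)
  have "continuous_on upper_half_plane cusp12"
    using cusp12_holomorphic holomorphic_on_imp_continuous_on by blast
  then have op: "open {\<tau> \<in> upper_half_plane. cusp12 \<tau> \<in> - {0}}"
    using continuous_open_preimage[OF _ open_upper_half_plane, of cusp12 "- {0}"] open_delete[OF open_UNIV, of 0]
    by (simp add: vimage_def Int_def Compl_eq_Diff_UNIV)
  have "f \<tau>1 = 0"
  proof (rule analytic_continuation_open[where f = f and g = "\<lambda>_. 0", OF op open_upper_half_plane])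
    show "{\<tau> \<in> upper_half_plane. cusp12 \<tau> \<in> - {0}} \<noteq> {}"
      using cusp12_ii_nonzero by (auto simp: upper_half_plane_def intro!: exI[of _ \<i>])
    show "connected upper_half_plane" by (simp add: convex_connected convex_upper_half_plane)
    show "f z = 0" if "z \<in> {\<tau> \<in> upper_half_plane. cusp12 \<tau> \<in> - {0}}" for z
      using prod0[of z] that by (auto simp: upper_half_plane_def)
  qed (use hol nz in \<open>auto simp: upper_half_plane_def\<close>)
  then show False using nz by simp
qed

section \<open>Discriminant forms\<close>

lemma eq_mod1_refl [simp]: "eq_mod1 x x"
  by (simp add: eq_mod1_def)

lemma eq_mod1_sym: "eq_mod1 x y \<Longrightarrow> eq_mod1 y x"
  unfolding eq_mod1_def by (metis Ints_minus minus_diff_eq)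

lemma eq_mod1_trans [trans]: "eq_mod1 x y \<Longrightarrow> eq_mod1 y z \<Longrightarrow> eq_mod1 x z"
  unfolding eq_mod1_def by (metis Ints_add diff_add_cancel add_diff_eq)

lemma eq_mod1_add: "eq_mod1 x y \<Longrightarrow> eq_mod1 x' y' \<Longrightarrow> eq_mod1 (x + x') (y + y')"
  unfolding eq_mod1_def by (metis Ints_add add_diff_add)

lemma eq_mod1_minus: "eq_mod1 x y \<Longrightarrow> eq_mod1 (- x) (- y)"
  unfolding eq_mod1_def by (metis Ints_minus minus_diff_minus)

lemma eq_mod1_diff: "eq_mod1 x y \<Longrightarrow> eq_mod1 x' y' \<Longrightarrow> eq_mod1 (x - x') (y - y')"
  using eq_mod1_add[of x y "- x'" "- y'"] eq_mod1_minus by simp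

lemma eq_mod1_mult_int: "eq_mod1 x y \<Longrightarrow> eq_mod1 (of_int c * x) (of_int c * y)"
  unfolding eq_mod1_def by (metis Ints_mult Ints_of_int right_diff_distrib)

lemma eq_mod1_diff_eq: "eq_mod1 a b \<Longrightarrow> x - y = a - b \<Longrightarrow> eq_mod1 x y"
  by (simp add: eq_mod1_def)

lemma eq_mod1_0_iff: "eq_mod1 x 0 \<longleftrightarrow> x \<in> \<int>"
  by (simp add: eq_mod1_def)

lemma eq_mod1_Ints_iff: "eq_mod1 x y \<Longrightarrow> x \<in> \<int> \<longleftrightarrow> y \<in> \<int>"
  using eq_mod1_trans eq_mod1_sym unfolding eq_mod1_0_iff[symmetric] by blast

lemma int_mult_Ints: "x \<in> \<int> \<Longrightarrow> of_int c * (x::rat) \<in> \<int>"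
  by simp

subsection \<open>Integer multiples\<close>

lemma zmul_0 [simp]: "zmul 0 g = 0"
  by (simp add: zmul_def)

lemma zmul_Suc_right: "zmul (c + 1) g = zmul c g + g"
proof -
  consider "c \<ge> 0" | "c = - 1" | "c < - 1" by linarith
  then show ?thesis
  proof cases
    case 1
    then have "nat (c + 1) = Suc (nat c)" by simp
    then show ?thesis using 1 by (simp add: zmul_def)
  next
    case 2
    then show ?thesis by (simp add: zmul_def)
  next
    case 3
    then have "nat (- c) = Suc (nat (- (c + 1)))" by simp
    then show ?thesis using 3 by (simp add: zmul_def)
  qed
qed

lemma zmul_pred_right: "zmul (c - 1) g = zmul c g - g"
  using zmul_Suc_right[of "c - 1" g] by (simp add: algebra_simps)

lemma zmul_1 [simp]: "zmul 1 g = g"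
  using zmul_Suc_right[of 0 g] by simp

lemma zmul_add_left: "zmul (c + d) g = zmul c g + zmul d g"
proof (induction d rule: int_induct[where k = 0])
  case (step1 i)
  then show ?case using zmul_Suc_right[of "c + i" g] zmul_Suc_right[of i g] by (metis add.assoc)
next
  case (step2 i)
  then show ?case using zmul_pred_right[of "c + i" g] zmul_pred_right[of i g] by (metis add_diff_eq)
qed simp

lemma zmul_zero_right [simp]: "zmul c 0 = 0"
  by (simp add: zmul_def)

lemma zmul_add_right: "zmul c (g + h) = zmul c g + zmul c h"
proof (induction c rule: int_induct[where k = 0])
  case (step1 i)
  then show ?case unfolding zmul_Suc_right by (simp add: algebra_simps)
next
  case (step2 i)
  then show ?case unfolding zmul_pred_right by (simp add: algebra_simps)
qed simp

lemma zmul_minus_left: "zmul (- c) g = - zmul c g"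
  using zmul_add_left[of c "- c" g] by (simp add: eq_neg_iff_add_eq_0 add.commute)

lemma zmul_minus_right: "zmul c (- g) = - zmul c g"
  using zmul_add_right[of c g "- g"] by (simp add: eq_neg_iff_add_eq_0 add.commute)

lemma zmul_diff_left: "zmul (c - d) g = zmul c g - zmul d g"
  using zmul_add_left[of c "- d" g] by (simp add: zmul_minus_left)

lemma zmul_diff_right: "zmul c (g - h) = zmul c g - zmul c h"
  using zmul_add_right[of c g "- h"] by (simp add: zmul_minus_right)

lemma zmul_mult: "zmul (c * d) g = zmul c (zmul d g)"
proof (induction c rule: int_induct[where k = 0])
  case (step1 i)
  then show ?case by (simp add: zmul_Suc_right zmul_add_left distrib_right)
next
  case (step2 i)
  then show ?case by (simp add: zmul_pred_right zmul_diff_left left_diff_distrib)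
qed simp

lemma zmul_sum_right: "zmul c (sum f A) = (\<Sum>x\<in>A. zmul c (f x))"
  by (induction A rule: infinite_finite_induct) (simp_all add: zmul_add_right)

lemma zmul_dvd_eq_0: "zmul c g = 0 \<Longrightarrow> c dvd d \<Longrightarrow> zmul d g = 0"
  by (metis dvd_def mult.commute zmul_mult zmul_zero_right)

lemma zmul_cong: "zmul n g = 0 \<Longrightarrow> n dvd (c - d) \<Longrightarrow> zmul c g = zmul d g"
  using zmul_dvd_eq_0[of n g "c - d"] by (simp add: zmul_diff_left)

lemma zmul_gcd_eq_0:
  assumes "zmul c g = 0" "zmul d g = 0"
  shows "zmul (gcd c d) g = 0"
proof -
  obtain u v where "u * c + v * d = gcd c d" using bezout_int by blast
  then show ?thesis using assms by (metis add.right_neutral zmul_add_left zmul_mult zmul_zero_right)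
qed

subsection \<open>The quadratic form\<close>

definition er :: "rat \<Rightarrow> complex" where
  "er x = ee (of_rat x)"

lemma ee_add: "ee (x + y) = ee x * ee y"
  by (simp add: ee_def exp_add ring_distribs)

lemma er_add: "er (x + y) = er x * er y"
  by (simp add: er_def ee_add of_rat_add)

lemma er_0 [simp]: "er 0 = 1"
  by (simp add: er_def ee_def)

lemma er_nonzero [simp]: "er x \<noteq> 0"
  by (simp add: er_def ee_def)

lemma er_minus: "er (- x) = inverse (er x)"
  using er_add[of x "- x"] by (simp add: field_simps)

lemma er_diff: "er (x - y) = er x / er y"
  using er_add[of x "- y"] by (simp add: er_minus field_simps)

lemma er_eq_1_iff: "er x = 1 \<longleftrightarrow> x \<in> \<int>"
proof
  assume "er x = 1"
  then obtain n :: int where "Im (2 * of_real pi * \<i> * of_rat x) = of_int (2 * n) * pi"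
    unfolding er_def ee_def exp_eq_1 by auto
  moreover have "of_rat x = complex_of_real (of_rat x)"
    by (cases x) (simp add: of_rat_rat)
  ultimately have "of_rat x = (of_rat (of_int n) :: real)" by (simp add: mult.commute)
  then have "x = of_int n" by (simp only: of_rat_eq_iff)
  then show "x \<in> \<int>" by simp
next
  assume "x \<in> \<int>"
  then obtain n where "x = of_int n" by (auto elim: Ints_cases)
  then have "2 * of_real pi * \<i> * of_rat x = of_int n * (2 * of_real pi * \<i>)" by simp
  then show "er x = 1" unfolding er_def ee_def exp_eq_1 by auto
qed

lemma er_cong: "eq_mod1 x y \<Longrightarrow> er x = er y"
  using er_eq_1_iff[of "x - y"] by (simp add: eq_mod1_def er_diff)

lemma norm_er [simp]: "cmod (er x) = 1"
proof -
  have "of_rat x = complex_of_real (of_rat x)" by (cases x) (simp add: of_rat_rat)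
  then show ?thesis by (simp add: er_def ee_def)
qed

lemma cnj_er: "cnj (er x) = er (- x)"
proof -
  have "er x * cnj (er x) = 1" using complex_norm_square[of "er x"] by simp
  then show ?thesis by (simp add: er_minus inverse_unique)
qed

lemma er_of_int_mult: "er (of_int c * x) = er x powi c"
proof (induction c rule: int_induct[where k = 0])
  case (step1 i)
  then show ?case by (simp add: er_add ring_distribs power_int_add)
next
  case (step2 i)
  then show ?case by (simp add: er_diff left_diff_distrib power_int_diff)
qed simp

locale disc_form =
  fixes q :: "'a::{ab_group_add,finite} \<Rightarrow> rat"
  assumes disc: "discriminant_form q"
begin

abbreviation bl :: "'a \<Rightarrow> 'a \<Rightarrow> rat" where "bl \<equiv> bilin q"

lemma q_zmul: "eq_mod1 (q (zmul c g)) (of_int (c ^ 2) * q g)"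
  using disc by (simp add: discriminant_form_def)

lemma bl_add_left: "eq_mod1 (bl (a + b) g) (bl a g + bl b g)"
  using disc by (simp add: discriminant_form_def)

lemma nondegenerate: "(\<And>g. bl b g \<in> \<int>) \<Longrightarrow> b = 0"
  using disc by (simp add: discriminant_form_def eq_mod1_0_iff)

lemma bl_commute: "bl a b = bl b a"
  by (simp add: bilin_def add.commute)

lemma bl_add_right: "eq_mod1 (bl g (a + b)) (bl g a + bl g b)"
  using bl_add_left by (metis bl_commute)

lemma q_0: "q 0 \<in> \<int>"
  using q_zmul[of 0 0] by (simp add: eq_mod1_0_iff)

lemma q_add: "q (a + b) = q a + q b + bl a b"
  by (simp add: bilin_def)

lemma bl_0_left: "bl 0 g \<in> \<int>"
  using bl_add_left[of 0 0 g] by (simp add: eq_mod1_def)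

lemma bl_zmul_left: "eq_mod1 (bl (zmul c a) g) (of_int c * bl a g)"
proof (induction c rule: int_induct[where k = 0])
  case base
  then show ?case using bl_0_left by (simp add: eq_mod1_0_iff)
next
  case (step1 i)
  have "eq_mod1 (bl (zmul (i + 1) a) g) (bl (zmul i a) g + bl a g)"
    by (simp add: zmul_Suc_right bl_add_left)
  also have "eq_mod1 (bl (zmul i a) g + bl a g) (of_int i * bl a g + bl a g)"
    using step1 by (intro eq_mod1_add) auto
  finally show ?case by (simp add: ring_distribs)
next
  case (step2 i)
  have "eq_mod1 (bl (zmul i a) g) (bl (zmul (i - 1) a) g + bl a g)"
    using bl_add_left[of "zmul (i - 1) a" a g] by (simp add: zmul_pred_right)
  then have "eq_mod1 (bl (zmul (i - 1) a) g) (bl (zmul i a) g - bl a g)"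
    using eq_mod1_diff[OF eq_mod1_sym eq_mod1_refl[of "bl a g"]] by fastforce
  also have "eq_mod1 (bl (zmul i a) g - bl a g) (of_int i * bl a g - bl a g)"
    using step2 by (intro eq_mod1_diff) auto
  finally show ?case by (simp add: left_diff_distrib)
qed

lemma bl_zmul_right: "eq_mod1 (bl g (zmul c a)) (of_int c * bl g a)"
  using bl_zmul_left by (metis bl_commute)

lemma bl_zmul_swap: "eq_mod1 (bl (zmul c a) g) (bl a (zmul c g))"
  using bl_zmul_left bl_zmul_right eq_mod1_sym eq_mod1_trans by blast

lemma bl_self: "eq_mod1 (bl a a) (2 * q a)"
proof -
  have "eq_mod1 (q (zmul 2 a)) (4 * q a)" using q_zmul[of 2 a] by simp
  moreover have "zmul 2 a = a + a" using zmul_Suc_right[of 1 a] by simp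
  ultimately show ?thesis by (simp add: eq_mod1_def bilin_def)
qed

lemma bl_zmul_Ints: "zmul c a = 0 \<Longrightarrow> of_int c * bl a g \<in> \<int>"
  using bl_zmul_left[of c a g] bl_0_left[of g] eq_mod1_Ints_iff by metis

lemma q_add_zmul: "eq_mod1 (q (g + zmul c h)) (q g + of_int (c ^ 2) * q h + of_int c * bl g h)"
  unfolding q_add by (intro eq_mod1_add q_zmul bl_zmul_right eq_mod1_refl)

abbreviation N :: nat where "N \<equiv> level q"

lemma level_pos: "N > 0" and level_q: "of_nat N * q g \<in> \<int>"
proof -
  define M where "M = (\<Prod>g\<in>UNIV. nat (snd (quotient_of (q g))))"
  have "M > 0" unfolding M_def
    by (intro prod_pos) (auto simp: quotient_of_denom_pos')
  moreover have "of_nat M * q g \<in> \<int>" for g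
  proof -
    have "nat (snd (quotient_of (q g))) dvd M" unfolding M_def by (intro dvd_prodI) auto
    then obtain m where m: "M = nat (snd (quotient_of (q g))) * m" by blast
    obtain a b where ab: "quotient_of (q g) = (a, b)" by (cases "quotient_of (q g)")
    then have "b > 0" "q g = of_int a / of_int b"
      using quotient_of_denom_pos quotient_of_div by auto
    moreover have "M = nat b * m" using m ab by simp
    ultimately have "of_nat M * q g = of_int (int m * a)" by simp
    then show ?thesis by simp
  qed
  ultimately have "\<exists>N. N > 0 \<and> (\<forall>g. eq_mod1 (of_nat N * q g) 0)" by (auto simp: eq_mod1_0_iff)
  from LeastI_ex[OF this] show "N > 0" "of_nat N * q g \<in> \<int>"
    unfolding level_def[symmetric] by (auto simp: eq_mod1_0_iff)
qed

lemma level_bl: "of_nat N * bl a b \<in> \<int>"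
  using level_q[of "a + b"] level_q[of a] level_q[of b]
  unfolding bilin_def right_diff_distrib by simp

lemma level_zmul: "zmul (int N) (g::'a) = 0"
proof (rule nondegenerate)
  show "bl (zmul (int N) g) h \<in> \<int>" for h
    using bl_zmul_left[of "int N" g h] level_bl[of g h] eq_mod1_Ints_iff by fastforce
qed

lemma zmul_level_dvd: "int N dvd c \<Longrightarrow> zmul c (g::'a) = 0"
  using level_zmul zmul_dvd_eq_0 by blast

lemma level_q_dvd: "int N dvd c \<Longrightarrow> of_int c * q g \<in> \<int>"
  using level_q[of g] by (auto simp: dvd_def mult_ac intro: Ints_mult[of "of_int _"])

end

section \<open>The modular group\<close>

definition mat2 :: "int \<Rightarrow> int \<Rightarrow> int \<Rightarrow> int \<Rightarrow> int^2^2" where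
  "mat2 a b c d = vector [vector [a, b], vector [c, d]]"

lemma mat2_nth [simp]:
  "mat2 a b c d $ 1 $ 1 = a" "mat2 a b c d $ 1 $ 2 = b"
  "mat2 a b c d $ 2 $ 1 = c" "mat2 a b c d $ 2 $ 2 = d"
  by (simp_all add: mat2_def)

lemma mat2_eta: "M = mat2 (M $ 1 $ 1) (M $ 1 $ 2) (M $ 2 $ 1) (M $ 2 $ 2)"
  by (simp add: vec_eq_iff forall_2)

lemma mat2_mult: "mat2 a b c d ** mat2 a' b' c' d' =
    mat2 (a * a' + b * c') (a * b' + b * d') (c * a' + d * c') (c * b' + d * d')"
  by (simp add: vec_eq_iff forall_2 matrix_matrix_mult_def sum_2)

lemma mat2_SL2Z: "mat2 a b c d \<in> SL2Z \<longleftrightarrow> a * d - b * c = 1"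
  by (simp add: SL2Z_def det_2)

lemma T_mat_eq: "T_mat = mat2 1 1 0 1" and S_mat_eq: "S_mat = mat2 0 (- 1) 1 0"
  and mat_1_eq: "mat 1 = mat2 1 0 0 1"
  by (simp_all add: T_mat_def S_mat_def mat2_def) (simp add: vec_eq_iff forall_2 mat_def)

lemma T_mat_SL2Z [simp]: "T_mat \<in> SL2Z" and S_mat_SL2Z [simp]: "S_mat \<in> SL2Z"
  and mat_1_SL2Z [simp]: "mat 1 \<in> SL2Z"
  by (simp_all add: T_mat_eq S_mat_eq mat_1_eq mat2_SL2Z)

lemma SL2Z_mult: "M \<in> SL2Z \<Longrightarrow> M' \<in> SL2Z \<Longrightarrow> M ** M' \<in> SL2Z"
  by (simp add: SL2Z_def det_mul)

text \<open>Euclidean algorithm on the lower row: multiplication by a power of T reduces its second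
  entry modulo the first, and S exchanges the two up to sign.\<close>

lemma SL2Z_induct [consumes 1, case_names one S T]:
  assumes M: "M \<in> SL2Z"
    and 1: "P (mat 1)"
    and S: "\<And>M. M \<in> SL2Z \<Longrightarrow> P M \<Longrightarrow> P (M ** S_mat)"
    and T: "\<And>M. M \<in> SL2Z \<Longrightarrow> P M \<Longrightarrow> P (M ** T_mat)"
  shows "P M"
proof -
  define Q where "Q a b c d \<longleftrightarrow> a * d - b * c = 1 \<and> P (mat2 a b c d)" for a b c d
  have QS: "Q b (- a) d (- c)" if "Q a b c d" for a b c d
    using S[of "mat2 a b c d"] that by (simp add: Q_def mat2_SL2Z S_mat_eq mat2_mult algebra_simps)
  have QT: "Q a (a + b) c (c + d)" if "Q a b c d" for a b c d
    using T[of "mat2 a b c d"] that by (simp add: Q_def mat2_SL2Z T_mat_eq mat2_mult algebra_simps)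
  \<comment> \<open>Only right multiplication by S and T is at hand. The inverses are the words S^3
    and S^3 T S T S, the latter by the relation (S T)^3 = S^2.\<close>
  have QS': "Q a b c d" if "Q b (- a) d (- c)" for a b c d
    using QS[OF QS[OF QS[OF that]]] by simp
  have QT': "Q a (b - a) c (d - c)" if "Q a b c d" for a b c d
    using QS[OF QT[OF QS[OF QT[OF QS[OF QS[OF QS[OF that]]]]]]] by (simp add: algebra_simps)
  have QTn: "Q a (b + n * a) c (d + n * c)" if "Q a b c d" for a b c d n
  proof (induction n rule: int_induct[where k = 0])
    case base
    then show ?case using that by simp
  next
    case (step1 i)
    then show ?case using QT by (fastforce simp: algebra_simps)
  next
    case (step2 i)
    then show ?case using QT'[OF step2(2)] by (simp add: algebra_simps)
  qed
  have Q1: "Q 1 0 0 1" using 1 by (simp add: Q_def mat_1_eq)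
  have main: "Q a b c d" if "a * d - b * c = 1" for a b c d
    using that
  proof (induction "nat \<bar>c\<bar>" arbitrary: a b c d rule: less_induct)
    case less
    show ?case
    proof (cases "c = 0")
      case True
      then have ad: "a * d = 1" using less.prems by simp
      then consider "a = 1" "d = 1" | "a = - 1" "d = - 1" using zmult_eq_1_iff by auto
      then show ?thesis
      proof cases
        case 1
        then show ?thesis using QTn[OF Q1, of b] True by simp
      next
        case 2
        then show ?thesis using QTn[OF QS[OF QS[OF Q1]], of "- b"] True by simp
      qed
    next
      case False
      define t where "t = d div c"
      have d: "d = d mod c + t * c" by (simp add: t_def)
      have "nat \<bar>d mod c\<bar> < nat \<bar>c\<bar>" using False abs_mod_less[of c d] by simp
      moreover have "(b - t * a) * (- c) - (- a) * (d mod c) = 1"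
        using less.prems by (subst (asm) d) (simp add: algebra_simps)
      ultimately have "Q (b - t * a) (- a) (d mod c) (- c)" by (rule less.hyps)
      then have "Q a (b - t * a) c (d mod c)" by (rule QS')
      from QTn[OF this, of t] show ?thesis using d by (simp add: algebra_simps)
    qed
  qed
  have "Q (M $ 1 $ 1) (M $ 1 $ 2) (M $ 2 $ 1) (M $ 2 $ 2)"
    using M by (intro main) (simp add: SL2Z_def det_2)
  then show ?thesis unfolding Q_def using mat2_eta[of M] by simp
qed

section \<open>The Weil representation and the Heisenberg operators\<close>

lemma sum_eq_0_shift:
  fixes f :: "'b::ab_group_add \<Rightarrow> complex"
  assumes "bij_betw (\<lambda>x. x + h) H H" "\<And>x. x \<in> H \<Longrightarrow> f (x + h) = c * f x" "c \<noteq> 1"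
  shows "sum f H = 0"
proof -
  have "sum f H = (\<Sum>x\<in>H. f (x + h))" using sum.reindex_bij_betw[OF assms(1), of f] by simp
  also have "\<dots> = c * sum f H" by (simp add: assms(2) sum_distrib_left)
  finally have "(1 - c) * sum f H = 0" by (simp add: algebra_simps)
  then show ?thesis using assms(3) by simp
qed

context disc_form
begin

lemma sum_er_bl: "(\<Sum>g\<in>UNIV. er (bl h g)) = (if h = 0 then of_nat CARD('a) else 0)"
proof (cases "h = 0")
  case True
  then have "er (bl h g) = 1" for g using bl_0_left er_eq_1_iff by simp
  then show ?thesis using True by simp
next
  case False
  then obtain g0 where g0: "bl h g0 \<notin> \<int>" using nondegenerate by blast
  have "(\<Sum>g\<in>UNIV. er (bl h g)) = 0"
  proof (rule sum_eq_0_shift[where h = g0 and c = "er (bl h g0)"])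
    show "bij_betw (\<lambda>x. x + g0) UNIV UNIV" by (rule bij_betwI[where g = "\<lambda>x. x - g0"]) auto
    show "er (bl h (x + g0)) = er (bl h g0) * er (bl h x)" for x
      using er_cong[OF bl_add_right] by (simp add: er_add mult.commute)
    show "er (bl h g0) \<noteq> 1" using g0 er_eq_1_iff by blast
  qed
  then show ?thesis using False by simp
qed

text \<open>An element of the finite Heisenberg group attached to the pair (c\<xi>, d\<xi>): a
  translation combined with a character. The phase c d q(\<xi>) normalizes it so that in
  \<open>act_heis\<close> the pair (c, d) transforms linearly, with no further factor.\<close>

definition heis :: "'a \<Rightarrow> int \<Rightarrow> int \<Rightarrow> complex^('a::{ab_group_add,finite}) \<Rightarrow> complex^('a::{ab_group_add,finite})" where
  "heis \<xi> c d \<phi> = (\<chi> g. er (of_int (c * d) * q \<xi> + of_int d * bl \<xi> g) * \<phi> $ (g + zmul c \<xi>))"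

end

locale weil_rep = disc_form q for q :: "'a::{ab_group_add,finite} \<Rightarrow> rat" +
  fixes \<rho> :: "int^2^2 \<Rightarrow> complex^('a::{ab_group_add,finite})^('a::{ab_group_add,finite})"
  assumes weil: "weil_representation q \<rho>"
begin

definition weil_const :: complex where
  "weil_const = ee (of_int (disc_sign q) / 8) / of_real (sqrt (real CARD('a)))"

lemma mult_axis_component: "(A *v axis g (1::complex)) $ i = A $ i $ g"
  by (simp add: matrix_vector_mult_def axis_def if_distrib[of "\<lambda>x. _ * x"] cong: if_cong)

lemma rho_T: "\<rho> T_mat $ i $ g = (if i = g then er (- q g) else 0)"
proof -
  have "\<rho> T_mat *v axis g 1 = ee (- of_rat (q g)) *s axis g 1"
    using weil by (simp add: weil_representation_def)
  then have "(\<rho> T_mat *v axis g 1) $ i = (ee (- of_rat (q g)) *s axis g 1) $ i" by simp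
  then show ?thesis
    unfolding mult_axis_component by (simp add: axis_def er_def of_rat_minus)
qed

lemma rho_S: "\<rho> S_mat $ i $ g = weil_const * er (bl g i)"
proof -
  have "\<rho> S_mat *v axis g 1 = weil_const *s (\<Sum>b\<in>UNIV. ee (of_rat (bilin q g b)) *s axis b 1)"
    using weil by (simp add: weil_representation_def weil_const_def)
  then have "(\<rho> S_mat *v axis g 1) $ i = (weil_const *s (\<Sum>b\<in>UNIV. ee (of_rat (bilin q g b)) *s axis b 1)) $ i"
    by simp
  moreover have "(\<Sum>b\<in>UNIV. ee (of_rat (bilin q g b)) *s axis b 1) $ i = er (bl g i)"
  proof -
    have "(\<Sum>b\<in>UNIV. ee (of_rat (bilin q g b)) *s axis b 1) $ i = (\<Sum>b\<in>UNIV. if b = i then er (bl g b) else 0)"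
      unfolding sum_component by (rule sum.cong) (auto simp: axis_def er_def)
    then show ?thesis by simp
  qed
  ultimately show ?thesis unfolding mult_axis_component vector_smult_component by simp
qed

lemma rho_mult: "M \<in> SL2Z \<Longrightarrow> M' \<in> SL2Z \<Longrightarrow> \<rho> (M ** M') = \<rho> M ** \<rho> M'"
  and rho_1: "\<rho> (mat 1) = mat 1"
  using weil by (auto simp: weil_representation_def)

text \<open>The dual action, from the right on row vectors: pairing with F gives <v|M, F> = <v,
  \<rho>(M) F>, where the pairing is bilinear and involves no complex conjugation.\<close>

definition act :: "complex^('a::{ab_group_add,finite}) \<Rightarrow> int^2^2 \<Rightarrow> complex^('a::{ab_group_add,finite})" where
  "act \<phi> M = \<phi> v* \<rho> M"

lemma act_1 [simp]: "act \<phi> (mat 1) = \<phi>"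
  by (simp add: act_def rho_1)

lemma act_mult: "M \<in> SL2Z \<Longrightarrow> M' \<in> SL2Z \<Longrightarrow> act \<phi> (M ** M') = act (act \<phi> M) M'"
  by (simp add: act_def rho_mult vector_matrix_mul_assoc)

lemma act_T: "act \<phi> T_mat $ g = er (- q g) * \<phi> $ g"
  by (simp add: act_def vector_matrix_mult_def rho_T if_distrib[of "\<lambda>x. _ * x"] mult.commute cong: if_cong)

lemma act_S: "act \<phi> S_mat $ g = weil_const * (\<Sum>i\<in>UNIV. er (bl g i) * \<phi> $ i)"
  by (simp add: act_def vector_matrix_mult_def rho_S sum_distrib_left mult_ac)

text \<open>On generators: S is a Fourier transform and exchanges translations and characters; T
  adds the translation to the character because q(g + a\<xi>) - q(g) is linear in g up to a
  constant. Together they multiply the row (c, d) by M.\<close>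

lemma act_heis:
  assumes "M \<in> SL2Z"
  shows "act (heis \<xi> c d \<phi>) M =
    heis \<xi> (c * M $ 1 $ 1 + d * M $ 2 $ 1) (c * M $ 1 $ 2 + d * M $ 2 $ 2) (act \<phi> M)"
  using assms
proof (induction rule: SL2Z_induct)
  case one
  then show ?case by (simp add: mat_1_eq[symmetric]) (simp add: mat_1_eq)
next
  case (S M)
  define a where "a = c * M $ 1 $ 1 + d * M $ 2 $ 1"
  define b where "b = c * M $ 1 $ 2 + d * M $ 2 $ 2"
  have gen: "act (heis \<xi> a b \<psi>) S_mat = heis \<xi> b (- a) (act \<psi> S_mat)" for \<psi>
  proof (simp only: vec_eq_iff, rule allI)
    fix g
    have bij: "bij_betw (\<lambda>i. i + zmul a \<xi>) UNIV UNIV"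
      by (rule bij_betwI[where g = "\<lambda>i. i - zmul a \<xi>"]) auto
    have ex: "er (bl g i) * er (of_int (a * b) * q \<xi> + of_int b * bl \<xi> i)
       = er (of_int (b * - a) * q \<xi> + of_int (- a) * bl \<xi> g) * er (bl (g + zmul b \<xi>) (i + zmul a \<xi>))" for i
    proof -
      have "eq_mod1 (bl (g + zmul b \<xi>) (i + zmul a \<xi>))
          (bl g i + bl g (zmul a \<xi>) + (bl (zmul b \<xi>) i + bl (zmul b \<xi>) (zmul a \<xi>)))"
        by (meson bl_add_left bl_add_right eq_mod1_add eq_mod1_trans)
      also have "eq_mod1 \<dots> (bl g i + of_int a * bl g \<xi> + (of_int b * bl \<xi> i + of_int (b * a) * (2 * q \<xi>)))"
      proof (intro eq_mod1_add eq_mod1_refl bl_zmul_left bl_zmul_right)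
        have "eq_mod1 (bl (zmul b \<xi>) (zmul a \<xi>)) (of_int b * bl \<xi> (zmul a \<xi>))" by (rule bl_zmul_left)
        also have "eq_mod1 \<dots> (of_int b * (of_int a * bl \<xi> \<xi>))" by (intro eq_mod1_mult_int bl_zmul_right)
        also have "of_int b * (of_int a * bl \<xi> \<xi>) = of_int (b * a) * bl \<xi> \<xi>" by simp
        also have "eq_mod1 \<dots> (of_int (b * a) * (2 * q \<xi>))" by (intro eq_mod1_mult_int bl_self)
        finally show "eq_mod1 (bl (zmul b \<xi>) (zmul a \<xi>)) (of_int (b * a) * (2 * q \<xi>))" .
      qed
      finally have "eq_mod1 (bl g i + (of_int (a * b) * q \<xi> + of_int b * bl \<xi> i))
         (of_int (b * - a) * q \<xi> + of_int (- a) * bl \<xi> g + bl (g + zmul b \<xi>) (i + zmul a \<xi>))"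
        by (rule eq_mod1_diff_eq[OF eq_mod1_sym]) (simp add: algebra_simps bl_commute[of g \<xi>])
      then show ?thesis by (simp only: er_add[symmetric] er_cong)
    qed
    have "act (heis \<xi> a b \<psi>) S_mat $ g
       = weil_const * (\<Sum>i\<in>UNIV. er (of_int (b * - a) * q \<xi> + of_int (- a) * bl \<xi> g) *
            (er (bl (g + zmul b \<xi>) (i + zmul a \<xi>)) * \<psi> $ (i + zmul a \<xi>)))"
      unfolding act_S heis_def vec_lambda_beta mult.assoc[symmetric] ex ..
    also have "\<dots> = weil_const * (er (of_int (b * - a) * q \<xi> + of_int (- a) * bl \<xi> g) *
            (\<Sum>i\<in>UNIV. er (bl (g + zmul b \<xi>) i) * \<psi> $ i))"
      unfolding sum_distrib_left[symmetric]
      by (subst sum.reindex_bij_betw[OF bij, of "\<lambda>i. er (bl (g + zmul b \<xi>) i) * \<psi> $ i"]) simp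
    also have "\<dots> = heis \<xi> b (- a) (act \<psi> S_mat) $ g"
      by (simp add: heis_def act_S)
    finally show "act (heis \<xi> a b \<psi>) S_mat $ g = heis \<xi> b (- a) (act \<psi> S_mat) $ g" .
  qed
  have "act (heis \<xi> c d \<phi>) (M ** S_mat) = heis \<xi> b (- a) (act \<phi> (M ** S_mat))"
    using S gen by (simp add: act_mult a_def b_def)
  moreover have "M ** S_mat = mat2 (M$1$2) (- M$1$1) (M$2$2) (- M$2$1)"
    by (subst mat2_eta[of M]) (simp add: S_mat_eq mat2_mult)
  ultimately show ?case by (simp add: a_def b_def algebra_simps)
next
  case (T M)
  define a where "a = c * M $ 1 $ 1 + d * M $ 2 $ 1"
  define b where "b = c * M $ 1 $ 2 + d * M $ 2 $ 2"
  have gen: "act (heis \<xi> a b \<psi>) T_mat = heis \<xi> a (a + b) (act \<psi> T_mat)" for \<psi>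
  proof (simp only: vec_eq_iff, rule allI)
    fix g
    have "eq_mod1 (- q g + (of_int (a * b) * q \<xi> + of_int b * bl \<xi> g))
       (of_int (a * (a + b)) * q \<xi> + of_int (a + b) * bl \<xi> g + - q (g + zmul a \<xi>))"
      by (rule eq_mod1_diff_eq[OF q_add_zmul[of g a \<xi>]])
        (simp add: algebra_simps power2_eq_square bl_commute[of g \<xi>])
    then have "er (- q g) * er (of_int (a * b) * q \<xi> + of_int b * bl \<xi> g) =
       er (of_int (a * (a + b)) * q \<xi> + of_int (a + b) * bl \<xi> g) * er (- q (g + zmul a \<xi>))"
      by (simp only: er_add[symmetric] er_cong)
    then show "act (heis \<xi> a b \<psi>) T_mat $ g = heis \<xi> a (a + b) (act \<psi> T_mat) $ g"
      unfolding act_T heis_def vec_lambda_beta by (simp only: mult.assoc[symmetric])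
  qed
  have "act (heis \<xi> c d \<phi>) (M ** T_mat) = heis \<xi> a (a + b) (act \<phi> (M ** T_mat))"
    using T gen by (simp add: act_mult a_def b_def)
  moreover have "M ** T_mat = mat2 (M$1$1) (M$1$1 + M$1$2) (M$2$1) (M$2$1 + M$2$2)"
    by (subst mat2_eta[of M]) (simp add: T_mat_eq mat2_mult)
  ultimately show ?case by (simp add: a_def b_def algebra_simps)
qed

end

section \<open>Unitarity and Milgram's formula\<close>

context weil_rep
begin

definition sqnorm :: "complex^('a::{ab_group_add,finite}) \<Rightarrow> real" where
  "sqnorm \<phi> = (\<Sum>g\<in>UNIV. (cmod (\<phi> $ g))\<^sup>2)"

lemma weil_const_nonzero: "weil_const \<noteq> 0"
  by (simp add: weil_const_def ee_def)

lemma norm_weil_const: "(cmod weil_const)\<^sup>2 * real CARD('a) = 1"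
proof -
  have "cmod (ee (of_int (disc_sign q) / 8)) = 1" by (simp add: ee_def)
  then show ?thesis by (simp add: weil_const_def norm_divide power_divide)
qed

text \<open>S is a normalized Fourier transform, so its case is Parseval's identity; T is diagonal
  with entries of modulus 1. Unitarity is what forces the multipliers of \<open>v\<close> to have
  modulus 1.\<close>

lemma sqnorm_act:
  assumes "M \<in> SL2Z"
  shows "sqnorm (act \<phi> M) = sqnorm \<phi>"
  using assms
proof (induction rule: SL2Z_induct)
  case one
  then show ?case by simp
next
  case (S M)
  have "sqnorm (act \<psi> S_mat) = sqnorm \<psi>" for \<psi>
  proof -
    have "complex_of_real (\<Sum>g\<in>UNIV. (cmod (\<Sum>i\<in>UNIV. er (bl g i) * \<psi> $ i))\<^sup>2)
        = (\<Sum>g\<in>UNIV. (\<Sum>i\<in>UNIV. er (bl g i) * \<psi> $ i) * cnj (\<Sum>j\<in>UNIV. er (bl g j) * \<psi> $ j))"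
      by (simp only: of_real_sum complex_norm_square)
    also have "\<dots> = (\<Sum>g\<in>UNIV. \<Sum>i\<in>UNIV. \<Sum>j\<in>UNIV. \<psi> $ i * cnj (\<psi> $ j) * er (bl (i - j) g))"
    proof (rule sum.cong[OF refl])
      fix g
      have "er (bl g i) * cnj (er (bl g j)) = er (bl (i - j) g)" for i j
      proof -
        have "er (bl g i) = er (bl g (i - j)) * er (bl g j)"
          using er_cong[OF bl_add_right[of g "i - j" j]] by (simp add: er_add)
        then show ?thesis using complex_norm_square[of "er (bl g j)"]
          by (simp add: bl_commute mult.assoc)
      qed
      then have tm: "er (bl g i) * \<psi> $ i * (cnj (er (bl g j)) * cnj (\<psi> $ j)) = \<psi> $ i * cnj (\<psi> $ j) * er (bl (i - j) g)" for i j
        by (simp add: mult_ac)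
      show "(\<Sum>i\<in>UNIV. er (bl g i) * \<psi> $ i) * cnj (\<Sum>j\<in>UNIV. er (bl g j) * \<psi> $ j)
          = (\<Sum>i\<in>UNIV. \<Sum>j\<in>UNIV. \<psi> $ i * cnj (\<psi> $ j) * er (bl (i - j) g))"
        by (simp only: cnj_sum complex_cnj_mult sum_product tm)
    qed
    also have "\<dots> = (\<Sum>i\<in>UNIV. \<Sum>j\<in>UNIV. \<psi> $ i * cnj (\<psi> $ j) * (\<Sum>g\<in>UNIV. er (bl (i - j) g)))"
      by (subst sum.swap, rule sum.cong[OF refl], subst sum.swap) (simp add: sum_distrib_left)
    also have "\<dots> = (\<Sum>i\<in>UNIV. \<psi> $ i * cnj (\<psi> $ i) * of_nat CARD('a))"
      by (rule sum.cong[OF refl]) (simp add: sum_er_bl if_distrib[of "\<lambda>x. _ * x"] cong: if_cong)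
    also have "\<dots> = complex_of_real (real CARD('a) * sqnorm \<psi>)"
      unfolding sqnorm_def of_real_mult of_real_sum complex_norm_square sum_distrib_left
      by (simp add: mult.commute)
    finally have "(\<Sum>g\<in>UNIV. (cmod (\<Sum>i\<in>UNIV. er (bl g i) * \<psi> $ i))\<^sup>2) = real CARD('a) * sqnorm \<psi>"
      by (simp only: of_real_eq_iff)
    then show ?thesis
      using norm_weil_const by (simp add: sqnorm_def[of "act _ _"] act_S norm_mult power_mult_distrib flip: sum_distrib_left)
  qed
  then show ?case using S by (simp add: act_mult)
next
  case (T M)
  have "sqnorm (act \<psi> T_mat) = sqnorm \<psi>" for \<psi>
    by (simp add: sqnorm_def act_T norm_mult)
  then show ?case using T by (simp add: act_mult)
qed

text \<open>Milgram's formula, read off from the relation \<open>T S T S T = S\<close>.\<close>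

lemma gauss_sum_weil_const: "weil_const * (\<Sum>g\<in>UNIV. er (- q g)) = 1"
proof -
  have rel: "T_mat ** S_mat ** T_mat ** S_mat ** T_mat = S_mat"
    by (simp add: T_mat_eq S_mat_eq mat2_mult)
  define e0 :: "complex^('a::{ab_group_add,finite})" where "e0 = axis 0 1"
  have "act e0 (T_mat ** S_mat ** T_mat ** S_mat ** T_mat)
      = act (act (act (act (act e0 T_mat) S_mat) T_mat) S_mat) T_mat"
    by (simp add: act_mult SL2Z_mult)
  then have eq: "act (act (act (act (act e0 T_mat) S_mat) T_mat) S_mat) T_mat $ 0 = act e0 S_mat $ 0"
    by (simp add: rel)
  have er0: "er (- q 0) = 1" using q_0 er_eq_1_iff by simp
  have erb: "er (bl 0 g) = 1" "er (bl g 0) = 1" for g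
    using bl_0_left er_eq_1_iff bl_commute[of g 0] by auto
  have S0: "act e0 S_mat $ g = weil_const" for g
    by (simp add: act_S e0_def axis_def erb if_distrib[of "\<lambda>x. _ * x"] cong: if_cong)
  have T0: "act e0 T_mat = e0" by (simp add: vec_eq_iff act_T e0_def axis_def er0)
  have "act (act (act (act (act e0 T_mat) S_mat) T_mat) S_mat) T_mat $ 0
      = weil_const * (\<Sum>i\<in>UNIV. er (- q i) * weil_const)"
    unfolding T0 by (simp add: act_T er0 act_S[of "act _ _"] S0 erb)
  then have "weil_const * (weil_const * (\<Sum>i\<in>UNIV. er (- q i))) = weil_const"
    using eq S0[of 0] by (simp add: sum_distrib_left mult.commute)
  then show ?thesis using weil_const_nonzero by simp
qed

end

section \<open>The vector v and its Ramanujan weights\<close>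

locale weil_vector = weil_rep q \<rho> for q :: "'a::{ab_group_add,finite} \<Rightarrow> rat" and \<rho> +
  fixes \<mu> :: 'a and r :: nat
  defines "r \<equiv> \<Prod>(prime_factors (level q))"
  assumes mu_order: "\<And>p. p \<in> prime_factors N \<Longrightarrow> zmul (int (N div p)) \<mu> \<noteq> 0"
    and mu_isotropic: "q (zmul (int (N div r)) \<mu>) \<in> \<int>"
begin

definition \<kappa> :: 'a where "\<kappa> = zmul (int (N div r)) \<mu>"

lemma r_pos: "r > 0"
  unfolding r_def by (intro prod_pos) (auto intro: prime_gt_0_nat)

lemma prime_dvd_r: "p \<in> prime_factors N \<Longrightarrow> p dvd r"
  unfolding r_def by (rule dvd_prodI) auto

lemma r_dvd_iff: "int r dvd n \<longleftrightarrow> (\<forall>p\<in>prime_factors N. int p dvd n)"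
proof
  assume "int r dvd n"
  then show "\<forall>p\<in>prime_factors N. int p dvd n" using prime_dvd_r by (meson dvd_trans int_dvd_int_iff)
next
  assume *: "\<forall>p\<in>prime_factors N. int p dvd n"
  have "int (\<Prod>A) dvd n" if "finite A" "A \<subseteq> prime_factors N" for A
    using that
  proof (induction A)
    case (insert p A)
    have pr: "prime p" "\<And>x. x \<in> A \<Longrightarrow> prime x" using insert.prems by auto
    have "coprime (int p) (int (\<Prod>A))"
      using insert.hyps pr by (auto simp: of_nat_prod intro!: prod_coprime_right primes_coprime)
    then show ?case using insert * by (auto intro!: divides_mult)
  qed simp
  then show "int r dvd n" unfolding r_def by blast
qed

lemma r_dvd_N: "r dvd N"
proof -
  have "int r dvd int N" unfolding r_dvd_iff by (auto simp: in_prime_factors_iff)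
  then show ?thesis by simp
qed

lemma zmul_N_mu: "int N dvd c \<Longrightarrow> zmul c \<mu> = 0"
  by (rule zmul_level_dvd)

lemma zmul_r_kappa: "zmul (int r) \<kappa> = 0"
proof -
  have "int r * int (N div r) = int N" using r_dvd_N by (metis dvd_mult_div_cancel of_nat_mult)
  then show ?thesis unfolding \<kappa>_def zmul_mult[symmetric] by (simp add: level_zmul)
qed

lemma zmul_kappa_p:
  assumes "p \<in> prime_factors N"
  shows "zmul (int (r div p)) \<kappa> = zmul (int (N div p)) \<mu>"
proof -
  have "(r div p) * (N div r) = N div p"
    using prime_dvd_r[OF assms] r_dvd_N r_pos by (auto elim!: dvdE)
  then show ?thesis unfolding \<kappa>_def zmul_mult[symmetric] by (metis of_nat_mult)
qed

text \<open>If n\<kappa> = 0 and some prime p of r does not divide n, then gcd(n, r) divides r/p, so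
  (r/p)\<kappa> = (N/p)\<mu> would vanish. Thus \<kappa> has exact order r and the multiples below r
  are distinct.\<close>

lemma zmul_kappa_eq_0_iff: "zmul n \<kappa> = 0 \<longleftrightarrow> int r dvd n"
proof
  assume "int r dvd n"
  then show "zmul n \<kappa> = 0" using zmul_r_kappa zmul_dvd_eq_0 by blast
next
  assume n: "zmul n \<kappa> = 0"
  show "int r dvd n"
  proof (rule ccontr)
    assume "\<not> int r dvd n"
    then obtain p where p: "p \<in> prime_factors N" "\<not> int p dvd n" using r_dvd_iff by blast
    have g0: "zmul (gcd n (int r)) \<kappa> = 0" using n zmul_r_kappa by (rule zmul_gcd_eq_0)
    have "prime (int p)" using p(1) by auto
    then have "coprime (gcd n (int r)) (int p)"
      using p(2) by (metis coprime_commute dvd_trans gcd_dvd1 prime_imp_coprime)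
    moreover have "gcd n (int r) dvd int p * int (r div p)"
      using prime_dvd_r[OF p(1)] by (metis dvd_mult_div_cancel gcd_dvd2 of_nat_mult)
    ultimately have "gcd n (int r) dvd int (r div p)" by (simp add: coprime_dvd_mult_right_iff)
    then have "zmul (int (r div p)) \<kappa> = 0" using g0 zmul_dvd_eq_0 by blast
    then show False using mu_order[OF p(1)] zmul_kappa_p[OF p(1)] by simp
  qed
qed

lemma q_kappa: "q \<kappa> \<in> \<int>"
  using mu_isotropic by (simp add: \<kappa>_def)

lemma q_zmul_kappa: "q (zmul n \<kappa>) \<in> \<int>"
  unfolding eq_mod1_Ints_iff[OF q_zmul] using q_kappa by (rule int_mult_Ints)

lemma bl_kappa_kappa: "bl \<kappa> (zmul n \<kappa>) \<in> \<int>"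
proof -
  have "bl \<kappa> \<kappa> \<in> \<int>" unfolding eq_mod1_Ints_iff[OF bl_self] using q_kappa by simp
  then show ?thesis unfolding eq_mod1_Ints_iff[OF bl_zmul_right] by (rule int_mult_Ints)
qed

text \<open>The weights form the Ramanujan sum modulo \<open>r\<close>; its sum over every coset of
  \<open>(r/p)\<int> / r\<int>\<close> vanishes.\<close>

definition ramanujan :: "int \<Rightarrow> complex" where
  "ramanujan i = (\<Prod>p\<in>prime_factors N. if int p dvd i then of_nat p - 1 else - 1)"

lemma ramanujan_cong:
  assumes "int r dvd i - j"
  shows "ramanujan i = ramanujan j"
  unfolding ramanujan_def
proof (rule prod.cong[OF refl])
  fix p assume "p \<in> prime_factors N"
  then have "int p dvd i - j" using assms r_dvd_iff by blast
  then have "int p dvd i \<longleftrightarrow> int p dvd j" using dvd_add_left_iff[of "int p" "i - j" j] by simp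
  then show "(if int p dvd i then of_nat p - 1 else - 1 :: complex) = (if int p dvd j then of_nat p - 1 else - 1)"
    by simp
qed

lemma ramanujan_0_nonzero: "ramanujan 0 \<noteq> 0"
  unfolding ramanujan_def by (auto dest: in_prime_factors_imp_prime)

text \<open>r/p is prime to p and divisible by the other primes, so along the coset only the factor
  at p varies. It is p - 1 for one index and -1 for the remaining p - 1.\<close>

lemma ramanujan_sum_coset:
  assumes p: "p \<in> prime_factors N"
  shows "(\<Sum>i<p. ramanujan (n + int i * int (r div p))) = 0"
proof -
  have pp: "prime p" using p by auto
  define R where "R = (\<Prod>p'\<in>prime_factors N - {p}. if int p' dvd n then of_nat p' - 1 else - 1 :: complex)"
  define s where "s = int (r div p)"
  have rp: "r div p = \<Prod>(prime_factors N - {p})"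
  proof -
    have "r = p * \<Prod>(prime_factors N - {p})" unfolding r_def using p by (subst prod.remove[OF _ p]) auto
    then show ?thesis using pp by (simp add: prime_gt_0_nat)
  qed
  have other: "int p' dvd s" if "p' \<in> prime_factors N - {p}" for p'
    unfolding s_def rp using that by (simp add: dvd_prodI)
  have cop: "coprime (int p) s"
    unfolding s_def rp using p by (auto simp: of_nat_prod intro!: prod_coprime_right primes_coprime)
  have split: "ramanujan (n + int i * s) = (if int p dvd n + int i * s then of_nat p - 1 else - 1) * R" for i
  proof -
    have "ramanujan (n + int i * s) = (if int p dvd n + int i * s then of_nat p - 1 else - 1) *
       (\<Prod>p'\<in>prime_factors N - {p}. if int p' dvd n + int i * s then of_nat p' - 1 else - 1)"
      unfolding ramanujan_def using p by (subst prod.remove[of _ p]) auto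
    also have "(\<Prod>p'\<in>prime_factors N - {p}. if int p' dvd n + int i * s then of_nat p' - 1 else - 1 :: complex) = R"
      unfolding R_def using other by (intro prod.cong refl) (simp add: dvd_add_left_iff)
    finally show ?thesis .
  qed
  obtain i0 where i0: "i0 < p" "\<And>i. i < p \<Longrightarrow> int p dvd n + int i * s \<longleftrightarrow> i = i0"
  proof -
    obtain x where x: "[s * x = - n] (mod int p)"
      using cong_solve_dvd_int[of s "int p" "- n"] cop by (auto simp: coprime_commute coprime_iff_gcd_eq_1 gcd.commute)
    define i0 where "i0 = nat (x mod int p)"
    have p0: "int p > 0" using pp by (simp add: prime_gt_0_nat)
    have i0x: "int i0 = x mod int p" using p0 by (simp add: i0_def)
    have "i0 < p" using i0x p0 by (metis of_nat_less_iff pos_mod_bound)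
    moreover have "[n + int i0 * s = 0] (mod int p)"
    proof -
      have "[s * int i0 = s * x] (mod int p)" unfolding i0x by (simp add: cong_def mod_mult_right_eq)
      then have "[s * int i0 = - n] (mod int p)" using x cong_trans by blast
      then have "[n + s * int i0 = n + - n] (mod int p)" by (intro cong_add cong_refl)
      then show ?thesis by (simp add: mult.commute)
    qed
    then have d0: "int p dvd n + int i0 * s" by (simp add: cong_0_iff)
    moreover have "i = i0" if "i < p" "int p dvd n + int i * s" for i
    proof -
      have "int p dvd (n + int i * s) - (n + int i0 * s)" using that d0 by (rule_tac dvd_diff)
      then have "int p dvd (int i - int i0) * s" by (simp add: algebra_simps)
      then have "int p dvd int i - int i0" using cop by (simp add: coprime_dvd_mult_left_iff)
      then have "[int i = int i0] (mod int p)" by (simp add: cong_iff_dvd_diff)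
      then have "[i = i0] (mod p)" by (simp add: cong_int_iff)
      then show ?thesis using that \<open>i0 < p\<close> by (simp add: cong_less_modulus_unique_nat)
    qed
    ultimately show ?thesis using that by blast
  qed
  have "(\<Sum>i<p. ramanujan (n + int i * s)) = (\<Sum>i<p. ((if i = i0 then of_nat p else 0) - 1) * R)"
    unfolding split using i0(2) by (intro sum.cong refl) auto
  also have "\<dots> = ((\<Sum>i<p. if i = i0 then of_nat p else 0) - of_nat p) * R"
    by (simp add: sum_distrib_right[symmetric] sum_subtractf)
  also have "\<dots> = 0" using i0(1) by simp
  finally show ?thesis unfolding s_def .
qed

definition v :: "complex^('a::{ab_group_add,finite})" where
  "v = (\<chi> g. \<Sum>i<r. if g = zmul (int i) \<kappa> then ramanujan (int i) else 0)"

lemma v_zmul_kappa: "v $ zmul n \<kappa> = ramanujan n"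
proof -
  define j where "j = nat (n mod int r)"
  have r0: "int r > 0" using r_pos by simp
  have j: "int j = n mod int r" "j < r" using r0 by (auto simp: j_def nat_less_iff)
  have eq: "zmul n \<kappa> = zmul (int i) \<kappa> \<longleftrightarrow> i = j" if "i < r" for i
  proof -
    have "zmul n \<kappa> = zmul (int i) \<kappa> \<longleftrightarrow> zmul (n - int i) \<kappa> = 0" by (simp add: zmul_diff_left)
    also have "\<dots> \<longleftrightarrow> n mod int r = int i mod int r" unfolding zmul_kappa_eq_0_iff by (simp add: mod_eq_dvd_iff)
    also have "\<dots> \<longleftrightarrow> i = j" using that j by (auto simp: zmod_int[symmetric])
    finally show ?thesis .
  qed
  have "v $ zmul n \<kappa> = (\<Sum>i<r. if i = j then ramanujan (int i) else 0)"
    unfolding v_def vec_lambda_beta by (intro sum.cong refl) (simp add: eq)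
  also have "\<dots> = ramanujan (int j)" using j by simp
  also have "\<dots> = ramanujan n" unfolding j(1) by (rule ramanujan_cong) (simp add: mod_eq_dvd_iff[symmetric])
  finally show ?thesis .
qed

lemma v_support: "v $ g \<noteq> 0 \<Longrightarrow> \<exists>n. g = zmul n \<kappa>"
  unfolding v_def vec_lambda_beta by (auto elim!: sum.not_neutral_contains_not_neutral split: if_splits)

lemma heis_v:
  assumes *: "bl \<xi> \<kappa> \<in> \<int>"
  shows "heis \<xi> 0 1 v = v"
proof -
  have "er (bl \<xi> g) * v $ g = v $ g" for g
  proof (cases "v $ g = 0")
    case False
    then obtain n where "g = zmul n \<kappa>" using v_support by blast
    then have "bl \<xi> g \<in> \<int>" using eq_mod1_Ints_iff[OF bl_zmul_right[of \<xi> n \<kappa>]] int_mult_Ints[OF *] by simp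
    then show ?thesis using er_eq_1_iff by simp
  qed simp
  then show ?thesis by (simp add: vec_eq_iff heis_def)
qed

text \<open>The subgroup generated by (N/p)\<mu> = (r/p)\<kappa> consists of multiples of \<kappa>,
  so a coset of it either consists of such multiples or misses the support of
  \<open>v\<close>.\<close>

lemma v_sum_coset:
  assumes p: "p \<in> prime_factors N"
  shows "(\<Sum>i<p. v $ (g + zmul (int i) (zmul (int (N div p)) \<mu>))) = 0"
proof (cases "\<exists>n. g = zmul n \<kappa>")
  case True
  then obtain n where "g = zmul n \<kappa>" by blast
  then have "g + zmul (int i) (zmul (int (N div p)) \<mu>) = zmul (n + int i * int (r div p)) \<kappa>" for i
    by (simp add: zmul_add_left zmul_mult zmul_kappa_p[OF p])
  then show ?thesis using ramanujan_sum_coset[OF p] by (simp add: v_zmul_kappa)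
next
  case False
  have "v $ (g + zmul (int i) (zmul (int (N div p)) \<mu>)) = 0" for i
  proof (rule ccontr)
    assume "\<not> ?thesis"
    then obtain n where "g + zmul (int i) (zmul (int (N div p)) \<mu>) = zmul n \<kappa>" using v_support by blast
    then have "g = zmul (n - int i * int (r div p)) \<kappa>"
      by (simp add: zmul_diff_left zmul_mult zmul_kappa_p[OF p] algebra_simps)
    then show False using False by blast
  qed
  then show ?thesis by simp
qed

end

section \<open>Transport of v by the modular group\<close>

context weil_rep
begin

lemma act_sum: "act (\<Sum>i\<in>A. f i) M = (\<Sum>i\<in>A. act (f i) M)"
  by (induction A rule: infinite_finite_induct) (simp_all add: act_def vector_matrix_mult_add_rdistrib vector_matrix_left_distrib)

lemma act_scale: "act (c *s \<phi>) M = c *s act \<phi> M"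
  by (simp add: act_def vec_eq_iff vector_matrix_mult_def sum_distrib_left mult_ac)

lemma heis_scale: "heis \<xi> a b (c *s \<phi>) = c *s heis \<xi> a b \<phi>"
  by (simp add: heis_def vec_eq_iff mult_ac)

lemma sqnorm_scale: "sqnorm (c *s \<phi>) = (cmod c)\<^sup>2 * sqnorm \<phi>"
  by (simp add: sqnorm_def norm_mult power_mult_distrib sum_distrib_left)

lemma sqnorm_pos: "\<phi> $ g \<noteq> 0 \<Longrightarrow> sqnorm \<phi> > 0"
  unfolding sqnorm_def by (rule sum_pos2[of _ g]) auto

end

context weil_vector
begin

lemma v_0_nonzero: "v $ 0 \<noteq> 0"
  using v_zmul_kappa[of 0] ramanujan_0_nonzero by simp

lemma v_eq_sum: "v = (\<Sum>i<r. ramanujan (int i) *s heis \<kappa> (- int i) 0 (axis 0 1))"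
  by (simp add: vec_eq_iff v_def heis_def axis_def zmul_minus_left if_distrib[of "\<lambda>x. _ * x"] cong: if_cong)

text \<open>Up to scalars, e^0 is the only vector fixed by all characters
  \<open>heis \<xi> 0 1\<close>. The lower row of M is (0, 1) modulo N, so M preserves these
  operators and sends e^0 to \<omega> e^0. \<open>v\<close> is a combination of translates of e^0
  along \<kappa> and picks up the same \<omega>: the upper row is (1, b) modulo N, and b only
  contributes phases in q(\<kappa>) and (\<kappa>, \<kappa>), which are integral.\<close>

lemma act_v_Gamma1:
  assumes M: "M \<in> SL2Z" and c: "int N dvd M $ 2 $ 1" and d: "int N dvd M $ 2 $ 2 - 1"
  shows "\<exists>\<omega>. cmod \<omega> = 1 \<and> act v M = \<omega> *s v"
proof -
  define a where "a = M $ 1 $ 1"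
  define b where "b = M $ 1 $ 2"
  have det: "a * M $ 2 $ 2 - b * M $ 2 $ 1 = 1" using M by (simp add: SL2Z_def det_2 a_def b_def)
  have a: "int N dvd a - 1"
  proof -
    have "a - 1 = b * M $ 2 $ 1 - a * (M $ 2 $ 2 - 1)" using det by (simp add: algebra_simps)
    then show ?thesis using c d by simp
  qed
  define e0 :: "complex^('a::{ab_group_add,finite})" where "e0 = axis 0 1"
  define \<psi> where "\<psi> = act e0 M"
  have \<psi>0: "\<psi> $ g = 0" if "g \<noteq> 0" for g
  proof -
    obtain \<xi> where xi: "bl \<xi> g \<notin> \<int>" using nondegenerate[of g] \<open>g \<noteq> 0\<close> bl_commute by metis
    have "heis \<xi> 0 1 e0 = e0"
      using bl_0_left[of \<xi>] er_eq_1_iff by (simp add: vec_eq_iff heis_def e0_def axis_def bl_commute[of \<xi> 0])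
    then have "heis \<xi> (M $ 2 $ 1) (M $ 2 $ 2) \<psi> = \<psi>" using act_heis[OF M, of \<xi> 0 1 e0] by (simp add: \<psi>_def)
    then have eq: "er (of_int (M$2$1 * M$2$2) * q \<xi> + of_int (M$2$2) * bl \<xi> g) * \<psi> $ (g + zmul (M$2$1) \<xi>) = \<psi> $ g"
      by (metis (lifting) heis_def vec_lambda_beta)
    have "of_int (M$2$1 * M$2$2) * q \<xi> \<in> \<int>" using c by (intro level_q_dvd) simp
    moreover have "of_int (M$2$2 - 1) * bl \<xi> g \<in> \<int>"
      using bl_zmul_Ints[OF zmul_level_dvd[OF d]] .
    ultimately have "eq_mod1 (of_int (M$2$1 * M$2$2) * q \<xi> + of_int (M$2$2) * bl \<xi> g) (bl \<xi> g)"
      unfolding eq_mod1_def by (metis (no_types, opaque_lifting) Ints_add add_diff_eq left_diff_distrib mult_1 of_int_1 of_int_diff)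
    then have "er (bl \<xi> g) * \<psi> $ g = \<psi> $ g" using eq zmul_level_dvd[OF c] er_cong by auto
    then show ?thesis using xi er_eq_1_iff by auto
  qed
  define \<omega> where "\<omega> = \<psi> $ 0"
  have \<psi>: "act e0 M = \<omega> *s e0"
  proof -
    have "e0 $ g = (if g = 0 then 1 else 0)" for g by (simp add: e0_def axis_def)
    then show ?thesis using \<psi>0 unfolding vec_eq_iff \<psi>_def[symmetric] \<omega>_def by simp
  qed
  have hz: "heis \<kappa> (- int i * a) (- int i * b) e0 = heis \<kappa> (- int i) 0 e0" for i
  proof -
    have z: "zmul (- int i * a) \<kappa> = zmul (- int i) \<kappa>"
      using zmul_cong[OF level_zmul[of \<kappa>], of "- int i * a" "- int i"] a by (simp add: algebra_simps dvd_diff_commute) (metis dvd_mult2 left_diff_distrib mult.commute mult_1 dvd_mult)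
    have er1: "er (of_int (- int i * a * (- int i * b)) * q \<kappa> + of_int (- int i * b) * bl \<kappa> g) * e0 $ (g + zmul (- int i) \<kappa>)
       = e0 $ (g + zmul (- int i) \<kappa>)" for g
    proof (cases "g = zmul (int i) \<kappa>")
      case True
      have "of_int (- int i * a * (- int i * b)) * q \<kappa> + of_int (- int i * b) * bl \<kappa> g \<in> \<int>"
        unfolding True by (intro Ints_add int_mult_Ints q_kappa bl_kappa_kappa)
      then show ?thesis by (simp only: er_eq_1_iff[THEN iffD2] mult_1)
    next
      case False
      then have "e0 $ (g + zmul (- int i) \<kappa>) = 0" by (simp add: e0_def axis_def zmul_minus_left)
      then show ?thesis by simp
    qed
    show ?thesis unfolding vec_eq_iff heis_def vec_lambda_beta z er1 by simp
  qed
  have "act v M = (\<Sum>i<r. ramanujan (int i) *s act (heis \<kappa> (- int i) 0 e0) M)"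
    by (subst v_eq_sum) (simp add: act_sum act_scale e0_def)
  also have "\<dots> = (\<Sum>i<r. ramanujan (int i) *s (\<omega> *s heis \<kappa> (- int i) 0 e0))"
    unfolding act_heis[OF M] \<psi> heis_scale using hz by (simp add: a_def b_def)
  also have "\<dots> = \<omega> *s v"
    by (subst v_eq_sum) (simp add: vec_eq_iff e0_def sum_distrib_left mult_ac)
  finally have eq: "act v M = \<omega> *s v" .
  have "(cmod \<omega>)\<^sup>2 * sqnorm v = sqnorm v"
    using sqnorm_act[OF M, of v] unfolding eq sqnorm_scale .
  moreover have "sqnorm v > 0" using v_0_nonzero sqnorm_pos by blast
  ultimately have "(cmod \<omega>)\<^sup>2 = 1" by simp
  then have "cmod \<omega> = 1" by (metis norm_ge_zero real_sqrt_abs2 real_sqrt_one real_sqrt_unique)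
  then show ?thesis using eq by blast
qed

text \<open>The quotient of the two matrices lies in \<Gamma>1(N).\<close>

lemma act_v_cong:
  assumes M: "M \<in> SL2Z" and M': "M' \<in> SL2Z"
    and c: "int N dvd M $ 2 $ 1 - M' $ 2 $ 1" and d: "int N dvd M $ 2 $ 2 - M' $ 2 $ 2"
  shows "\<exists>\<omega>. cmod \<omega> = 1 \<and> act v M = \<omega> *s act v M'"
proof -
  obtain a b c1 d1 where Me: "M = mat2 a b c1 d1" using mat2_eta by blast
  obtain a' b' c' d' where Me': "M' = mat2 a' b' c' d'" using mat2_eta by blast
  have det: "a * d1 - b * c1 = 1" "a' * d' - b' * c' = 1" using M M' by (simp_all add: Me Me' mat2_SL2Z)
  define g where "g = M ** mat2 d' (- b') (- c') a'"
  have g: "g \<in> SL2Z" unfolding g_def using M det by (intro SL2Z_mult) (auto simp: mat2_SL2Z algebra_simps)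
  have "g ** M' = M ** (mat2 d' (- b') (- c') a' ** mat2 a' b' c' d')"
    by (simp add: g_def Me' matrix_mul_assoc)
  also have "mat2 d' (- b') (- c') a' ** mat2 a' b' c' d' = mat 1"
    using det by (simp add: mat2_mult mat_1_eq algebra_simps)
  finally have gM: "M = g ** M'" by simp
  have ge: "g = mat2 (a * d' - b * c') (b * a' - a * b') (c1 * d' - d1 * c') (d1 * a' - c1 * b')"
    by (simp add: g_def Me mat2_mult algebra_simps)
  have cd: "int N dvd c1 - c'" "int N dvd d1 - d'" using c d by (simp_all add: Me Me')
  have "c1 * d' - d1 * c' = (c1 - c') * d' - (d1 - d') * c'" by (simp add: algebra_simps)
  then have 1: "int N dvd g $ 2 $ 1" using cd by (simp add: ge)
  have "d1 * a' - c1 * b' - 1 = (d1 - d') * a' - (c1 - c') * b'" using det by (simp add: algebra_simps)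
  then have 2: "int N dvd g $ 2 $ 2 - 1" using cd by (simp add: ge)
  obtain \<omega> where "cmod \<omega> = 1" "act v g = \<omega> *s v" using act_v_Gamma1[OF g 1 2] by blast
  then show ?thesis using gM act_mult[OF g M'] act_scale by metis
qed

text \<open>Transport of \<open>heis \<xi> 0 1 v = v\<close>, the row (0, 1) becoming the lower row
  of M. If the lower left entry kills \<xi>, a non-trivial phase excludes g from the support; if
  not, the values at two points of D are tied together.\<close>

lemma act_v_heis:
  assumes M: "M \<in> SL2Z" and xi: "bl \<xi> \<kappa> \<in> \<int>"
  shows "er (of_int (M$2$1 * M$2$2) * q \<xi> + of_int (M$2$2) * bl \<xi> g) * act v M $ (g + zmul (M$2$1) \<xi>) = act v M $ g"
proof -
  have "heis \<xi> (M$2$1) (M$2$2) (act v M) = act v M"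
    using act_heis[OF M, of \<xi> 0 1 v] heis_v[OF xi] by simp
  then have "heis \<xi> (M$2$1) (M$2$2) (act v M) $ g = act v M $ g" by simp
  then show ?thesis by (simp add: heis_def)
qed

text \<open>By \<open>v_sum_coset\<close> the translations along (N/p)\<mu> add up to an operator
  killing \<open>v\<close>; transport turns the row (i, 0) into i times the upper row. No phase in q
  survives since (N/p)\<mu> is isotropic.\<close>

lemma act_v_sum_coset:
  assumes M: "M \<in> SL2Z" and p: "p \<in> prime_factors N"
  shows "(\<Sum>i<p. er (of_int (int i * M$1$2) * bl (zmul (int (N div p)) \<mu>) g) *
     act v M $ (g + zmul (int i * M$1$1) (zmul (int (N div p)) \<mu>))) = 0"
proof -
  define \<xi> where "\<xi> = zmul (int (N div p)) \<mu>"
  have qx: "q \<xi> \<in> \<int>" using q_zmul_kappa zmul_kappa_p[OF p] by (metis \<xi>_def)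
  have "(\<Sum>i<p. heis \<xi> (int i) 0 v) = 0"
    using v_sum_coset[OF p] by (simp add: vec_eq_iff heis_def \<xi>_def)
  then have "act (\<Sum>i<p. heis \<xi> (int i) 0 v) M = 0" by (simp add: act_def)
  then have "(\<Sum>i<p. heis \<xi> (int i * M$1$1) (int i * M$1$2) (act v M)) $ g = 0"
    by (simp add: act_sum act_heis[OF M])
  moreover have "heis \<xi> (int i * M$1$1) (int i * M$1$2) (act v M) $ g =
     er (of_int (int i * M$1$2) * bl \<xi> g) * act v M $ (g + zmul (int i * M$1$1) \<xi>)" for i
    unfolding heis_def er_add vec_lambda_beta er_eq_1_iff[THEN iffD2, OF int_mult_Ints[OF qx]] by simp
  ultimately show ?thesis unfolding \<xi>_def sum_component by simp
qed

end

section \<open>Poles at the cusps\<close>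

context disc_form
begin

text \<open>Sum e((x, h)) over x in D and h in H in both orders: the sum over x leaves only h = 0,
  the sum over h leaves only x in the complement.\<close>

lemma card_annihilator:
  assumes "0 \<in> H" "\<And>x y. x \<in> H \<Longrightarrow> y \<in> H \<Longrightarrow> x + y \<in> H" "\<And>x. x \<in> H \<Longrightarrow> - x \<in> H"
  shows "card H * card {x. \<forall>h\<in>H. bl x h \<in> \<int>} = CARD('a)"
proof -
  let ?A = "{x. \<forall>h\<in>H. bl x h \<in> \<int>}"
  have inner: "(\<Sum>h\<in>H. er (bl x h)) = (if x \<in> ?A then of_nat (card H) else 0)" for x
  proof (cases "x \<in> ?A")
    case True
    then have "er (bl x h) = 1" if "h \<in> H" for h using that er_eq_1_iff by blast
    then show ?thesis using True by simp
  next
    case False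
    then obtain h0 where h0: "h0 \<in> H" "bl x h0 \<notin> \<int>" by blast
    have "(\<Sum>h\<in>H. er (bl x h)) = 0"
    proof (rule sum_eq_0_shift[where h = h0 and c = "er (bl x h0)"])
      show "bij_betw (\<lambda>x. x + h0) H H"
        using assms(2)[OF _ h0(1)] assms(2)[OF _ assms(3)[OF h0(1)]]
        by (intro bij_betwI[where g = "\<lambda>x. x + - h0"]) auto
      show "er (bl x (y + h0)) = er (bl x h0) * er (bl x y)" for y
        using er_cong[OF bl_add_right] by (simp add: er_add mult.commute)
      show "er (bl x h0) \<noteq> 1" using h0 er_eq_1_iff by blast
    qed
    then show ?thesis using False by (simp only: if_False)
  qed
  have "of_nat (card H * card ?A) = (\<Sum>x\<in>UNIV. if x \<in> ?A then of_nat (card H) else (0::complex))"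
    by (simp add: sum.If_cases)
  also have "\<dots> = (\<Sum>x\<in>UNIV. \<Sum>h\<in>H. er (bl x h))" by (simp only: inner)
  also have "\<dots> = (\<Sum>h\<in>H. \<Sum>x\<in>UNIV. er (bl h x))" by (subst sum.swap) (simp only: bl_commute)
  also have "\<dots> = of_nat CARD('a)" using assms(1) by (simp add: sum_er_bl)
  finally show ?thesis by (simp only: of_nat_eq_iff)
qed

text \<open>By non-degeneracy the complement of D^c is D_c. Applying \<open>card_annihilator\<close>
  to both subgroups, the complement of D_c has as many elements as D^c, which it contains.\<close>

lemma annihilator_kernel:
  assumes "\<And>b. zmul c b = 0 \<Longrightarrow> bl x b \<in> \<int>"
  shows "\<exists>y. x = zmul c y"
proof -
  let ?K = "{b::'a. zmul c b = 0}" and ?I = "range (zmul c :: 'a \<Rightarrow> 'a)"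
  have "zmul c x + zmul c y \<in> ?I" for x y :: 'a using zmul_add_right[of c x y] by (metis rangeI)
  moreover have "- zmul c x \<in> ?I" for x :: 'a by (metis zmul_minus_right rangeI)
  moreover have "0 \<in> ?I" by (metis rangeI zmul_zero_right)
  ultimately have I: "card ?I * card {x. \<forall>h\<in>?I. bl x h \<in> \<int>} = CARD('a)"
    by (intro card_annihilator) auto
  have "{x. \<forall>h\<in>?I. bl x h \<in> \<int>} = ?K"
  proof (intro equalityI subsetI)
    fix x assume "x \<in> {x. \<forall>h\<in>?I. bl x h \<in> \<int>}"
    then have "bl (zmul c x) y \<in> \<int>" for y using eq_mod1_Ints_iff[OF bl_zmul_swap] by simp
    then show "x \<in> ?K" using nondegenerate by simp
  next
    fix x assume "x \<in> ?K"
    then have "bl x (zmul c y) \<in> \<int>" for y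
      using eq_mod1_Ints_iff[OF bl_zmul_swap[of c x y]] bl_0_left by simp
    then show "x \<in> {x. \<forall>h\<in>?I. bl x h \<in> \<int>}" by auto
  qed
  then have 1: "card ?I * card ?K = CARD('a)" using I by simp
  have 2: "card ?K * card {x. \<forall>h\<in>?K. bl x h \<in> \<int>} = CARD('a)"
    by (rule card_annihilator) (auto simp: zmul_add_right zmul_minus_right)
  have "card ?K \<noteq> 0" by (simp add: card_eq_0_iff) (metis zmul_zero_right)
  moreover have "card ?K * card {x. \<forall>h\<in>?K. bl x h \<in> \<int>} = card ?K * card ?I"
    using 1 2 by (simp only: mult.commute)
  ultimately have c: "card {x. \<forall>h\<in>?K. bl x h \<in> \<int>} = card ?I" by (simp only: mult_cancel1) simp
  have "?I \<subseteq> {x. \<forall>h\<in>?K. bl x h \<in> \<int>}"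
  proof
    fix x assume "x \<in> ?I"
    then obtain y where y: "x = zmul c y" by blast
    have "bl (zmul c y) h \<in> \<int>" if "zmul c h = 0" for h
      using eq_mod1_Ints_iff[OF bl_zmul_swap[of c y h]] bl_0_left that by (simp add: bl_commute)
    then show "x \<in> {x. \<forall>h\<in>?K. bl x h \<in> \<int>}" using y by simp
  qed
  then have "?I = {x. \<forall>h\<in>?K. bl x h \<in> \<int>}" using c by (intro card_subset_eq) auto
  then show ?thesis using assms by blast
qed

text \<open>If \<open>8\<close> exactly divides \<open>N\<close>, a pole at a cusp with \<open>c \<equiv> 2 (mod 4)\<close> forces the first condition and a pole
  of odd \<open>\<delta>\<close> at a cusp with \<open>c \<equiv> 4 (mod 8)\<close> forces the second one. They exclude each other when the
  signature is even.\<close>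

definition odd_two_torsion :: bool where
  "odd_two_torsion \<longleftrightarrow> (\<exists>z. zmul 2 z = 0 \<and> 2 * q z \<notin> \<int> \<and> (\<forall>\<xi>. zmul 2 \<xi> = 0 \<longrightarrow> eq_mod1 (bl \<xi> z) (2 * q \<xi>)))"

definition even_four_torsion :: bool where
  "even_four_torsion \<longleftrightarrow> (\<forall>\<xi>. zmul 4 \<xi> = 0 \<longrightarrow> 4 * q \<xi> \<in> \<int>)"

end

lemma dvd_div_prime_power:
  fixes p \<delta> N j :: nat
  assumes "prime p" "\<delta> dvd N" "N > 0" "j < multiplicity p N" "\<not> p ^ (multiplicity p N - j) dvd \<delta>"
  shows "\<delta> dvd N div p ^ (j + 1)"
proof -
  have d0: "\<delta> \<noteq> 0" using assms(2,3) by (metis dvd_0_left not_gr_zero)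
  have "p ^ (j + 1) dvd N" using assms(4) by (intro multiplicity_dvd') simp
  then obtain m where m: "N = p ^ (j + 1) * m" by blast
  have m0: "m \<noteq> 0" using m assms(3) by auto
  have pe: "prime_elem p" using assms(1) by simp
  have "multiplicity p \<delta> < multiplicity p N - j"
    using assms(5) d0 assms(1) by (metis multiplicity_dvd' not_less)
  moreover have "multiplicity p N = j + 1 + multiplicity p m"
    unfolding m using m0 pe assms(1) multiplicity_same_power[of p "j + 1"]
    by (subst prime_elem_multiplicity_mult_distrib) (auto simp del: power_Suc power_Suc2 power_add)
  ultimately have mp: "multiplicity p \<delta> \<le> multiplicity p m" by linarith
  have "\<delta> dvd m"
  proof (rule multiplicity_le_imp_dvd)
    fix p' :: nat assume p': "prime p'"
    show "multiplicity p' \<delta> \<le> multiplicity p' m"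
    proof (cases "p' = p")
      case False
      have "multiplicity p' \<delta> \<le> multiplicity p' N" using assms by (intro dvd_imp_multiplicity_le) auto
      also have "\<dots> = multiplicity p' m"
        unfolding m using m0 p' multiplicity_distinct_prime_power[OF p' assms(1) False, of "j + 1"] assms(1)
        by (subst prime_elem_multiplicity_mult_distrib) (auto simp del: power_Suc power_Suc2 power_add)
      finally show ?thesis .
    qed (use mp in simp)
  qed (use d0 in simp)
  then show ?thesis using m assms(1) by (simp add: prime_gt_0_nat)
qed

section \<open>Which \<gamma> occur in v|M\<close>

context weil_vector
begin

lemma prime_power_dvd_N_div_r:
  assumes "p \<in> prime_factors N"
  shows "p ^ (multiplicity p N - 1) dvd N div r"
proof -
  have pp: "prime p" using assms by auto
  obtain m where m: "N = r * m" using r_dvd_N by blast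
  have m0: "m \<noteq> 0" using m level_pos by auto
  have rsplit: "r = p * \<Prod>(prime_factors N - {p})" unfolding r_def using assms by (subst prod.remove[OF _ assms]) auto
  have cop: "coprime p (\<Prod>(prime_factors N - {p}))"
    using assms by (auto intro!: prod_coprime_right primes_coprime)
  have r1: "multiplicity p (\<Prod>(prime_factors N - {p})) = 0"
    using cop pp by (intro not_dvd_imp_multiplicity_0) (metis coprime_common_divisor dvd_refl not_prime_unit)
  have "\<Prod>(prime_factors N - {p}) \<noteq> 0" using r_pos rsplit by (metis mult_0_right not_gr_zero)
  then have "multiplicity p r = 1"
    using pp r1 unfolding rsplit by (subst prime_elem_multiplicity_mult_distrib) (auto simp: prime_gt_0_nat)
  then have "multiplicity p N = 1 + multiplicity p m"
    using pp m0 r_pos m by (metis prime_elem_multiplicity_mult_distrib prime_imp_prime_elem not_gr_zero)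
  then have "p ^ (multiplicity p N - 1) dvd m" by (simp add: multiplicity_dvd)
  then show ?thesis using m r_pos by simp
qed

text \<open>If p^(\<nu>-j) does not divide \<delta>, then \<gamma> is killed by X = N / p^(j+1). For
  \<xi> = X t \<mu> the shift by c\<xi> is c' t times (N/p)\<mu> and all phases are trivial, so v|M
  is constant along the coset of \<gamma>. The operator killing v|M then gives p times its value at
  \<gamma>, so this value is 0.\<close>

lemma prime_power_dvd_of_support:
  assumes M: "M \<in> SL2Z" and p: "p \<in> prime_factors N"
    and c: "M $ 2 $ 1 = int (p ^ j) * c'" "\<not> int p dvd c'"
    and j: "j = 0 \<or> j + 2 \<le> multiplicity p N"
    and \<gamma>: "act v M $ \<gamma> \<noteq> 0" and \<delta>: "\<delta> dvd N" "zmul (int \<delta>) \<gamma> = 0"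
  shows "p ^ (multiplicity p N - j) dvd \<delta>"
proof (rule ccontr)
  assume nd: "\<not> ?thesis"
  define \<nu> where "\<nu> = multiplicity p N"
  have pp: "prime p" and pN: "p dvd N" using p by (auto simp: in_prime_factors_iff)
  have \<nu>1: "\<nu> \<ge> 1" using pp pN level_pos by (simp add: \<nu>_def prime_multiplicity_gt_zero_iff Suc_le_eq)
  then have j\<nu>: "j < \<nu>" using j by (auto simp: \<nu>_def)
  define X where "X = N div p ^ (j + 1)"
  have dX: "\<delta> dvd X" unfolding X_def using pp \<delta>(1) level_pos j\<nu> nd by (intro dvd_div_prime_power) (auto simp: \<nu>_def)
  have NX: "N = p ^ (j + 1) * X"
  proof -
    have "p ^ (j + 1) dvd N" using j\<nu> unfolding \<nu>_def by (intro multiplicity_dvd') simp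
    then show ?thesis by (simp add: X_def)
  qed
  define \<kappa>p where "\<kappa>p = zmul (int (N div p)) \<mu>"
  have Np: "N div p = p ^ j * X" using NX pp by (simp add: prime_gt_0_nat)
  have zp: "zmul (int p) \<kappa>p = 0"
    unfolding \<kappa>p_def zmul_mult[symmetric] using pN by (intro zmul_N_mu) (simp flip: of_nat_mult)
  have \<kappa>p_kappa: "\<kappa>p = zmul (int (r div p)) \<kappa>" using zmul_kappa_p[OF p] by (simp add: \<kappa>p_def)
  have zX: "zmul (int X) \<gamma> = 0" using \<delta>(2) dX by (meson int_dvd_int_iff zmul_dvd_eq_0)
  have bX: "bl (zmul (int X * t) \<mu>) \<gamma> \<in> \<int>" for t
  proof -
    have "zmul (int X * t) \<gamma> = 0" using zX zmul_dvd_eq_0 dvd_triv_left by blast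
    then show ?thesis using eq_mod1_Ints_iff[OF bl_zmul_swap[of "int X * t" \<mu> \<gamma>]] bl_0_left by (simp add: bl_commute)
  qed
  have bk: "bl \<kappa>p \<gamma> \<in> \<int>" unfolding \<kappa>p_def Np using bX[of "int (p ^ j)"] by (simp add: mult.commute)
  have shift: "act v M $ (\<gamma> + zmul (c' * t) \<kappa>p) = act v M $ \<gamma>" for t
  proof -
    define \<xi> where "\<xi> = zmul (int X * t) \<mu>"
    \<comment> \<open>The hypothesis on j enters here. For j = 0, \<xi> is a multiple of the
      isotropic \<kappa>. For 1 <= j <= \<nu> - 2, p still divides X; hence r divides X, so X kills
      \<kappa>, and N divides c (X t)^2.\<close>
    have "bl \<xi> \<kappa> \<in> \<int> \<and> of_int (M$2$1) * q \<xi> \<in> \<int>"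
    proof (cases "j = 0")
      case True
      then have "\<xi> = zmul t \<kappa>p" using Np by (simp add: \<xi>_def \<kappa>p_def mult.commute flip: zmul_mult)
      then have "\<xi> = zmul (t * int (r div p)) \<kappa>" by (simp add: \<kappa>p_kappa zmul_mult)
      then show ?thesis using bl_kappa_kappa q_zmul_kappa by (simp add: bl_commute)
    next
      case False
      then have j2: "j + 2 \<le> \<nu>" using j by (simp add: \<nu>_def)
      have "p ^ (j + 2) dvd N" using j2 unfolding \<nu>_def by (intro multiplicity_dvd') simp
      then have "p ^ (j + 1) * p dvd p ^ (j + 1) * X" unfolding NX[symmetric] by (simp add: mult.commute)
      then have pX: "p dvd X" using pp by (simp add: prime_gt_0_nat)
      have "int r dvd int X" unfolding r_dvd_iff
      proof
        fix p' assume p': "p' \<in> prime_factors N"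
        then have "prime p'" "p' dvd p ^ (j + 1) * X" using NX by (auto simp: in_prime_factors_iff)
        then have "p' = p \<or> p' dvd X" using pp
          by (metis prime_dvd_mult_iff prime_dvd_power primes_dvd_imp_eq)
        then show "int p' dvd int X" using pX by auto
      qed
      then have "zmul (int X * t) \<kappa> = 0" by (simp add: zmul_kappa_eq_0_iff)
      then have 1: "bl \<xi> \<kappa> \<in> \<int>" unfolding \<xi>_def
        using eq_mod1_Ints_iff[OF bl_zmul_swap[of "int X * t" \<mu> \<kappa>]] bl_0_left by (simp add: bl_commute)
      obtain X' where X': "X = p * X'" using pX by blast
      have "M$2$1 * (int X * t)\<^sup>2 = int N * (c' * int X' * t\<^sup>2)"
        unfolding c NX by (subst (1) X') (simp add: X' power2_eq_square algebra_simps)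
      then have "of_int (M$2$1 * (int X * t)\<^sup>2) * q \<mu> \<in> \<int>" by (intro level_q_dvd) simp
      moreover have "eq_mod1 (of_int (M$2$1) * q \<xi>) (of_int (M$2$1) * (of_int ((int X * t)\<^sup>2) * q \<mu>))"
        unfolding \<xi>_def by (intro eq_mod1_mult_int q_zmul)
      ultimately have "of_int (M$2$1) * q \<xi> \<in> \<int>" using eq_mod1_Ints_iff by (simp add: mult.assoc)
      then show ?thesis using 1 by blast
    qed
    then have b: "bl \<xi> \<kappa> \<in> \<int>" and cq: "of_int (M$2$1) * q \<xi> \<in> \<int>" by auto
    have z: "zmul (M$2$1) \<xi> = zmul (c' * t) \<kappa>p"
      unfolding \<xi>_def \<kappa>p_def zmul_mult[symmetric] c Np by (simp add: mult_ac)
    have "of_int (M$2$1 * M$2$2) * q \<xi> + of_int (M$2$2) * bl \<xi> \<gamma> \<in> \<int>"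
      using int_mult_Ints[OF cq, of "M$2$2"] int_mult_Ints[OF bX[of t], of "M$2$2"]
      by (simp add: \<xi>_def mult_ac)
    then have er1: "er (of_int (M$2$1 * M$2$2) * q \<xi> + of_int (M$2$2) * bl \<xi> \<gamma>) = 1"
      using er_eq_1_iff by blast
    show ?thesis using act_v_heis[OF M b, of \<gamma>] unfolding z er1 by simp
  qed
  \<comment> \<open>c' is invertible modulo p, so the shifts by c' t reach every multiple of
    (N/p)\<mu>.\<close>
  have coset: "act v M $ (\<gamma> + zmul (int i * M$1$1) \<kappa>p) = act v M $ \<gamma>" for i
  proof -
    have "coprime c' (int p)" using c(2) pp by (metis coprime_commute prime_imp_coprime prime_nat_int_transfer)
    then obtain t where "[c' * t = int i * M$1$1] (mod int p)"
      using cong_solve_dvd_int[of c' "int p"] by (auto simp: coprime_iff_gcd_eq_1)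
    then have "zmul (c' * t) \<kappa>p = zmul (int i * M$1$1) \<kappa>p"
      using zp by (intro zmul_cong[of "int p"]) (auto simp: cong_iff_dvd_diff)
    then show ?thesis using shift[of t] by simp
  qed
  have "of_nat p * act v M $ \<gamma> = (\<Sum>i<p. er (of_int (int i * M$1$2) * bl \<kappa>p \<gamma>) * act v M $ (\<gamma> + zmul (int i * M$1$1) \<kappa>p))"
    using er_eq_1_iff[THEN iffD2, OF int_mult_Ints[OF bk]] unfolding coset by (simp del: of_int_mult)
  also have "\<dots> = 0" using act_v_sum_coset[OF M p, of \<gamma>] by (simp only: \<kappa>p_def)
  finally show False using \<gamma> pp by (simp add: prime_gt_0_nat)
qed

text \<open>The Heisenberg operator used here belongs to a multiple of \<open>\<gamma>\<close> itself that is killed by \<open>c\<close>.\<close>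

lemma middle_cusp_imp_2:
  assumes M: "M \<in> SL2Z" and p: "p \<in> prime_factors N"
    and c: "M $ 2 $ 1 = int (p ^ j) * c'" "\<not> int p dvd c'"
    and j: "1 \<le> j" "j + 2 \<le> multiplicity p N"
    and \<gamma>: "act v M $ \<gamma> \<noteq> 0" and \<delta>: "\<delta> dvd N" "zmul (int \<delta>) \<gamma> = 0" "eq_mod1 (q \<gamma>) (1 / of_nat \<delta>)"
  shows "p = 2 \<and> j = 1"
proof -
  have pp: "prime p" using p by auto
  have d0: "\<delta> > 0" using \<delta>(1) level_pos by (metis dvd_0_left not_gr_zero)
  \<comment> \<open>p^k is the largest power of p dividing both c and \<delta>. Hence c kills \<xi>
    = (\<delta>/p^k)\<gamma>, and c q(\<xi>) is integral. What remains of the phase is d (\<xi>,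
    \<gamma>) = 2d/p^k modulo 1; it must be integral, so p^k divides 2.\<close>
  define k where "k = min j (multiplicity p \<delta>)"
  have pd: "p ^ (multiplicity p N - j) dvd \<delta>"
    using prime_power_dvd_of_support[OF M p c _ \<gamma> \<delta>(1,2)] j by blast
  then have v2: "multiplicity p \<delta> \<ge> 2"
    using j d0 prime_gt_1_nat[OF pp] multiplicity_geI[of \<delta> p "multiplicity p N - j"] by auto
  have k1: "k \<ge> 1" "k \<le> j" using j v2 by (auto simp: k_def)
  have "p ^ k dvd \<delta>" by (rule multiplicity_dvd') (simp add: k_def)
  then obtain s where s: "\<delta> = p ^ k * s" by blast
  have s0: "s > 0" using s d0 by (cases s) auto
  have pk0: "p ^ k > 0" using pp by (simp add: prime_gt_0_nat)
  have pkc: "int (p ^ k) dvd M$2$1" unfolding c using k1 by (simp add: le_imp_power_dvd)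
  define \<xi> where "\<xi> = zmul (int s) \<gamma>"
  have "bl \<xi> \<kappa> \<in> \<int>"
  proof -
    have "p ^ k dvd p ^ (multiplicity p N - 1)" using k1 j by (intro le_imp_power_dvd) linarith
    then have "p ^ k dvd N div r" using prime_power_dvd_N_div_r[OF p] dvd_trans by blast
    then have "int \<delta> dvd int (N div r) * int s" unfolding s by (metis int_dvd_int_iff mult_dvd_mono of_nat_mult dvd_refl)
    then have "zmul (int (N div r)) \<xi> = 0" unfolding \<xi>_def zmul_mult[symmetric] using \<delta>(2) zmul_dvd_eq_0 by blast
    then show ?thesis unfolding \<kappa>_def
      using eq_mod1_Ints_iff[OF bl_zmul_swap[of "int (N div r)" \<xi> \<mu>]] bl_0_left by simp
  qed
  note heis = act_v_heis[OF M this, of \<gamma>]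
  have "int \<delta> dvd M$2$1 * int s" unfolding s using pkc by (simp add: mult_dvd_mono)
  then have z: "zmul (M$2$1) \<xi> = 0" unfolding \<xi>_def zmul_mult[symmetric] using \<delta>(2) zmul_dvd_eq_0 by blast
  have int: "of_int (M$2$1 * M$2$2) * q \<xi> + of_int (M$2$2) * bl \<xi> \<gamma> \<in> \<int>"
    using heis \<gamma> er_eq_1_iff unfolding z by auto
  have sd: "of_int (int s) * (1 / of_nat \<delta>) = (1 / of_nat (p ^ k) :: rat)"
    unfolding s using s0 by simp
  have "eq_mod1 (q \<xi>) (of_int ((int s)\<^sup>2) * q \<gamma>)" unfolding \<xi>_def by (rule q_zmul)
  also have "eq_mod1 \<dots> (of_int ((int s)\<^sup>2) * (1 / of_nat \<delta>))" by (intro eq_mod1_mult_int \<delta>)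
  also have "of_int ((int s)\<^sup>2) * (1 / of_nat \<delta>) = of_int (int s) * (1 / of_nat (p ^ k) :: rat)"
    unfolding sd[symmetric] by (simp add: power2_eq_square)
  finally have "eq_mod1 (of_int (M$2$1 * M$2$2) * q \<xi>) (of_int (M$2$1 * M$2$2) * (of_int (int s) * (1 / of_nat (p ^ k))))"
    by (intro eq_mod1_mult_int)
  moreover have "of_int (M$2$1 * M$2$2) * (of_int (int s) * (1 / of_nat (p ^ k))) \<in> (\<int> :: rat set)"
  proof -
    obtain y where y: "M$2$1 = int (p ^ k) * y" using pkc by blast
    have "of_int (M$2$1 * M$2$2) * (of_int (int s) * (1 / of_nat (p ^ k))) = (of_int (y * M$2$2 * int s) :: rat)"
      unfolding y using prime_gt_0_nat[OF pp] by simp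
    then show ?thesis by (metis Ints_of_int)
  qed
  ultimately have "of_int (M$2$1 * M$2$2) * q \<xi> \<in> \<int>" using eq_mod1_Ints_iff by blast
  then have "of_int (M$2$2) * bl \<xi> \<gamma> \<in> \<int>" using int Ints_diff by (metis add_diff_cancel_left')
  moreover have "eq_mod1 (of_int (M$2$2) * bl \<xi> \<gamma>) (of_int (M$2$2) * (2 * (1 / of_nat (p ^ k))))"
  proof (rule eq_mod1_mult_int)
    have "eq_mod1 (bl \<xi> \<gamma>) (of_int (int s) * bl \<gamma> \<gamma>)" unfolding \<xi>_def by (rule bl_zmul_left)
    also have "eq_mod1 \<dots> (of_int (int s) * (2 * q \<gamma>))" by (intro eq_mod1_mult_int bl_self)
    also have "of_int (int s) * (2 * q \<gamma>) = of_int (2 * int s) * q \<gamma>" by simp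
    also have "eq_mod1 \<dots> (of_int (2 * int s) * (1 / of_nat \<delta>))" by (intro eq_mod1_mult_int \<delta>)
    also have "of_int (2 * int s) * (1 / of_nat \<delta>) = (2 * (1 / of_nat (p ^ k)) :: rat)"
      unfolding sd[symmetric] by simp
    finally show "eq_mod1 (bl \<xi> \<gamma>) (2 * (1 / of_nat (p ^ k)))" .
  qed
  ultimately have "of_int (M$2$2) * (2 * (1 / of_nat (p ^ k))) \<in> (\<int> :: rat set)" using eq_mod1_Ints_iff by blast
  then obtain y where y: "of_int (M$2$2) * (2 * (1 / of_nat (p ^ k))) = (of_int y :: rat)" by (auto elim: Ints_cases)
  then have "of_int (M$2$2 * 2) = (of_int (y * int (p ^ k)) :: rat)" using prime_gt_0_nat[OF pp] by (simp add: field_simps)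
  then have "M$2$2 * 2 = y * int (p ^ k)" by (simp only: of_int_eq_iff)
  then have "int (p ^ k) dvd M$2$2 * 2" by simp
  moreover have "coprime (int (p ^ k)) (M$2$2)"
  proof -
    have "int p dvd M$2$1" unfolding c using j(1) by simp
    moreover have "M$1$1 * M$2$2 - M$1$2 * M$2$1 = 1" using M by (simp add: SL2Z_def det_2)
    ultimately have "int p dvd M$2$2 \<Longrightarrow> int p dvd 1" by (metis dvd_diff dvd_mult)
    then have "\<not> int p dvd M$2$2" using prime_gt_1_nat[OF pp] by auto
    then show ?thesis using pp by (simp add: prime_imp_coprime)
  qed
  ultimately have "int (p ^ k) dvd 2" by (simp add: coprime_dvd_mult_right_iff)
  then have pk2: "p ^ k dvd 2" by (metis int_dvd_int_iff of_nat_numeral)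
  then have "p dvd 2" using k1 by (metis One_nat_def Suc_le_lessD dvd_power dvd_trans)
  then have p2: "p = 2" using pp primes_dvd_imp_eq two_is_prime_nat by blast
  have "k < 2"
  proof (rule ccontr)
    assume "\<not> k < 2"
    then have "(2::nat) ^ 2 dvd 2 ^ k" by (intro le_imp_power_dvd) simp
    then have "(2::nat) ^ 2 dvd 2" using pk2 p2 dvd_trans by blast
    then show False by (auto dest: dvd_imp_le)
  qed
  \<comment> \<open>\<delta> has at least two factors p, so the minimum k = 1 is attained by
    j.\<close>
  then have "j = 1" using k1 v2 by (auto simp: k_def min_def split: if_splits)
  then show ?thesis using p2 by blast
qed

text \<open>For \<xi> in D_2 the shift by c\<xi> vanishes, and triviality of the phase reads (\<xi>,
  \<gamma>) = 2 q(\<xi>) modulo 1. It follows that 2\<gamma> is orthogonal to D_4, say 2\<gamma> =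
  4\<eta>, and z = \<gamma> - 2\<eta> lies in D_2 and has the same pairing with D_2. Comparing
  multiples of q(\<gamma>) and q(z), where 4 q(z) is integral, then limits the powers of 2 in N and
  \<delta>.\<close>

lemma odd_component_cusp_2:
  assumes M: "M \<in> SL2Z" and N8: "8 dvd N"
    and c: "M $ 2 $ 1 = 2 * c'" "odd c'"
    and \<gamma>: "act v M $ \<gamma> \<noteq> 0" and \<delta>: "\<delta> dvd N" "zmul (int \<delta>) \<gamma> = 0" "eq_mod1 (q \<gamma>) (1 / of_nat \<delta>)"
  shows "\<not> 16 dvd N \<and> \<not> 8 dvd \<delta> \<and> odd_two_torsion"
proof -
  have two: "2 \<in> prime_factors N" using N8 level_pos by (auto simp: in_prime_factors_iff intro: dvd_trans)
  define \<nu> where "\<nu> = multiplicity 2 N"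
  have \<nu>3: "\<nu> \<ge> 3" unfolding \<nu>_def using N8 level_pos by (intro multiplicity_geI) auto
  have d0: "\<delta> > 0" using \<delta>(1) level_pos by (metis dvd_0_left not_gr_zero)
  have pd: "2 ^ (\<nu> - 1) dvd \<delta>"
    using prime_power_dvd_of_support[OF M two, of 1 c' \<gamma> \<delta>] c \<gamma> \<delta> \<nu>3 by (simp add: \<nu>_def)
  have "(2::nat) ^ 1 dvd 2 ^ (\<nu> - 1)" using \<nu>3 by (intro le_imp_power_dvd) simp
  then have even_Nr: "2 dvd N div r"
    using prime_power_dvd_N_div_r[OF two] dvd_trans unfolding \<nu>_def by fastforce
  have oddd: "odd (M$2$2)"
  proof -
    have "M$1$1 * M$2$2 - M$1$2 * M$2$1 = 1" using M by (simp add: SL2Z_def det_2)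
    then show ?thesis unfolding c by (metis dvd_diff dvd_mult dvd_mult2 dvd_triv_left odd_one mult.commute)
  qed
  have key: "eq_mod1 (bl \<xi> \<gamma>) (2 * q \<xi>)" if xi: "zmul 2 \<xi> = 0" for \<xi>
  proof -
    have "zmul (int (N div r)) \<xi> = 0" using xi even_Nr by (metis int_dvd_int_iff of_nat_numeral zmul_dvd_eq_0)
    then have "bl \<xi> \<kappa> \<in> \<int>" unfolding \<kappa>_def
      using eq_mod1_Ints_iff[OF bl_zmul_swap[of "int (N div r)" \<xi> \<mu>]] bl_0_left by simp
    from act_v_heis[OF M this, of \<gamma>]
    have int: "of_int (M$2$1 * M$2$2) * q \<xi> + of_int (M$2$2) * bl \<xi> \<gamma> \<in> \<int>"
      using \<gamma> er_eq_1_iff zmul_dvd_eq_0[OF xi, of "M$2$1"] by (auto simp: c)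
    have q4: "4 * q \<xi> \<in> \<int>"
      using eq_mod1_Ints_iff[OF q_zmul[of 2 \<xi>]] q_0 xi by simp
    have b2: "2 * bl \<xi> \<gamma> \<in> \<int>" using bl_zmul_Ints[OF xi, of \<gamma>] by simp
    obtain e where e: "M$2$2 = 2 * e + 1" using oddd by (metis oddE)
    obtain f where f: "c' = 2 * f + 1" using c(2) by (metis oddE)
    have "of_int (M$2$1 * M$2$2) * q \<xi> + of_int (M$2$2) * bl \<xi> \<gamma>
      = bl \<xi> \<gamma> + 2 * q \<xi> + (of_int e * (2 * bl \<xi> \<gamma>) + of_int (e * (2 * f + 1) + f) * (4 * q \<xi>))"
      by (simp add: c e f algebra_simps)
    then have "bl \<xi> \<gamma> + 2 * q \<xi> \<in> \<int>"
      using int int_mult_Ints[OF b2, of e] int_mult_Ints[OF q4, of "e * (2 * f + 1) + f"]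
      by (metis (no_types, lifting) Ints_add Ints_diff add_diff_cancel_right')
    then have "bl \<xi> \<gamma> + 2 * q \<xi> - 4 * q \<xi> \<in> \<int>" using q4 by (rule Ints_diff)
    then show ?thesis by (simp add: eq_mod1_def)
  qed
  \<comment> \<open>For b in D_4, \<open>key\<close> applies to 2b: (2b, \<gamma>) = 2 q(2b) = 8
    q(b) = 4 (b, b) = 0 modulo 1.\<close>
  have "bl (zmul 2 \<gamma>) b \<in> \<int>" if b: "zmul 4 b = 0" for b
  proof -
    have "zmul 2 (zmul 2 b) = 0" using b zmul_mult[of 2 2 b] by simp
    then have k: "eq_mod1 (bl (zmul 2 b) \<gamma>) (2 * q (zmul 2 b))" by (rule key)
    have "eq_mod1 (2 * q (zmul 2 b)) (of_int 4 * (2 * q b))"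
      using eq_mod1_mult_int[OF q_zmul[of 2 b], of 2] by simp
    also have "eq_mod1 \<dots> (of_int 4 * bl b b)" by (intro eq_mod1_mult_int eq_mod1_sym[OF bl_self])
    finally have "eq_mod1 (bl (zmul 2 b) \<gamma>) (of_int 4 * bl b b)" using k eq_mod1_trans by blast
    moreover have "of_int 4 * bl b b \<in> \<int>" using bl_zmul_Ints[OF b] .
    ultimately have "bl (zmul 2 b) \<gamma> \<in> \<int>" using eq_mod1_Ints_iff by blast
    then show ?thesis using eq_mod1_Ints_iff[OF bl_zmul_swap[of 2 \<gamma> b]] by (simp add: bl_commute)
  qed
  from annihilator_kernel[OF this] obtain \<eta> where \<eta>: "zmul 2 \<gamma> = zmul 4 \<eta>" by blast
  define z where "z = \<gamma> - zmul 2 \<eta>"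
  have z2: "zmul 2 z = 0" using \<eta> zmul_mult[of 2 2 \<eta>] by (simp add: z_def zmul_diff_right)
  have qz4: "4 * q z \<in> \<int>" using eq_mod1_Ints_iff[OF q_zmul[of 2 z]] q_0 z2 by simp
  have qg: "eq_mod1 (q \<gamma>) (q z + 4 * q \<eta>)"
  proof -
    have "eq_mod1 (q (z + zmul 2 \<eta>)) (q z + of_int (2\<^sup>2) * q \<eta> + of_int 2 * bl z \<eta>)" by (rule q_add_zmul)
    moreover have "of_int 2 * bl z \<eta> \<in> \<int>" using bl_zmul_Ints[OF z2] .
    ultimately have "eq_mod1 (q (z + zmul 2 \<eta>)) (q z + of_int (2\<^sup>2) * q \<eta>)"
      unfolding eq_mod1_def by (metis Ints_add diff_add_cancel diff_diff_add add.commute)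
    then show ?thesis by (simp add: z_def)
  qed
  have bz: "eq_mod1 (bl \<xi> z) (2 * q \<xi>)" if xi: "zmul 2 \<xi> = 0" for \<xi>
  proof -
    have "eq_mod1 (bl \<xi> \<gamma>) (bl \<xi> z + bl \<xi> (zmul 2 \<eta>))" using bl_add_right[of \<xi> z "zmul 2 \<eta>"] by (simp add: z_def)
    moreover have "bl \<xi> (zmul 2 \<eta>) \<in> \<int>"
      using eq_mod1_Ints_iff[OF bl_zmul_swap[of 2 \<xi> \<eta>]] xi bl_0_left by simp
    ultimately have "eq_mod1 (bl \<xi> \<gamma>) (bl \<xi> z)" unfolding eq_mod1_def
      by (metis Ints_add diff_add_cancel diff_diff_add add.commute)
    then show ?thesis using key[OF xi] eq_mod1_sym eq_mod1_trans by blast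
  qed
  obtain N' where N': "N = 8 * N'" using N8 by blast
  text \<open>Multiplying by \<open>N/4\<close> kills the contribution of \<open>\<eta>\<close>.\<close>
  have "eq_mod1 (of_int (int (2 * N')) * (1 / of_nat \<delta>)) (of_int (int (2 * N')) * (q z + 4 * q \<eta>))"
    using \<delta>(3) qg by (intro eq_mod1_mult_int) (meson eq_mod1_sym eq_mod1_trans)
  moreover have "of_int (int (2 * N')) * (4 * q \<eta>) \<in> \<int>" using level_q[of \<eta>] by (simp add: N' mult_ac)
  ultimately have e2: "eq_mod1 (of_nat (2 * N') / of_nat \<delta>) (of_nat (2 * N') * q z)"
    unfolding eq_mod1_def by (simp add: distrib_left) (metis Ints_add diff_add_cancel diff_diff_add add.commute)
  have dvdI: "\<delta> dvd m" if mI: "of_nat m / of_nat \<delta> \<in> (\<int> :: rat set)" for m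
  proof -
    obtain y where "of_nat m / of_nat \<delta> = (of_int y :: rat)" using mI by (auto elim: Ints_cases)
    then have "of_int (int m) = (of_int (y * int \<delta>) :: rat)" using d0 by (simp add: field_simps)
    then have "int m = y * int \<delta>" by (simp only: of_int_eq_iff)
    then have "int \<delta> dvd int m" by simp
    then show ?thesis by simp
  qed
  have n2: "multiplicity 2 \<delta> \<ge> \<nu> - 1" using pd d0 by (intro multiplicity_geI) auto
  have N'0: "N' \<noteq> 0" using N' level_pos by auto
  have mm: "multiplicity 2 (2 ^ i * N') = i + multiplicity 2 N'" for i
    using N'0 by (subst prime_elem_multiplicity_mult_distrib) auto
  have mN: "\<nu> = 3 + multiplicity 2 N'" using mm[of 3] by (simp add: \<nu>_def N')
  have mult_le: "multiplicity 2 \<delta> \<le> i + multiplicity 2 N'" if "\<delta> dvd 2 ^ i * N'" for i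
    unfolding mm[symmetric] using that N'0 by (intro dvd_imp_multiplicity_le) auto
  \<comment> \<open>\<delta> has at least \<nu> - 1 factors 2 and 2N' = N/4 has only \<nu> - 2, so
    the quotient is not integral. As 4 q(z) is integral, this will make N' odd.\<close>
  have nz: "of_nat (2 * N') * q z \<notin> \<int>"
  proof
    assume "of_nat (2 * N') * q z \<in> \<int>"
    then have "of_nat (2 * N') / of_nat \<delta> \<in> (\<int> :: rat set)" using e2 eq_mod1_Ints_iff by blast
    then have "\<delta> dvd 2 * N'" by (rule dvdI)
    then show False using mult_le[of 1] n2 mN by simp
  qed
  have "odd N'"
  proof
    assume "even N'"
    then obtain n where "N' = 2 * n" by blast
    then have "of_nat (2 * N') * q z = of_int (int n) * (4 * q z)" by simp
    then show False using nz qz4 int_mult_Ints by metis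
  qed
  moreover have "2 * q z \<notin> \<int>"
  proof
    assume "2 * q z \<in> \<int>"
    then have "of_int (int N') * (2 * q z) \<in> \<int>" by (rule int_mult_Ints)
    then show False using nz by (simp add: mult_ac)
  qed
  moreover have "\<not> 8 dvd \<delta>"
  proof
    assume "8 dvd \<delta>"
    then have 3: "multiplicity 2 \<delta> \<ge> 3" using d0 by (intro multiplicity_geI) auto
    have "eq_mod1 (of_int 2 * (of_nat (2 * N') / of_nat \<delta>)) (of_int 2 * (of_nat (2 * N') * q z))"
      using e2 by (rule eq_mod1_mult_int)
    moreover have "of_int 2 * (of_nat (2 * N') * q z) \<in> \<int>"
      using int_mult_Ints[OF qz4, of "int N'"] by (simp add: mult_ac)
    ultimately have "of_int 2 * (of_nat (2 * N') / of_nat \<delta>) \<in> (\<int> :: rat set)" using eq_mod1_Ints_iff by blast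
    then have "of_nat (4 * N') / of_nat \<delta> \<in> (\<int> :: rat set)" by simp
    then have "\<delta> dvd 2 ^ 2 * N'" using dvdI by simp
    then show False using mult_le[of 2] 3 \<open>odd N'\<close> by (simp add: not_dvd_imp_multiplicity_0)
  qed
  ultimately show ?thesis unfolding odd_two_torsion_def N' using z2 bz by auto
qed

text \<open>An element of odd order is orthogonal to D_4, and c kills D_4, so for \<xi> in D_4 only
  the phase c d q(\<xi>) is left. It is an odd multiple of 4 q(\<xi>), and 8 q(\<xi>) is
  integral.\<close>

lemma even_component_cusp_4:
  assumes M: "M \<in> SL2Z" and N8: "8 dvd N"
    and c: "M $ 2 $ 1 = 4 * c'" "odd c'"
    and \<gamma>: "act v M $ \<gamma> \<noteq> 0" and \<delta>: "odd \<delta>" "zmul (int \<delta>) \<gamma> = 0"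
  shows even_four_torsion
  unfolding even_four_torsion_def
proof (intro allI impI)
  fix \<xi> assume xi: "zmul 4 \<xi> = (0::'a)"
  have two: "2 \<in> prime_factors N" using N8 level_pos by (auto simp: in_prime_factors_iff intro: dvd_trans)
  define \<nu> where "\<nu> = multiplicity 2 N"
  have \<nu>3: "\<nu> \<ge> 3" unfolding \<nu>_def using N8 level_pos by (intro multiplicity_geI) auto
  have "2 ^ 2 dvd (2::nat) ^ (\<nu> - 1)" using \<nu>3 by (intro le_imp_power_dvd) linarith
  then have "2 ^ 2 dvd N div r" using prime_power_dvd_N_div_r[OF two] dvd_trans unfolding \<nu>_def by blast
  then have "int 4 dvd int (N div r)" unfolding int_dvd_int_iff by simp
  then have "zmul (int (N div r)) \<xi> = 0" using xi zmul_dvd_eq_0 by simp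
  then have "bl \<xi> \<kappa> \<in> \<int>" unfolding \<kappa>_def
    using eq_mod1_Ints_iff[OF bl_zmul_swap[of "int (N div r)" \<xi> \<mu>]] bl_0_left by simp
  from act_v_heis[OF M this, of \<gamma>]
  have int: "of_int (M$2$1 * M$2$2) * q \<xi> + of_int (M$2$2) * bl \<xi> \<gamma> \<in> \<int>"
    using \<gamma> er_eq_1_iff zmul_dvd_eq_0[OF xi, of "M$2$1"] by (auto simp: c)
  have oddd: "odd (M$2$2)"
  proof -
    have "M$1$1 * M$2$2 - M$1$2 * M$2$1 = 1" using M by (simp add: SL2Z_def det_2)
    then have "M$1$1 * M$2$2 = 1 + 2 * (2 * M$1$2 * c')" by (simp add: c)
    then show ?thesis by (metis even_mult_iff odd_one even_add dvd_triv_left)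
  qed
  have b: "bl \<xi> \<gamma> \<in> \<int>"
  proof -
    have "coprime (int \<delta>) (2 ^ 2)" using \<delta>(1) by (simp only: coprime_power_right_iff) simp
    then have "coprime (int \<delta>) 4" by simp
    then obtain x y where "x * int \<delta> + y * 4 = 1" using bezout_int[of "int \<delta>" 4] by (auto simp: coprime_iff_gcd_eq_1)
    then have "bl \<xi> \<gamma> = of_int x * (of_int (int \<delta>) * bl \<gamma> \<xi>) + of_int y * (of_int 4 * bl \<xi> \<gamma>)"
      by (metis (no_types, lifting) bl_commute distrib_right mult.assoc mult_1 of_int_1 of_int_add of_int_mult)
    then show ?thesis using bl_zmul_Ints[OF \<delta>(2), of \<xi>] bl_zmul_Ints[OF xi, of \<gamma>] by (metis Ints_add int_mult_Ints)
  qed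
  have "of_int (M$2$2) * bl \<xi> \<gamma> \<in> \<int>" using b by (rule int_mult_Ints)
  then have i1: "of_int (M$2$1 * M$2$2) * q \<xi> \<in> \<int>" using int by (metis Ints_diff add_diff_cancel_right')
  have q8: "8 * q \<xi> \<in> \<int>"
  proof -
    have "eq_mod1 (of_int 4 * bl \<xi> \<xi>) (of_int 4 * (2 * q \<xi>))" by (intro eq_mod1_mult_int bl_self)
    then show ?thesis using bl_zmul_Ints[OF xi, of \<xi>] eq_mod1_Ints_iff by fastforce
  qed
  have "odd (c' * M$2$2)" using c(2) oddd by simp
  then obtain e where e: "c' * M$2$2 = 2 * e + 1" by (metis oddE)
  have "of_int (M$2$1 * M$2$2) * q \<xi> = of_int (4 * (c' * M$2$2)) * q \<xi>" by (simp add: c)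
  also have "\<dots> = 4 * q \<xi> + of_int e * (8 * q \<xi>)" unfolding e by (simp add: algebra_simps)
  finally show "4 * q \<xi> \<in> \<int>" using i1 int_mult_Ints[OF q8, of e] by (metis Ints_diff add_diff_cancel_right')
qed

end

section \<open>Gauss sums and the prime 2\<close>

lemma even_card_involution:
  assumes "finite A" "\<And>x. x \<in> A \<Longrightarrow> f x \<in> A \<and> f (f x) = x \<and> f x \<noteq> x"
  shows "even (card A)"
  using assms
proof (induction A rule: finite_psubset_induct)
  case (psubset A)
  show ?case
  proof (cases "A = {}")
    case False
    then obtain a where a: "a \<in> A" by blast
    let ?B = "A - {a, f a}"
    have "even (card ?B)"
    proof (rule psubset.IH)
      show "?B \<subset> A" using a by blast
      show "f x \<in> ?B \<and> f (f x) = x \<and> f x \<noteq> x" if "x \<in> ?B" for x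
        using psubset.prems[of x] psubset.prems[of a] that a by auto
    qed
    moreover have "card A = card ?B + 2"
    proof -
      have "f a \<noteq> a" "f a \<in> A" using psubset.prems[OF a] by auto
      then have "card {a, f a} = 2" "{a, f a} \<subseteq> A" using a by auto
      then show ?thesis using psubset.hyps card_Diff_subset[of "{a, f a}" A] card_mono[of A "{a, f a}"] by simp
    qed
    ultimately show ?thesis by simp
  qed simp
qed

text \<open>In the Gaussian integers x + iy is a unit times (1 + i)^(2k+1), which lies on a
  diagonal. The proof descends by a factor 2, since odd x and y would give x^2 + y^2 = 2 modulo
  4.\<close>

lemma sum_two_squares_odd_power:
  fixes x y :: int
  assumes "x\<^sup>2 + y\<^sup>2 = 2 ^ (2 * k + 1)"
  shows "x\<^sup>2 = y\<^sup>2"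
  using assms
proof (induction k arbitrary: x y)
  case 0
  then have s: "x\<^sup>2 + y\<^sup>2 = 2" by simp
  have small: "w \<in> {- 1, 0, 1}" if "w\<^sup>2 \<le> 2" for w :: int
  proof -
    have "\<bar>w\<bar> < 2"
    proof (rule ccontr)
      assume "\<not> \<bar>w\<bar> < 2"
      then have "2\<^sup>2 \<le> \<bar>w\<bar>\<^sup>2" by (intro power_mono) auto
      then show False using that by simp
    qed
    then show ?thesis by auto
  qed
  have "x\<^sup>2 \<ge> 0" "y\<^sup>2 \<ge> 0" by simp_all
  then have "x\<^sup>2 \<le> 2" "y\<^sup>2 \<le> 2" using s by linarith+
  then have "x \<in> {- 1, 0, 1}" "y \<in> {- 1, 0, 1}" using small by blast+
  then show ?case using s by auto
next
  case (Suc k)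
  have e: "even (x\<^sup>2 + y\<^sup>2)" unfolding Suc.prems by simp
  have "even x"
  proof (rule ccontr)
    assume ox: "odd x"
    then have "odd y" using e by simp
    then obtain a b where "x = 2 * a + 1" "y = 2 * b + 1" using ox by (metis oddE)
    then have "x\<^sup>2 + y\<^sup>2 = 4 * (a\<^sup>2 + a + b\<^sup>2 + b) + 2" by (simp add: power2_eq_square algebra_simps)
    moreover have "(2::int) ^ (2 * Suc k + 1) = 4 * 2 ^ (2 * k + 1)" by simp
    ultimately have "4 * 2 ^ (2 * k + 1) - 4 * (a\<^sup>2 + a + b\<^sup>2 + b) = (2::int)" using Suc.prems by simp
    then show False by presburger
  qed
  moreover have "even y" using e \<open>even x\<close> by simp
  ultimately obtain a b where ab: "x = 2 * a" "y = 2 * b" by (meson evenE)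
  have "a\<^sup>2 + b\<^sup>2 = 2 ^ (2 * k + 1)" using Suc.prems by (simp add: ab power_mult_distrib)
  then have "a\<^sup>2 = b\<^sup>2" by (rule Suc.IH)
  then show ?case by (simp add: ab power_mult_distrib)
qed

lemma sum_gaussian_integer:
  assumes "\<And>x. x \<in> A \<Longrightarrow> (f x :: complex) ^ 4 = 1"
  shows "\<exists>a b :: int. sum f A = Complex (of_int a) (of_int b)"
  using assms
proof (induction A rule: infinite_finite_induct)
  case (insert x A)
  obtain a b :: int where ab: "sum f A = Complex (of_int a) (of_int b)" using insert by auto
  have "(f x - 1) * (f x + 1) * (f x - \<i>) * (f x + \<i>) = f x ^ 4 - 1"
    by (simp add: algebra_simps power4_eq_xxxx)
  then have "(f x - 1) * (f x + 1) * (f x - \<i>) * (f x + \<i>) = 0" using insert.prems by simp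
  then consider "f x = 1" | "f x = - 1" | "f x = \<i>" | "f x = - \<i>"
    by (auto simp: eq_neg_iff_add_eq_0)
  then show ?case
  proof cases
    case 1 then show ?thesis using insert ab by (intro exI[of _ "a + 1"] exI[of _ b]) (simp add: complex_eq_iff)
  next
    case 2 then show ?thesis using insert ab by (intro exI[of _ "a - 1"] exI[of _ b]) (simp add: complex_eq_iff)
  next
    case 3 then show ?thesis using insert ab by (intro exI[of _ a] exI[of _ "b + 1"]) (simp add: complex_eq_iff)
  next
    case 4 then show ?thesis using insert ab by (intro exI[of _ a] exI[of _ "b - 1"]) (simp add: complex_eq_iff)
  qed
qed (auto intro!: exI[of _ "0::int"] simp: complex_eq_iff)

section \<open>Subgroups and Gauss sums over them\<close>

definition subgrp :: "'a::ab_group_add set \<Rightarrow> bool" where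
  "subgrp H \<longleftrightarrow> 0 \<in> H \<and> (\<forall>x\<in>H. \<forall>y\<in>H. x + y \<in> H) \<and> (\<forall>x\<in>H. - x \<in> H)"

lemma subgrp_diff: "subgrp H \<Longrightarrow> x \<in> H \<Longrightarrow> y \<in> H \<Longrightarrow> x - y \<in> H"
  unfolding subgrp_def by (metis add_uminus_conv_diff)

lemma subgrp_shift: "subgrp H \<Longrightarrow> h \<in> H \<Longrightarrow> bij_betw (\<lambda>x. x + h) H H"
  by (rule bij_betwI[where g = "\<lambda>x. x - h"]) (auto simp: subgrp_diff, simp add: subgrp_def)

lemma subgrp_kernel: "subgrp {x::'a::ab_group_add. zmul m x = 0}"
  by (simp add: subgrp_def zmul_add_right zmul_minus_right)

lemma card_kernel_image:
  fixes H :: "'a::{ab_group_add,finite} set"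
  assumes H: "subgrp H"
  shows "card H = card {x\<in>H. zmul m x = 0} * card (zmul m ` H)"
proof -
  have fib: "card {x\<in>H. zmul m x = y} = card {x\<in>H. zmul m x = 0}" if yH: "y \<in> zmul m ` H" for y
  proof -
    obtain h where h: "h \<in> H" "y = zmul m h" using yH by blast
    have "bij_betw (\<lambda>x. x + h) {x\<in>H. zmul m x = 0} {x\<in>H. zmul m x = y}"
      by (rule bij_betwI[where g = "\<lambda>x. x - h"])
        (use H h in \<open>auto simp: zmul_add_right zmul_diff_right subgrp_diff\<close>, simp add: subgrp_def)
    then show ?thesis by (simp add: bij_betw_same_card)
  qed
  have "card H = (\<Sum>x\<in>H. 1)" by simp
  also have "\<dots> = (\<Sum>y\<in>zmul m ` H. \<Sum>x\<in>{x\<in>H. zmul m x = y}. 1)" by (rule sum.image_gen) simp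
  also have "\<dots> = (\<Sum>y\<in>zmul m ` H. card {x\<in>H. zmul m x = 0})" by (rule sum.cong[OF refl]) (simp add: fib)
  finally show ?thesis by simp
qed

text \<open>Among the subgroups of H of 2-power order a largest one is H itself, because adjoining
  an element outside it doubles its order.\<close>

lemma card_elementary_2_group:
  fixes H :: "'a::{ab_group_add,finite} set"
  assumes H: "subgrp H" and two: "\<And>x. x \<in> H \<Longrightarrow> x + x = 0"
  shows "\<exists>k. card H = 2 ^ k"
proof -
  define P where "P K \<longleftrightarrow> subgrp K \<and> K \<subseteq> H \<and> (\<exists>k. card K = 2 ^ k)" for K
  have "P {0}" using H by (auto simp: P_def subgrp_def intro: exI[of _ 0])
  then obtain K where K: "P K" "\<And>K'. P K' \<Longrightarrow> card K' \<le> card K"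
    using ex_has_greatest_nat[of P "{0}" card "CARD('a) + 1"] by (metis card_mono finite_UNIV less_Suc_eq_le Suc_eq_plus1 le_imp_less_Suc subset_UNIV finite)
  obtain k where k: "card K = 2 ^ k" using K by (auto simp: P_def)
  have sK: "subgrp K" "K \<subseteq> H" using K by (auto simp: P_def)
  have "K = H"
  proof (rule ccontr)
    assume "K \<noteq> H"
    then obtain h where h: "h \<in> H" "h \<notin> K" using sK by blast
    have neg: "- x = x" if "x \<in> H" for x using two[OF that] by (simp add: add_eq_0_iff)
    let ?L = "K \<union> (\<lambda>x. x + h) ` K"
    have disj: "K \<inter> (\<lambda>x. x + h) ` K = {}"
    proof (rule ccontr)
      assume "\<not> ?thesis"
      then obtain x where x: "x \<in> K" "x + h \<in> K" by blast
      then have "(x + h) - x \<in> K" using subgrp_diff[OF sK(1)] by blast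
      then show False using h by simp
    qed
    have "card ?L = 2 ^ Suc k"
      using disj k by (subst card_Un_disjoint) (auto simp: card_image inj_on_def)
    moreover have "?L \<subseteq> H" using sK h H by (auto simp: subgrp_def)
    moreover have "subgrp ?L"
    proof -
      have "x + y \<in> ?L" if x: "x \<in> ?L" and y: "y \<in> ?L" for x y
      proof -
        obtain x' where x': "x' \<in> K" "x = x' \<or> x = x' + h" using x by blast
        obtain y' where y': "y' \<in> K" "y = y' \<or> y = y' + h" using y by blast
        have s: "x' + y' \<in> K" using sK x' y' by (simp add: subgrp_def)
        have "x + y = x' + y' \<or> x + y = x' + y' + h"
          using x'(2) y'(2) two[OF h(1)] by (auto simp: algebra_simps)
        then show ?thesis using s by auto
      qed
      moreover have "- x \<in> ?L" if "x \<in> ?L" for x using neg[of x] that \<open>?L \<subseteq> H\<close> by auto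
      ultimately show ?thesis using sK by (auto simp: subgrp_def)
    qed
    ultimately have "P ?L" unfolding P_def by blast
    then have "card ?L \<le> card K" by (rule K)
    then show False using \<open>card ?L = 2 ^ Suc k\<close> k by simp
  qed
  then show ?thesis using k by blast
qed

context disc_form
begin

lemma sum_character:
  assumes H: "subgrp H"
  shows "(\<Sum>h\<in>H. er (of_int m * bl x h)) = (if \<forall>h\<in>H. of_int m * bl x h \<in> \<int> then of_nat (card H) else 0)"
proof (cases "\<forall>h\<in>H. of_int m * bl x h \<in> \<int>")
  case True
  then have "er (of_int m * bl x h) = 1" if "h \<in> H" for h using that er_eq_1_iff by blast
  then show ?thesis using True by simp
next
  case False
  then obtain h0 where h0: "h0 \<in> H" "of_int m * bl x h0 \<notin> \<int>" by blast
  have "(\<Sum>h\<in>H. er (of_int m * bl x h)) = 0"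
  proof (rule sum_eq_0_shift[OF subgrp_shift[OF H h0(1)], where c = "er (of_int m * bl x h0)"])
    show "er (of_int m * bl x (y + h0)) = er (of_int m * bl x h0) * er (of_int m * bl x y)" for y
      using er_cong[OF eq_mod1_mult_int[OF bl_add_right]] by (simp add: er_add distrib_left mult.commute)
    show "er (of_int m * bl x h0) \<noteq> 1" using h0 er_eq_1_iff by blast
  qed
  then show ?thesis using False by (simp only: if_False)
qed

text \<open>The substitution h = x + h' in the double sum separates e(m q(x)) from a character in
  h', whose sum vanishes unless x lies in the radical R.\<close>

lemma gauss_sum_norm:
  assumes H: "subgrp H" and R_def: "R = {h\<in>H. \<forall>h'\<in>H. of_int m * bl h h' \<in> \<int>}"
  shows "(\<Sum>h\<in>H. er (of_int m * q h)) * cnj (\<Sum>h\<in>H. er (of_int m * q h)) =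
    of_nat (card H) * (\<Sum>h\<in>R. er (of_int m * q h))"
proof -
  let ?e = "\<lambda>x. er (of_int m * q x)"
  have "(\<Sum>h\<in>H. ?e h) * cnj (\<Sum>h\<in>H. ?e h) = (\<Sum>h'\<in>H. \<Sum>h\<in>H. ?e h * cnj (?e h'))"
    by (simp add: sum_product) (rule sum.swap)
  also have "\<dots> = (\<Sum>h'\<in>H. \<Sum>x\<in>H. ?e (x + h') * cnj (?e h'))"
    by (intro sum.cong refl sum.reindex_bij_betw[OF subgrp_shift[OF H], symmetric]) auto
  also have "\<dots> = (\<Sum>h'\<in>H. \<Sum>x\<in>H. ?e x * er (of_int m * bl x h'))"
  proof (intro sum.cong refl)
    fix h' x
    have "?e h' * cnj (?e h') = 1" using complex_norm_square[of "?e h'"] by simp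
    then show "?e (x + h') * cnj (?e h') = ?e x * er (of_int m * bl x h')"
      by (simp add: q_add distrib_left er_add mult_ac)
  qed
  also have "\<dots> = (\<Sum>x\<in>H. ?e x * (\<Sum>h'\<in>H. er (of_int m * bl x h')))"
    by (subst sum.swap) (simp add: sum_distrib_left)
  also have "\<dots> = (\<Sum>x\<in>H. if x \<in> R then of_nat (card H) * ?e x else 0)"
    unfolding sum_character[OF H] by (rule sum.cong) (auto simp: R_def)
  also have "\<dots> = (\<Sum>x\<in>R. of_nat (card H) * ?e x)"
    by (rule sum.mono_neutral_cong_right) (auto simp: R_def)
  finally show ?thesis by (simp add: sum_distrib_left)
qed

end

lemma int_eq_of_complex: "of_nat m = (of_int k :: complex) \<Longrightarrow> int m = k"
  by (metis of_int_eq_iff of_int_of_nat_eq)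

lemma er_power4: "4 * x \<in> \<int> \<Longrightarrow> er x ^ 4 = 1"
  using er_of_int_mult[of 4 x] er_eq_1_iff[of "4 * x"] by simp

lemma er_power2: "er x ^ 2 = er (2 * x)"
  using er_of_int_mult[of 2 x] by simp

section \<open>The Gauss sum of the odd part\<close>

context disc_form
begin

abbreviation ker :: "int \<Rightarrow> 'a set" where "ker m \<equiv> {x. zmul m x = 0}"

lemma card_ker: "card (ker m) \<noteq> 0"
proof -
  have "0 \<in> ker m" by simp
  then show ?thesis unfolding card_eq_0_iff using finite[of "ker m"] by blast
qed

lemma er_q_add_ortho: "bl x y \<in> \<int> \<Longrightarrow> er (q (x + y)) = er (q x) * er (q y)"
  using er_eq_1_iff by (simp add: q_add er_add)

text \<open>Let A be the matrix of e((i, j)) on Q = D_n. The relation A e(-q) A = G e(q) A e(q),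
  with e(q) diagonal, becomes det A = G^|Q| on taking determinants, while A^4 is the scalar |Q|^2.
  So G^(4|Q|) = |Q|^(2|Q|), and as |Q| is odd, G^4 cannot be -|Q|^2.\<close>

lemma gauss_sum_odd_part:
  assumes n: "odd n" "n > 0"
    and nd: "\<And>x. x \<in> ker (int n) \<Longrightarrow> (\<And>y. y \<in> ker (int n) \<Longrightarrow> bl x y \<in> \<int>) \<Longrightarrow> x = 0"
  shows "(\<Sum>x\<in>ker (int n). er (q x)) ^ 4 \<noteq> - (of_nat (card (ker (int n))) ^ 2)"
proof
  define Q where "Q = ker (int n)"
  define G where "G = (\<Sum>x\<in>Q. er (- q x))"
  assume "(\<Sum>x\<in>ker (int n). er (q x)) ^ 4 = - (of_nat (card (ker (int n))) ^ 2)"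
  then have "cnj ((\<Sum>x\<in>Q. er (q x)) ^ 4) = - (of_nat (card Q) ^ 2)" by (simp add: Q_def)
  then have G4: "G ^ 4 = - (of_nat (card Q) ^ 2)" by (simp add: G_def cnj_er)
  have sQ: "subgrp Q" unfolding Q_def by (rule subgrp_kernel)
  then have Q0: "0 \<in> Q" and Qadd: "\<And>x y. x \<in> Q \<Longrightarrow> y \<in> Q \<Longrightarrow> x + y \<in> Q" and Qneg: "\<And>x. x \<in> Q \<Longrightarrow> - x \<in> Q"
    by (auto simp: subgrp_def)
  have two_inj: "x = 0" if "x \<in> Q" "zmul 2 x = 0" for x
  proof -
    have "coprime (int n) 2" using n by simp
    then have "zmul (gcd (int n) 2) x = 0" using that by (intro zmul_gcd_eq_0) (auto simp: Q_def)
    then show ?thesis using \<open>coprime (int n) 2\<close> by (simp add: coprime_iff_gcd_eq_1)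
  qed
  have oddQ: "odd (card Q)"
  proof -
    have "even (card (Q - {0}))"
    proof (rule even_card_involution[where f = uminus])
      show "- x \<in> Q - {0} \<and> - (- x) = x \<and> - x \<noteq> x" if "x \<in> Q - {0}" for x
      proof -
        have "- x \<noteq> x"
        proof
          assume "- x = x"
          then have "x + x = 0" by (metis add.right_inverse)
          then have "zmul 2 x = 0" using zmul_Suc_right[of 1 x] by simp
          then show False using two_inj that by blast
        qed
        then show ?thesis using that Qneg by auto
      qed
    qed simp
    then show ?thesis using Q0 by (metis card_Suc_Diff1 even_Suc finite)
  qed
  \<comment> \<open>Determinants are taken over the whole type, so A is continued by the identity
    outside Q; the diagonal matrices \<open>dg (on f)\<close> are continued in the same way.\<close>
  define A :: "complex^('a::{ab_group_add,finite})^('a::{ab_group_add,finite})"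
    where "A = (\<chi> i j. if i \<in> Q \<and> j \<in> Q then er (bl i j) else if i = j then 1 else 0)"
  have A_nth: "A $ i $ j = (if i \<in> Q \<and> j \<in> Q then er (bl i j) else if i = j then 1 else 0)" for i j
    by (simp add: A_def)
  define dg :: "('a \<Rightarrow> complex) \<Rightarrow> complex^('a::{ab_group_add,finite})^('a::{ab_group_add,finite})"
    where "dg f = (\<chi> i j. if i = j then f i else 0)" for f
  define on :: "('a \<Rightarrow> complex) \<Rightarrow> 'a \<Rightarrow> complex" where "on f i = (if i \<in> Q then f i else 1)" for f i
  have det_dg: "det (dg (on f)) = (\<Prod>i\<in>Q. f i)" for f
  proof -
    have "det (dg (on f)) = (\<Prod>i\<in>UNIV. dg (on f) $ i $ i)" by (rule det_diagonal) (simp add: dg_def)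
    also have "\<dots> = (\<Prod>i\<in>UNIV. if i \<in> Q then f i else 1)" by (simp add: dg_def on_def)
    also have "\<dots> = (\<Prod>i\<in>Q. f i)" by (simp add: prod.If_cases)
    finally show ?thesis .
  qed
  have dg_left: "(dg f ** B) $ i $ j = f i * B $ i $ j" for f B i j
    by (simp add: matrix_matrix_mult_def dg_def if_distrib[of "\<lambda>x. x * _"] cong: if_cong)
  have dg_right: "(B ** dg f) $ i $ j = B $ i $ j * f j" for f B i j
    by (simp add: matrix_matrix_mult_def dg_def if_distrib[of "\<lambda>x. _ * x"] cong: if_cong)
  have split: "(B ** A) $ i $ j = (if j \<in> Q then (\<Sum>b\<in>Q. B $ i $ b * er (bl b j)) else B $ i $ j)" for B i j
  proof (cases "j \<in> Q")
    case True
    have "(B ** A) $ i $ j = (\<Sum>b\<in>UNIV. if b \<in> Q then B $ i $ b * er (bl b j) else 0)"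
      unfolding matrix_matrix_mult_def vec_lambda_beta using True by (intro sum.cong refl) (auto simp: A_nth)
    then show ?thesis using True by (simp add: sum.If_cases)
  next
    case False
    have "(B ** A) $ i $ j = (\<Sum>b\<in>UNIV. if b = j then B $ i $ b else 0)"
      unfolding matrix_matrix_mult_def vec_lambda_beta using False by (intro sum.cong refl) (auto simp: A_nth)
    then show ?thesis using False by simp
  qed
  have char_sum: "(\<Sum>b\<in>Q. er (bl x b)) = (if x = 0 then of_nat (card Q) else 0)" if "x \<in> Q" for x
  proof -
    have "(\<forall>h\<in>Q. of_int 1 * bl x h \<in> \<int>) \<longleftrightarrow> x = 0" using nd[of x] that bl_0_left by (auto simp: Q_def)
    then show ?thesis using sum_character[OF sQ, of 1 x] by simp
  qed
  have er_add2: "er (bl i b) * er (bl b j) = er (bl (i + j) b)" for i j b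
    using er_cong[OF bl_add_left[of i j b]] by (simp add: er_add bl_commute)
  define B where "B = A ** A"
  have B: "B $ i $ j = (if i \<in> Q \<and> j \<in> Q then (if i = - j then of_nat (card Q) else 0) else if i = j then 1 else 0)" for i j
  proof (cases "i \<in> Q \<and> j \<in> Q")
    case True
    then have "B $ i $ j = (\<Sum>b\<in>Q. er (bl (i + j) b))"
      unfolding B_def split by (simp add: A_nth er_add2)
    also have "\<dots> = (if i + j = 0 then of_nat (card Q) else 0)" using True Qadd by (intro char_sum) auto
    finally show ?thesis using True by (simp add: eq_neg_iff_add_eq_0)
  next
    case False
    show ?thesis
    proof (cases "j \<in> Q")
      case True
      then have "(\<Sum>b\<in>Q. A $ i $ b * er (bl b j)) = 0" using False by (intro sum.neutral) (auto simp: A_nth)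
      then show ?thesis using True False by (auto simp: B_def split)
    next
      case False
      then show ?thesis by (simp add: B_def split A_nth)
    qed
  qed
  have BB: "B ** B = dg (on (\<lambda>_. of_nat (card Q) ^ 2))"
  proof -
    have "(B ** B) $ i $ j = dg (on (\<lambda>_. of_nat (card Q) ^ 2)) $ i $ j" for i j
    proof (cases "i \<in> Q")
      case True
      have "(B ** B) $ i $ j = (\<Sum>b\<in>UNIV. if b = - i then of_nat (card Q) * B $ b $ j else 0)"
        unfolding matrix_matrix_mult_def vec_lambda_beta
        using True Qneg by (intro sum.cong refl) (auto simp: B[of i] minus_equation_iff)
      also have "\<dots> = of_nat (card Q) * B $ (- i) $ j" by simp
      finally show ?thesis using True Qneg[OF True] by (auto simp: B dg_def on_def power2_eq_square)
    next
      case False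
      have "(B ** B) $ i $ j = (\<Sum>b\<in>UNIV. if b = i then B $ b $ j else 0)"
        unfolding matrix_matrix_mult_def vec_lambda_beta
        using False by (intro sum.cong refl) (auto simp: B[of i])
      then show ?thesis using False by (auto simp: B dg_def on_def)
    qed
    then show ?thesis by (simp add: vec_eq_iff)
  qed
  have "det (B ** B) = (\<Prod>i\<in>Q. of_nat (card Q) ^ 2)" unfolding BB det_dg ..
  then have detA4: "det A ^ 4 = (of_nat (card Q) ^ 2) ^ card Q"
    by (simp add: B_def det_mul power4_eq_xxxx mult.assoc)
  have cQ: "card Q > 0" using Q0 by (simp add: card_gt_0_iff) blast
  then have detA0: "det A \<noteq> 0" using detA4 by auto
  have rel: "A ** dg (on (\<lambda>x. er (- q x))) ** A =
      dg (on (\<lambda>_. G)) ** dg (on (\<lambda>x. er (q x))) ** A ** dg (on (\<lambda>x. er (q x)))"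
  proof -
    have "(A ** dg (on (\<lambda>x. er (- q x))) ** A) $ i $ j =
      (dg (on (\<lambda>_. G)) ** dg (on (\<lambda>x. er (q x))) ** A ** dg (on (\<lambda>x. er (q x)))) $ i $ j" for i j
    proof -
      have R: "(dg (on (\<lambda>_. G)) ** dg (on (\<lambda>x. er (q x))) ** A ** dg (on (\<lambda>x. er (q x)))) $ i $ j
         = on (\<lambda>_. G) i * on (\<lambda>x. er (q x)) i * A $ i $ j * on (\<lambda>x. er (q x)) j"
        by (simp add: dg_right matrix_mul_assoc[symmetric] dg_left)
      have L: "(A ** dg (on (\<lambda>x. er (- q x))) ** A) $ i $ j =
         (if j \<in> Q then (\<Sum>b\<in>Q. A $ i $ b * er (- q b) * er (bl b j)) else A $ i $ j * on (\<lambda>x. er (- q x)) j)"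
        unfolding split dg_right by (auto simp: on_def)
      show ?thesis
      proof (cases "i \<in> Q \<and> j \<in> Q")
        case True
        then have ij: "i + j \<in> Q" using Qadd by blast
        have "(\<Sum>b\<in>Q. A $ i $ b * er (- q b) * er (bl b j)) = (\<Sum>b\<in>Q. er (bl (i + j) b) * er (- q b))"
          using True by (intro sum.cong refl) (simp add: A_nth mult_ac flip: er_add2)
        \<comment> \<open>Completing the square: shifting b by x = i + j turns (x, b) - q(b) into
          q(x) - q(b).\<close>
        also have "\<dots> = (\<Sum>b\<in>Q. er (bl (i + j) (b + (i + j))) * er (- q (b + (i + j))))"
          using sum.reindex_bij_betw[OF subgrp_shift[OF sQ ij], of "\<lambda>b. er (bl (i + j) b) * er (- q b)"] by simp
        also have "\<dots> = (\<Sum>b\<in>Q. er (q (i + j)) * er (- q b))"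
        proof (intro sum.cong refl)
          fix b
          have "eq_mod1 (bl (i + j) (b + (i + j))) (bl (i + j) b + bl (i + j) (i + j))" by (rule bl_add_right)
          also have "eq_mod1 \<dots> (bl (i + j) b + 2 * q (i + j))" by (intro eq_mod1_add eq_mod1_refl bl_self)
          finally have "eq_mod1 (bl (i + j) (b + (i + j)) + - q (b + (i + j))) (q (i + j) + - q b)"
            by (rule eq_mod1_diff_eq) (simp add: q_add[of b] bl_commute[of b])
          then show "er (bl (i + j) (b + (i + j))) * er (- q (b + (i + j))) = er (q (i + j)) * er (- q b)"
            by (simp only: er_add[symmetric] er_cong)
        qed
        also have "\<dots> = er (q (i + j)) * G" by (simp add: G_def sum_distrib_left)
        also have "er (q (i + j)) = er (q i) * er (bl i j) * er (q j)" by (simp add: q_add er_add mult_ac)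
        finally show ?thesis unfolding L R using True by (simp add: on_def A_nth mult_ac)
      next
        case False
        have "(\<Sum>b\<in>Q. A $ i $ b * er (- q b) * er (bl b j)) = 0" if "j \<in> Q"
          using False that by (intro sum.neutral) (auto simp: A_nth)
        then show ?thesis unfolding L R using False by (auto simp: on_def A_nth)
      qed
    qed
    then show ?thesis by (simp add: vec_eq_iff)
  qed
  define t where "t = (\<Prod>x\<in>Q. er (- q x))"
  have t0: "t \<noteq> 0" by (simp add: t_def)
  have tinv: "(\<Prod>x\<in>Q. er (q x)) = inverse t"
  proof -
    have "(\<Prod>x\<in>Q. er (q x)) * t = (\<Prod>x\<in>Q. er (q x) * er (- q x))" by (simp add: t_def prod.distrib)
    also have "\<dots> = 1" by (simp flip: er_add)
    finally show ?thesis using t0 by (simp add: field_simps)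
  qed
  \<comment> \<open>Doubling permutes Q and multiplies q by 4, so t = t^4.\<close>
  have t3: "t ^ 3 = 1"
  proof -
    have "inj_on (zmul 2) Q"
    proof (rule inj_onI)
      fix x y assume "x \<in> Q" "y \<in> Q" "zmul 2 x = zmul 2 y"
      then have "zmul 2 (x - y) = 0" "x - y \<in> Q" using subgrp_diff[OF sQ] by (auto simp: zmul_diff_right)
      then show "x = y" using two_inj by force
    qed
    moreover have "zmul 2 ` Q \<subseteq> Q" by (auto simp: Q_def) (metis mult.commute zmul_mult zmul_zero_right)
    ultimately have bij: "bij_betw (zmul 2) Q Q" by (simp add: bij_betw_def endo_inj_surj)
    have "t = (\<Prod>x\<in>Q. er (- q (zmul 2 x)))" unfolding t_def using prod.reindex_bij_betw[OF bij, of "\<lambda>x. er (- q x)"] by simp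
    also have "\<dots> = (\<Prod>x\<in>Q. er (- q x) ^ 4)"
    proof (intro prod.cong refl)
      fix x
      have "eq_mod1 (- q (zmul 2 x)) (- (4 * q x))" using eq_mod1_minus[OF q_zmul[of 2 x]] by simp
      then have "er (- q (zmul 2 x)) = er (of_int 4 * (- q x))" by (simp add: er_cong)
      then show "er (- q (zmul 2 x)) = er (- q x) ^ 4" unfolding er_of_int_mult by simp
    qed
    also have "\<dots> = t ^ 4" by (simp add: t_def prod_power_distrib)
    finally have "t * t ^ 3 = t * 1" by (simp add: power_numeral_reduce)
    then show ?thesis using t0 by simp
  qed
  have "det A * t * det A = G ^ card Q * inverse t * det A * inverse t"
    using arg_cong[OF rel, of det] by (simp add: det_mul det_dg t_def[symmetric] tinv)
  then have "det A * t ^ 3 = G ^ card Q" using detA0 t0 by (simp add: field_simps power3_eq_cube)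
  then have "det A = G ^ card Q" using t3 by simp
  then have "(G ^ 4) ^ card Q = (of_nat (card Q) ^ 2) ^ card Q" using detA4 by (simp flip: power_mult add: mult.commute)
  then have "- ((of_nat (card Q) ^ 2) ^ card Q) = ((of_nat (card Q) ^ 2) ^ card Q :: complex)"
    unfolding G4 using oddQ by simp
  then show False using cQ by simp
qed

lemma subgrp_image: "subgrp H \<Longrightarrow> subgrp (zmul m ` H)"
  unfolding subgrp_def by (auto simp flip: zmul_add_right zmul_minus_right) (metis image_eqI zmul_zero_right)

lemma even_exponent:
  fixes m g :: int
  assumes "2 ^ n * m\<^sup>2 = g\<^sup>2" "m \<noteq> 0"
  shows "even n"
proof -
  have "g \<noteq> 0" using assms by auto
  have "multiplicity 2 (2 ^ n * m\<^sup>2) = n + 2 * multiplicity 2 m"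
    using assms(2) by (subst prime_elem_multiplicity_mult_distrib) (auto simp: prime_elem_multiplicity_power_distrib)
  moreover have "multiplicity 2 (g\<^sup>2) = 2 * multiplicity 2 g"
    using \<open>g \<noteq> 0\<close> by (simp add: prime_elem_multiplicity_power_distrib)
  ultimately have "n + 2 * multiplicity 2 m = 2 * multiplicity 2 g" using assms(1) by simp
  then show ?thesis by presburger
qed

text \<open>x = n\<eta> by \<open>annihilator_kernel\<close>, and nx = 0 shows that n^2 kills
  \<eta>; N kills \<eta> as well, so n does, by the first hypothesis. For a Hall divisor n of N that
  hypothesis is Bezout's identity for n and N/n, multiplied by n; it makes the form non-degenerate
  on D_n.\<close>

lemma perp_kernel:
  assumes "n\<^sup>2 * u + int N * w = n"
    and "zmul n x = 0" "\<And>h. zmul n h = 0 \<Longrightarrow> bl x h \<in> \<int>"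
  shows "x = 0"
proof -
  obtain \<eta> where \<eta>: "x = zmul n \<eta>" using annihilator_kernel[of n x] assms(3) by blast
  then have "zmul (n\<^sup>2) \<eta> = 0" using assms(2) by (simp add: power2_eq_square zmul_mult)
  then have "zmul (n\<^sup>2 * u + int N * w) \<eta> = 0"
    using level_zmul[of \<eta>] by (metis add.right_neutral mult.commute zmul_add_left zmul_mult zmul_zero_right)
  then show ?thesis using \<eta> assms(1) by simp
qed

end

section \<open>Milgram's formula against the two torsion conditions\<close>

context weil_rep
begin

text \<open>For even signature e(sign/8) is a fourth root of unity, so it drops out of the fourth
  power of Milgram's formula.\<close>

lemma gauss_sum_even_signature:
  assumes "even (disc_sign q)"
  shows "(\<Sum>g\<in>UNIV. er (q g)) ^ 4 = of_nat CARD('a) ^ 2"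
proof -
  obtain t where t: "disc_sign q = 2 * t" using assms by blast
  have "ee (of_int (disc_sign q) / 8) ^ 4 = exp (of_int t * (2 * of_real pi * \<i>))"
    unfolding ee_def t exp_of_nat_mult[symmetric] by (simp add: algebra_simps)
  also have "\<dots> = 1" unfolding exp_eq_1 by auto
  finally have "weil_const ^ 4 = 1 / of_nat CARD('a) ^ 2"
  proof -
    assume e: "ee (of_int (disc_sign q) / 8) ^ 4 = 1"
    have "sqrt (real CARD('a)) ^ 4 = (real CARD('a))\<^sup>2"
      using power_mult[of "sqrt (real CARD('a))" 2 2] by simp
    then have "complex_of_real (sqrt (real CARD('a))) ^ 4 = of_nat CARD('a) ^ 2"
      by (metis of_real_of_nat_eq of_real_power)
    then show ?thesis unfolding weil_const_def power_divide e by simp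
  qed
  moreover have "weil_const ^ 4 * (\<Sum>g\<in>UNIV. er (- q g)) ^ 4 = 1"
    using gauss_sum_weil_const by (metis power_mult_distrib power_one)
  ultimately have "1 / of_nat CARD('a) ^ 2 * (\<Sum>g\<in>UNIV. er (- q g)) ^ 4 = 1" by (simp only:)
  then have "(\<Sum>g\<in>UNIV. er (- q g)) ^ 4 = of_nat CARD('a) ^ 2" by (simp add: field_simps)
  then have "cnj ((\<Sum>g\<in>UNIV. er (- q g)) ^ 4) = of_nat CARD('a) ^ 2" by simp
  then show ?thesis by (simp add: cnj_er)
qed

text \<open>The Gauss sum \<open>\<Gamma>\<close> of \<open>D\<^sub>4\<close> is a Gaussian integer, and the two conditions make \<open>|\<Gamma>|\<^sup>2\<close> an odd power of
  \<open>2\<close>; hence \<open>\<Gamma>\<^sup>2\<close> is \<open>\<plusminus>\<i>\<close> times a power of \<open>2\<close>. For even signature this is incompatible with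
  Milgram's formula, as the Gauss sum of the odd part is \<open>1\<close> plus twice an algebraic integer.\<close>

lemma odd_even_torsion_contradiction:
  assumes sign: "even (disc_sign q)" and N8: "8 dvd N" "\<not> 16 dvd N"
    and odd2: odd_two_torsion and even4: even_four_torsion
  shows False
proof -
  obtain N' where N': "N = 8 * N'" using N8 by blast
  have oddN': "odd N'" using N8 by (auto simp: N')
  have N'0: "N' > 0" using level_pos N' by auto
  have cop: "coprime (8::int) (int N')"
  proof -
    have "coprime ((2::int) ^ 3) (int N')" using oddN' by (simp only: coprime_power_left_iff) simp
    then show ?thesis by simp
  qed
  then obtain u w where uw: "u * 8 + w * int N' = 1" using bezout_int[of 8 "int N'"] by (auto simp: coprime_iff_gcd_eq_1)
  have bez8: "8\<^sup>2 * u + int N * w = 8" using uw by (simp add: N' algebra_simps)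
  have bezN': "(int N')\<^sup>2 * w + int N * u = int N'"
  proof -
    have "(int N')\<^sup>2 * w + int N * u = int N' * (u * 8 + w * int N')" by (simp add: N' algebra_simps power2_eq_square)
    then show ?thesis using uw by simp
  qed
  have q8: "8 * q h \<in> \<int>" if "zmul 8 h = 0" for h
  proof -
    have "64 * q h \<in> \<int>" using eq_mod1_Ints_iff[OF q_zmul[of 8 h]] that q_0 by simp
    moreover have "8 * q h = of_int u * (64 * q h) + of_int w * (of_nat N * q h)"
    proof -
      have "of_int (8\<^sup>2 * u + int N * w) * q h = (of_int 8 :: rat) * q h" unfolding bez8 ..
      then show ?thesis by (simp add: algebra_simps)
    qed
    ultimately show ?thesis using level_q[of h] by (metis Ints_add int_mult_Ints)
  qed
  have k8: "subgrp (ker 8)" and k4: "subgrp (ker 4)" and k2: "subgrp (ker 2)" by (rule subgrp_kernel)+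
  have z48: "zmul 8 x = 0" if "zmul 4 x = 0" for x :: 'a using zmul_dvd_eq_0[OF that] by simp
  have z24: "zmul 4 x = 0" if "zmul 2 x = 0" for x :: 'a using zmul_dvd_eq_0[OF that] by simp
  have R4: "{h\<in>ker 8. \<forall>h'\<in>ker 8. of_int 4 * bl h h' \<in> \<int>} = ker 4"
  proof (intro equalityI subsetI)
    fix h assume h: "h \<in> {h\<in>ker 8. \<forall>h'\<in>ker 8. of_int 4 * bl h h' \<in> \<int>}"
    have "zmul 4 h = 0"
    proof (rule perp_kernel[OF bez8])
      have "zmul 8 (zmul 4 h) = zmul 4 (zmul 8 h)" by (simp flip: zmul_mult)
      then show "zmul 8 (zmul 4 h) = 0" using h by simp
      show "bl (zmul 4 h) h' \<in> \<int>" if "zmul 8 h' = 0" for h'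
        using h that eq_mod1_Ints_iff[OF bl_zmul_left[of 4 h h']] by simp
    qed
    then show "h \<in> ker 4" by simp
  next
    fix h assume "h \<in> ker 4"
    then show "h \<in> {h\<in>ker 8. \<forall>h'\<in>ker 8. of_int 4 * bl h h' \<in> \<int>}"
      using bl_zmul_Ints[of 4 h] z48 by auto
  qed
  have e4: "4 * q h \<in> \<int>" if "zmul 4 h = 0" for h using even4 that by (simp add: even_four_torsion_def)

  define G where "G = (\<Sum>h\<in>ker 8. er (q h))"
  have Gnorm: "G * cnj G = of_nat (card (ker 8))"
  proof -
    have "{h\<in>ker 8. \<forall>h'\<in>ker 8. of_int 1 * bl h h' \<in> \<int>} = {0}"
      using perp_kernel[OF bez8] bl_0_left by auto
    then have "(\<Sum>h\<in>ker 8. er (of_int 1 * q h)) * cnj (\<Sum>h\<in>ker 8. er (of_int 1 * q h))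
       = of_nat (card (ker 8)) * (\<Sum>h\<in>{0}. er (of_int 1 * q h))"
      using gauss_sum_norm[OF k8, of "{0}" 1] by simp
    then show ?thesis using q_0 er_eq_1_iff by (simp add: G_def)
  qed
  \<comment> \<open>For x in D_8, q(4x) is integral, so translation by 4x multiplies the summand at
    h by e(4 (h, x)). Averaging over x leaves only the h in D_4, where q takes values in (1/4)\<int>
    and the sum becomes a Gaussian integer.\<close>
  have G4: "G = (\<Sum>h\<in>ker 4. er (q h))"
  proof -
    have sh: "G = (\<Sum>h\<in>ker 8. er (q h) * er (of_int 4 * bl h x))" if x: "x \<in> ker 8" for x
    proof -
      have x4: "zmul 4 x \<in> ker 8" using x zmul_mult[of 8 4 x] zmul_mult[of 4 8 x] by simp
      have "G = (\<Sum>h\<in>ker 8. er (q (h + zmul 4 x)))"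
        unfolding G_def using sum.reindex_bij_betw[OF subgrp_shift[OF k8 x4], of "\<lambda>h. er (q h)"] by simp
      also have "\<dots> = (\<Sum>h\<in>ker 8. er (q h) * er (of_int 4 * bl h x))"
      proof (intro sum.cong refl)
        fix h
        have "of_int (4 ^ 2) * q x \<in> \<int>" using int_mult_Ints[OF q8, of x 2] x by simp
        then have "er (of_int (4 ^ 2) * q x) = 1" using er_eq_1_iff by blast
        then show "er (q (h + zmul 4 x)) = er (q h) * er (of_int 4 * bl h x)"
          using er_cong[OF q_add_zmul[of h 4 x]] by (simp only: er_add) simp
      qed
      finally show ?thesis .
    qed
    have "of_nat (card (ker 8)) * G = (\<Sum>x\<in>ker 8. G)" by simp
    also have "\<dots> = (\<Sum>x\<in>ker 8. \<Sum>h\<in>ker 8. er (q h) * er (of_int 4 * bl h x))"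
      by (intro sum.cong refl sh)
    also have "\<dots> = (\<Sum>h\<in>ker 8. er (q h) * (\<Sum>x\<in>ker 8. er (of_int 4 * bl h x)))"
      by (subst sum.swap) (simp only: sum_distrib_left)
    also have "\<dots> = (\<Sum>h\<in>ker 8. if h \<in> ker 4 then of_nat (card (ker 8)) * er (q h) else 0)"
      unfolding sum_character[OF k8] R4[symmetric] by (intro sum.cong refl) auto
    also have "\<dots> = (\<Sum>h\<in>ker 4. of_nat (card (ker 8)) * er (q h))"
      using z48 by (intro sum.mono_neutral_cong_right) auto
    also have "\<dots> = of_nat (card (ker 8)) * (\<Sum>h\<in>ker 4. er (q h))" by (simp only: sum_distrib_left)
    finally have "of_nat (card (ker 8)) * G = of_nat (card (ker 8)) * (\<Sum>h\<in>ker 4. er (q h))" .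
    moreover have "card (ker 8) \<noteq> 0" using card_ker[of 8] by simp
    ultimately show ?thesis by (metis mult_cancel_left of_nat_eq_0_iff)
  qed
  obtain X Y :: int where XY: "G = Complex (of_int X) (of_int Y)"
  proof -
    have "er (q h) ^ 4 = 1" if "h \<in> ker 4" for h
      using e4[of h] that er_power4 by simp
    then show ?thesis using sum_gaussian_integer[of "ker 4" "\<lambda>h. er (q h)"] that unfolding G4 by blast
  qed
  have cXY: "int (card (ker 8)) = X\<^sup>2 + Y\<^sup>2"
  proof (rule int_eq_of_complex)
    show "of_nat (card (ker 8)) = (of_int (X\<^sup>2 + Y\<^sup>2) :: complex)"
      unfolding Gnorm[symmetric] XY by (simp add: complex_eq_iff power2_eq_square)
  qed

  \<comment> \<open>The Gauss sum of 4q over D_8 is a rational integer. Its square is |D_8| |D_4|,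
    because 4q is trivial on D_4; with |D_8| = 2^e |D_4| this makes e even.\<close>
  define g where "g = (\<Sum>h\<in>ker 8. er (of_int 4 * q h))"
  have ermin: "er (- (of_int 4 * q h)) = er (of_int 4 * q h)" "er (of_int 4 * q h) ^ 4 = 1" if "h \<in> ker 8" for h
  proof -
    have "of_int 4 * q h - - (of_int 4 * q h) \<in> \<int>" using q8[of h] that by simp
    then show "er (- (of_int 4 * q h)) = er (of_int 4 * q h)" using er_cong eq_mod1_sym unfolding eq_mod1_def[symmetric] by blast
    have "4 * (of_int 4 * q h) \<in> \<int>" using int_mult_Ints[OF q8[of h], of 2] that by simp
    then show "er (of_int 4 * q h) ^ 4 = 1" by (rule er_power4)
  qed
  have gcnj: "cnj g = g" unfolding g_def cnj_sum cnj_er by (intro sum.cong refl ermin(1))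
  obtain ga gb :: int where gab: "g = Complex (of_int ga) (of_int gb)"
    using sum_gaussian_integer[of "ker 8" "\<lambda>h. er (of_int 4 * q h)"] ermin(2) unfolding g_def by blast
  have g2: "int (card (ker 8) * card (ker 4)) = ga\<^sup>2"
  proof (rule int_eq_of_complex)
    have "er (of_int 4 * q h) = 1" if "h \<in> ker 4" for h using e4[of h] that er_eq_1_iff by simp
    then have "(\<Sum>h\<in>ker 4. er (of_int 4 * q h)) = of_nat (card (ker 4))" by simp
    then have "g * cnj g = of_nat (card (ker 8)) * of_nat (card (ker 4))"
      using gauss_sum_norm[OF k8 R4[symmetric]] unfolding g_def by simp
    then have "g * g = of_nat (card (ker 8)) * of_nat (card (ker 4))" using gcnj by simp
    moreover have "gb = 0" using gcnj unfolding gab by (simp add: complex_eq_iff)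
    ultimately show "of_nat (card (ker 8) * card (ker 4)) = (of_int (ga\<^sup>2) :: complex)"
      unfolding gab by (simp add: complex_eq_iff power2_eq_square)
  qed

  have c8: "card (ker 8) = card (ker 4) * card (zmul 4 ` ker 8)"
  proof -
    have "{x\<in>ker 8. zmul 4 x = 0} = ker 4" using z48 by auto
    then show ?thesis using card_kernel_image[OF k8, of 4] by simp
  qed
  have c4: "card (ker 4) = card (ker 2) * card (zmul 2 ` ker 4)"
  proof -
    have "{x\<in>ker 4. zmul 2 x = 0} = ker 2" using z24 by auto
    then show ?thesis using card_kernel_image[OF k4, of 2] by simp
  qed
  have dbl: "x + x = zmul 2 x" for x :: 'a using zmul_Suc_right[of 1 x] by simp
  have "\<exists>a. card (ker 2) = 2 ^ a" by (rule card_elementary_2_group[OF k2]) (simp add: dbl)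
  then obtain a where a: "card (ker 2) = 2 ^ a" by blast
  have im2: "zmul 2 x + zmul 2 x = zmul 4 x" "zmul 4 x + zmul 4 x = zmul 8 x" for x :: 'a
    using zmul_add_left[of 2 2 x] zmul_add_left[of 4 4 x] by simp_all
  have "\<exists>b. card (zmul 2 ` ker 4) = 2 ^ b"
    by (rule card_elementary_2_group[OF subgrp_image[OF k4]]) (auto simp: im2)
  then obtain b where b: "card (zmul 2 ` ker 4) = 2 ^ b" by blast
  have "\<exists>e. card (zmul 4 ` ker 8) = 2 ^ e"
    by (rule card_elementary_2_group[OF subgrp_image[OF k8]]) (auto simp: im2)
  then obtain e where e: "card (zmul 4 ` ker 8) = 2 ^ e" by blast
  have evene: "even e"
  proof (rule even_exponent)
    show "2 ^ e * (int (card (ker 4)))\<^sup>2 = ga\<^sup>2"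
      using g2 unfolding c8 e by (simp add: power2_eq_square mult_ac)
    show "int (card (ker 4)) \<noteq> 0" using card_ker[of 4] by simp
  qed

  obtain z where z: "zmul 2 z = 0" "2 * q z \<notin> \<int>" "\<And>\<xi>. zmul 2 \<xi> = 0 \<Longrightarrow> eq_mod1 (bl \<xi> z) (2 * q \<xi>)"
    using odd2 unfolding odd_two_torsion_def by blast
  \<comment> \<open>|H|^2 = |D_2| |2 D_4| = 2^(a+b). Translation by z gives H = e(q(z)) cnj H with
    e(q(z)) equal to i or -i, so real and imaginary part of H agree up to sign, 2^(a+b) is twice a
    square, and a + b is odd.\<close>
  define H where "H = (\<Sum>h\<in>ker 2. er (q h))"
  have R2: "{h\<in>ker 2. \<forall>h'\<in>ker 2. of_int 1 * bl h h' \<in> \<int>} = zmul 2 ` ker 4"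
  proof (intro equalityI subsetI)
    fix h assume h: "h \<in> {h\<in>ker 2. \<forall>h'\<in>ker 2. of_int 1 * bl h h' \<in> \<int>}"
    then obtain y where y: "h = zmul 2 y" using annihilator_kernel[of 2 h] by auto
    then have "zmul 4 y = 0" using h zmul_mult[of 2 2 y] by simp
    then show "h \<in> zmul 2 ` ker 4" using y by blast
  next
    fix h assume "h \<in> zmul 2 ` ker 4"
    then obtain y where y: "h = zmul 2 y" "zmul 4 y = 0" by blast
    have "zmul 2 h = 0" using y zmul_mult[of 2 2 y] by simp
    moreover have "bl h h' \<in> \<int>" if "zmul 2 h' = 0" for h'
      using eq_mod1_Ints_iff[OF bl_zmul_swap[of 2 y h']] bl_0_left that by (simp add: y bl_commute)
    ultimately show "h \<in> {h\<in>ker 2. \<forall>h'\<in>ker 2. of_int 1 * bl h h' \<in> \<int>}" by simp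
  qed
  have Hnorm: "H * cnj H = of_nat (2 ^ a * 2 ^ b)"
  proof -
    have "er (of_int 1 * q h) = 1" if hK: "h \<in> zmul 2 ` ker 4" for h
    proof -
      obtain y where y: "h = zmul 2 y" "zmul 4 y = 0" using hK by blast
      have "q h \<in> \<int>" unfolding y using eq_mod1_Ints_iff[OF q_zmul[of 2 y]] e4[OF y(2)] by simp
      then show ?thesis using er_eq_1_iff by simp
    qed
    then have "(\<Sum>h\<in>zmul 2 ` ker 4. er (of_int 1 * q h)) = of_nat (2 ^ b)" using b by simp
    then show ?thesis using gauss_sum_norm[OF k2 R2[symmetric]] a by (simp add: H_def)
  qed
  have Hcnj: "H = er (q z) * cnj H"
  proof -
    have "H = (\<Sum>h\<in>ker 2. er (q (h + z)))"
      unfolding H_def using sum.reindex_bij_betw[OF subgrp_shift[OF k2], of z "\<lambda>h. er (q h)"] z by simp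
    also have "\<dots> = (\<Sum>h\<in>ker 2. er (q z) * er (- q h))"
    proof (intro sum.cong refl)
      fix h assume "h \<in> ker 2"
      then have h: "zmul 2 h = 0" by simp
      have "eq_mod1 (q (h + z)) (q h + q z + 2 * q h)" unfolding q_add by (intro eq_mod1_add eq_mod1_refl z(3) h)
      also have "eq_mod1 \<dots> (q z + - q h)" using e4[OF z24[OF h]] by (simp add: eq_mod1_def)
      finally show "er (q (h + z)) = er (q z) * er (- q h)" by (simp only: er_add[symmetric] er_cong)
    qed
    also have "\<dots> = er (q z) * cnj H" unfolding H_def cnj_sum cnj_er sum_distrib_left ..
    finally show ?thesis .
  qed
  obtain x y :: int where xy: "H = Complex (of_int x) (of_int y)"
  proof -
    have "er (q h) ^ 4 = 1" if "h \<in> ker 2" for h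
      using e4[OF z24, of h] that er_power4 by simp
    then show ?thesis using sum_gaussian_integer[of "ker 2" "\<lambda>h. er (q h)"] that unfolding H_def by blast
  qed
  have "x\<^sup>2 = y\<^sup>2"
  proof -
    have "er (2 * q z) ^ 2 = 1" using e4[OF z24[OF z(1)]] er_eq_1_iff by (simp add: er_power2)
    moreover have "er (2 * q z) \<noteq> 1" using z(2) er_eq_1_iff by blast
    ultimately have "er (2 * q z) = - 1" by (simp add: power2_eq_1_iff)
    then have "er (q z) ^ 2 = - 1" by (simp add: er_power2)
    then have "(er (q z) - \<i>) * (er (q z) + \<i>) = 0" by (simp add: algebra_simps power2_eq_square)
    then consider "er (q z) = \<i>" | "er (q z) = - \<i>" by (auto simp: eq_neg_iff_add_eq_0)
    then show ?thesis
    proof cases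
      case 1
      have "Re H = Re (\<i> * cnj H)" using arg_cong[OF Hcnj, of Re] unfolding 1 .
      then show ?thesis by (simp add: xy)
    next
      case 2
      have "Re H = Re (- \<i> * cnj H)" using arg_cong[OF Hcnj, of Re] unfolding 2 .
      then have "real_of_int x = of_int (- y)" by (simp add: xy)
      then have "x = - y" by (simp only: of_int_eq_iff)
      then show ?thesis by simp
    qed
  qed
  moreover have "2 ^ a * 2 ^ b = x\<^sup>2 + y\<^sup>2"
  proof -
    have "int (2 ^ a * 2 ^ b) = x\<^sup>2 + y\<^sup>2"
    proof (rule int_eq_of_complex)
      show "of_nat (2 ^ a * 2 ^ b) = (of_int (x\<^sup>2 + y\<^sup>2) :: complex)"
        unfolding Hnorm[symmetric] xy by (simp add: complex_eq_iff power2_eq_square)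
    qed
    then show ?thesis by simp
  qed
  ultimately have "2 ^ (a + b + 1) * 1\<^sup>2 = (2 * x)\<^sup>2" by (simp add: power_add power_mult_distrib)
  then have "even (a + b + 1)" by (rule even_exponent) simp
  \<comment> \<open>So X^2 + Y^2 = |D_8| is an odd power of 2. This forces X^2 = Y^2, hence G^2 is
    purely imaginary and G^4 = -|D_8|^2.\<close>
  then have "odd (a + b + e)" using evene by simp
  then obtain k where k: "a + b + e = 2 * k + 1" by (metis oddE)
  have "int (card (ker 8)) = 2 ^ (2 * k + 1)"
    unfolding c8 c4 a b e k[symmetric] by (simp add: power_add)
  then have "X\<^sup>2 + Y\<^sup>2 = 2 ^ (2 * k + 1)" using cXY by simp
  then have sq: "X\<^sup>2 = Y\<^sup>2" by (rule sum_two_squares_odd_power)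
  have G4: "G ^ 4 = - (of_nat (card (ker 8)) ^ 2)"
  proof -
    have "G ^ 2 = Complex (of_int (X\<^sup>2 - Y\<^sup>2)) (of_int (2 * X * Y))"
      unfolding XY by (simp add: power2_eq_square complex_eq_iff)
    then have "(G ^ 2) ^ 2 = (Complex 0 (of_int (2 * X * Y))) ^ 2" using sq by simp
    then have "G ^ 4 = (Complex 0 (of_int (2 * X * Y))) ^ 2" unfolding power_mult[symmetric] by simp
    also have "\<dots> = of_int (- ((2 * X * Y)\<^sup>2))" by (simp add: power2_eq_square complex_eq_iff)
    also have "(2 * X * Y)\<^sup>2 = (X\<^sup>2 + Y\<^sup>2)\<^sup>2" using sq by (simp add: power2_eq_square)
    also have "X\<^sup>2 + Y\<^sup>2 = int (card (ker 8))" using cXY by simp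
    finally show ?thesis by simp
  qed

  \<comment> \<open>D is the orthogonal sum of D_8 and its odd part Q, so the Gauss sum of D is a
    product. The sign in G^4 must then be compensated by the factor of Q, which
    \<open>gauss_sum_odd_part\<close> forbids.\<close>
  define Q where "Q = (ker (int N') :: 'a set)"
  have ortho: "bl x y \<in> \<int>" if "x \<in> ker 8" "y \<in> Q" for x y
  proof -
    have "bl x y = of_int u * (of_int 8 * bl x y) + of_int w * (of_int (int N') * bl y x)"
    proof -
      have "of_int (u * 8 + w * int N') * bl x y = bl x y" unfolding uw by simp
      then show ?thesis by (simp add: algebra_simps bl_commute[of y x])
    qed
    then show ?thesis using bl_zmul_Ints[of 8 x y] bl_zmul_Ints[of "int N'" y x] that
      by (metis (mono_tags, lifting) Ints_add Q_def int_mult_Ints mem_Collect_eq)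
  qed
  have bij: "bij_betw (\<lambda>(x, y). x + y) (ker 8 \<times> Q) UNIV"
  proof (rule bij_betwI[where g = "\<lambda>x. (zmul (w * int N') x, zmul (u * 8) x)"])
    have comm: "zmul 8 (zmul (w * int N') x) = 0" "zmul (int N') (zmul (u * 8) x) = 0" for x :: 'a
      unfolding zmul_mult[symmetric] by (rule zmul_level_dvd, simp add: N')+
    then show "(\<lambda>x. (zmul (w * int N') x, zmul (u * 8) x)) \<in> UNIV \<rightarrow> ker 8 \<times> Q" by (simp add: Q_def)
    show "(case (zmul (w * int N') x, zmul (u * 8) x) of (x, y) \<Rightarrow> x + y) = x" for x :: 'a
      using uw by (simp add: add.commute flip: zmul_add_left)
    show "(zmul (w * int N') (case p of (x, y) \<Rightarrow> x + y), zmul (u * 8) (case p of (x, y) \<Rightarrow> x + y)) = p" if pQ: "p \<in> ker 8 \<times> Q" for p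
    proof -
      obtain x y where p: "p = (x, y)" "zmul 8 x = 0" "zmul (int N') y = 0" using pQ by (auto simp: Q_def)
      have 1: "zmul (u * 8) x = 0" "zmul (w * int N') y = 0" using p by (simp_all add: zmul_mult)
      have "zmul (u * 8) x + zmul (w * int N') x = x" "zmul (u * 8) y + zmul (w * int N') y = y"
        using uw by (simp_all flip: zmul_add_left)
      then show ?thesis using 1 by (simp add: p zmul_add_right)
    qed
  qed simp
  have GD: "(\<Sum>g\<in>UNIV. er (q g)) = G * (\<Sum>x\<in>Q. er (q x))"
  proof -
    have "(\<Sum>g\<in>UNIV. er (q g)) = (\<Sum>p\<in>ker 8 \<times> Q. er (q (case p of (x, y) \<Rightarrow> x + y)))"
      using sum.reindex_bij_betw[OF bij, of "\<lambda>g. er (q g)"] by simp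
    also have "\<dots> = (\<Sum>(x, y)\<in>ker 8 \<times> Q. er (q x) * er (q y))"
      by (intro sum.cong refl) (use ortho er_q_add_ortho in \<open>force\<close>)
    also have "\<dots> = G * (\<Sum>x\<in>Q. er (q x))"
      unfolding G_def sum_product by (simp add: sum.cartesian_product)
    finally show ?thesis .
  qed
  have cD: "CARD('a) = card (ker 8) * card Q"
    using bij_betw_same_card[OF bij] by (simp add: card_cartesian_product)
  have "G ^ 4 * (\<Sum>x\<in>Q. er (q x)) ^ 4 = of_nat (card (ker 8)) ^ 2 * of_nat (card Q) ^ 2"
    using gauss_sum_even_signature[OF sign] unfolding GD cD by (simp add: power_mult_distrib)
  then have "of_nat (card (ker 8)) ^ 2 * (- ((\<Sum>x\<in>Q. er (q x)) ^ 4)) = of_nat (card (ker 8)) ^ 2 * (of_nat (card Q) ^ 2 :: complex)"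
    unfolding G4 by simp
  moreover have "(of_nat (card (ker 8)) ^ 2 :: complex) \<noteq> 0" using card_ker[of 8] by simp
  ultimately have "- ((\<Sum>x\<in>Q. er (q x)) ^ 4) = of_nat (card Q) ^ 2" using mult_left_cancel by blast
  then have "(\<Sum>x\<in>Q. er (q x)) ^ 4 = - (of_nat (card Q) ^ 2)" by (metis minus_minus)
  moreover have "(\<Sum>x\<in>Q. er (q x)) ^ 4 \<noteq> - (of_nat (card Q) ^ 2)"
    unfolding Q_def using oddN' N'0 by (intro gauss_sum_odd_part) (auto intro: perp_kernel[OF bezN'])
  ultimately show False by blast
qed

end

section \<open>Summation over pairs of residues\<close>

lemma sum_residues_crt:
  fixes F :: "nat \<Rightarrow> nat \<Rightarrow> real"
  assumes "coprime m n" "m > 0" "n > 0"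
  shows "(\<Sum>x<m * n. F (x mod m) (x mod n)) = (\<Sum>a<m. \<Sum>b<n. F a b)"
proof -
  have inj: "inj_on (\<lambda>x. (x mod m, x mod n)) {..<m * n}"
  proof (rule inj_onI)
    fix x y assume xy: "x \<in> {..<m * n}" "y \<in> {..<m * n}" "(x mod m, x mod n) = (y mod m, y mod n)"
    then have "[x = y] (mod m)" "[x = y] (mod n)" by (simp_all add: cong_def)
    then have "[x = y] (mod m * n)" using assms(1) by (rule coprime_cong_mult_nat)
    then show "x = y" using xy by (simp add: cong_def)
  qed
  have sub: "(\<lambda>x. (x mod m, x mod n)) ` {..<m * n} \<subseteq> {..<m} \<times> {..<n}" using assms by auto
  have "card ((\<lambda>x. (x mod m, x mod n)) ` {..<m * n}) = card ({..<m} \<times> {..<n})"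
    using inj by (simp add: card_image)
  then have "(\<lambda>x. (x mod m, x mod n)) ` {..<m * n} = {..<m} \<times> {..<n}"
    using sub by (intro card_subset_eq) auto
  then have bij: "bij_betw (\<lambda>x. (x mod m, x mod n)) {..<m * n} ({..<m} \<times> {..<n})"
    using inj by (simp add: bij_betw_def)
  have "(\<Sum>x<m * n. F (x mod m) (x mod n)) = (\<Sum>(a, b)\<in>{..<m} \<times> {..<n}. F a b)"
    using sum.reindex_bij_betw[OF bij, of "\<lambda>(a, b). F a b"] by simp
  then show ?thesis by (simp add: sum.cartesian_product)
qed

lemma sum_residue_pairs_crt:
  fixes f g :: "nat \<Rightarrow> nat \<Rightarrow> real"
  assumes mn: "coprime m n" "m > 0" "n > 0"
    and f: "\<And>c d. f (c mod m) (d mod m) = f c d" and g: "\<And>c d. g (c mod n) (d mod n) = g c d"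
  shows "(\<Sum>c<m * n. \<Sum>d<m * n. f c d * g c d) = (\<Sum>c<m. \<Sum>d<m. f c d) * (\<Sum>c<n. \<Sum>d<n. g c d)"
proof -
  have "(\<Sum>c<m * n. \<Sum>d<m * n. f c d * g c d) = (\<Sum>c<m * n. \<Sum>d<m * n. f (c mod m) (d mod m) * g (c mod n) (d mod n))"
    by (simp only: f g)
  also have "\<dots> = (\<Sum>a<m. \<Sum>a'<n. \<Sum>b<m. \<Sum>b'<n. f a b * g a' b')"
    by (subst sum_residues_crt[OF mn, of "\<lambda>b b'. f _ b * g _ b'"])
      (rule sum_residues_crt[OF mn, of "\<lambda>a a'. \<Sum>b<m. \<Sum>b'<n. f a b * g a' b'"])
  also have "\<dots> = (\<Sum>a<m. \<Sum>a'<n. (\<Sum>b<m. f a b) * (\<Sum>b'<n. g a' b'))"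
    by (simp only: sum_product)
  also have "\<dots> = (\<Sum>c<m. \<Sum>d<m. f c d) * (\<Sum>c<n. \<Sum>d<n. g c d)"
    by (simp only: sum_product)
  finally show ?thesis .
qed

lemma sum_residue_pairs_prod:
  fixes h :: "nat \<Rightarrow> nat \<Rightarrow> nat \<Rightarrow> real"
  assumes "finite A" "\<And>p. p \<in> A \<Longrightarrow> prime p"
    and "\<And>p c d. p \<in> A \<Longrightarrow> h p (c mod p ^ k p) (d mod p ^ k p) = h p c d"
  shows "(\<Sum>c<(\<Prod>p\<in>A. p ^ k p). \<Sum>d<(\<Prod>p\<in>A. p ^ k p). \<Prod>p\<in>A. h p c d) =
     (\<Prod>p\<in>A. \<Sum>c<p ^ k p. \<Sum>d<p ^ k p. h p c d)"
  using assms
proof (induction A)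
  case empty
  then show ?case by simp
next
  case (insert p A)
  let ?M = "\<Prod>p\<in>A. p ^ k p"
  have pp: "prime p" and pA: "\<And>p'. p' \<in> A \<Longrightarrow> prime p'" using insert.prems by auto
  have cop: "coprime (p ^ k p) ?M"
    using insert.hyps pp pA by (intro prod_coprime_right coprime_power_left_iff[THEN iffD2] coprime_power_right_iff[THEN iffD2] disjI1 primes_coprime) auto
  have M0: "?M > 0" using pA by (intro prod_pos) (auto intro: prime_gt_0_nat)
  have per: "(\<Prod>p\<in>A. h p (c mod ?M) (d mod ?M)) = (\<Prod>p\<in>A. h p c d)" for c d
  proof (rule prod.cong[OF refl])
    fix p' assume p': "p' \<in> A"
    then have dv: "p' ^ k p' dvd ?M" using insert.hyps by (intro dvd_prodI) auto
    have "h p' (c mod ?M) (d mod ?M) = h p' (c mod ?M mod p' ^ k p') (d mod ?M mod p' ^ k p')"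
      using insert.prems(2)[of p'] p' by simp
    also have "\<dots> = h p' (c mod p' ^ k p') (d mod p' ^ k p')" using dv by (simp add: mod_mod_cancel)
    also have "\<dots> = h p' c d" using insert.prems(2)[of p'] p' by simp
    finally show "h p' (c mod ?M) (d mod ?M) = h p' c d" .
  qed
  have "(\<Sum>c<p ^ k p * ?M. \<Sum>d<p ^ k p * ?M. h p c d * (\<Prod>p\<in>A. h p c d)) =
     (\<Sum>c<p ^ k p. \<Sum>d<p ^ k p. h p c d) * (\<Sum>c<?M. \<Sum>d<?M. \<Prod>p\<in>A. h p c d)"
    using cop M0 prime_gt_0_nat[OF pp] insert.prems(2)[of p] per
    by (intro sum_residue_pairs_crt) auto
  moreover have "(\<Sum>c<?M. \<Sum>d<?M. \<Prod>p\<in>A. h p c d) = (\<Prod>p\<in>A. \<Sum>c<p ^ k p. \<Sum>d<p ^ k p. h p c d)"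
    using insert.prems by (intro insert.IH) auto
  ultimately show ?case using insert.hyps by simp
qed

lemma card_multiples: "k > 0 \<Longrightarrow> card {x. x < k * m \<and> k dvd x} = (m::nat)"
proof -
  assume k: "k > 0"
  have "bij_betw (\<lambda>y. k * y) {..<m} {x. x < k * m \<and> k dvd x}"
    using k by (intro bij_betwI[where g = "\<lambda>x. x div k"]) (auto simp: less_mult_imp_div_less mult.commute)
  then show ?thesis using bij_betw_same_card by fastforce
qed

text \<open>An upper bound for the \<open>p\<close>-part of the pole order at the cusps with lower left entry \<open>c\<close>,
  where \<open>p\<^sup>\<nu>\<close> is the \<open>p\<close>-part of the level. The flag selects the exceptional bound for \<open>p\<^sup>\<nu> = 8\<close>.\<close>

definition cusp_weight :: "bool \<Rightarrow> nat \<Rightarrow> nat \<Rightarrow> nat \<Rightarrow> real" where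
  "cusp_weight s p \<nu> c =
    (if s \<and> p = 2 \<and> \<nu> = 3
     then (if \<not> 2 dvd c then 1 / 8 else if \<not> 4 dvd c then 1 / 4 else if \<not> 8 dvd c then 1 / 2 else 1)
     else (if \<not> p dvd c then 1 / real p ^ \<nu> else if p ^ (\<nu> - 1) dvd c then 1 else 0))"

lemma cusp_weight_nonneg: "cusp_weight s p \<nu> c \<ge> 0"
  by (simp add: cusp_weight_def)

lemma cusp_weight_mod:
  assumes "\<nu> \<ge> 1"
  shows "cusp_weight s p \<nu> (c mod p ^ \<nu>) = cusp_weight s p \<nu> c"
proof (cases "s \<and> p = 2 \<and> \<nu> = 3")
  case True
  then have [simp]: "s" "p = 2" "\<nu> = 3" by auto
  have "2 dvd c mod 8 \<longleftrightarrow> 2 dvd c" "4 dvd c mod 8 \<longleftrightarrow> 4 dvd c" "8 dvd c mod 8 \<longleftrightarrow> 8 dvd c"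
    by (simp_all add: dvd_mod_iff)
  then show ?thesis by (simp add: cusp_weight_def)
next
  case False
  have "p dvd p ^ \<nu>" "p ^ (\<nu> - 1) dvd p ^ \<nu>" using assms by (auto intro: le_imp_power_dvd dvd_power)
  then have "p dvd c mod p ^ \<nu> \<longleftrightarrow> p dvd c" "p ^ (\<nu> - 1) dvd c mod p ^ \<nu> \<longleftrightarrow> p ^ (\<nu> - 1) dvd c"
    by (simp_all add: dvd_mod_iff)
  then show ?thesis using False by (simp add: cusp_weight_def)
qed

definition local_prim :: "nat \<Rightarrow> nat \<Rightarrow> nat \<Rightarrow> real" where
  "local_prim p c d = (if p dvd c \<and> p dvd d then 0 else 1)"

text \<open>Remove from the p^(2\<nu>) pairs the p^(2\<nu>-2) with both entries divisible by p. The
  factor p^\<nu> - p^(\<nu>-1) is displayed because \<open>sum_local_weight\<close> contains it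
  too.\<close>

lemma sum_local_prim:
  assumes "p > 0" "\<nu> \<ge> 1"
  shows "(\<Sum>c<p ^ \<nu>. \<Sum>d<p ^ \<nu>. local_prim p c d) = real (p ^ \<nu> - p ^ (\<nu> - 1)) * (real (p ^ (\<nu> - 1)) * (real p + 1))"
proof -
  define P' where "P' = p ^ (\<nu> - 1)"
  have P: "p ^ \<nu> = p * P'" using assms(2) unfolding P'_def by (cases \<nu>) auto
  have c0: "card {x. x < p * P' \<and> p dvd x} = P'" using assms card_multiples by blast
  have s: "(\<Sum>d<p * P'. if p dvd d then (1::real) else 0) = real P'"
    using c0 by (simp add: sum.If_cases lessThan_def Int_def)
  have "(\<Sum>c<p * P'. \<Sum>d<p * P'. local_prim p c d) =
     (\<Sum>c<p * P'. \<Sum>d<p * P'. 1 - (if p dvd c then 1 else 0) * (if p dvd d then 1 else 0))"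
    by (intro sum.cong refl) (simp add: local_prim_def)
  also have "\<dots> = (\<Sum>c<p * P'. real (p * P') - (if p dvd c then 1 else 0) * real P')"
    unfolding sum_subtractf sum_distrib_left[symmetric] s by simp
  also have "\<dots> = real (p * P') * real (p * P') - real P' * real P'"
    unfolding sum_subtractf sum_distrib_right[symmetric] s by simp
  also have "\<dots> = (real (p * P') - real P') * (real P' * (real p + 1))" by (simp add: algebra_simps)
  also have "real (p * P') - real P' = real (p * P' - P')" using assms(1) by (simp add: of_nat_diff)
  finally show ?thesis unfolding P P'_def[symmetric] .
qed

text \<open>A c prime to p has p^\<nu> partners d, each of weight p^(-\<nu>), and contributes 1. Of
  the other c only the common multiples of p and p^(\<nu>-1) count: one if \<nu> = 1, p of them if
  \<nu> >= 2, each with p^\<nu> - p^(\<nu>-1) partners. For p^\<nu> = 8 the exceptional weights give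
  4 + 2 + 2 + 4 = 12, the same total, so the final bound does not depend on the flag.\<close>

lemma sum_local_weight:
  assumes "prime p" "\<nu> \<ge> 1"
  shows "(\<Sum>c<p ^ \<nu>. \<Sum>d<p ^ \<nu>. local_prim p c d * cusp_weight s p \<nu> c) =
     real (p ^ \<nu> - p ^ (\<nu> - 1)) * (if \<nu> = 1 then 2 else real p + 1)"
proof (cases "s \<and> p = 2 \<and> \<nu> = 3")
  case True
  then have [simp]: "s" "p = 2" "\<nu> = 3" by auto
  have "{..<8::nat} = {0, 1, 2, 3, 4, 5, 6, 7}" by auto
  then show ?thesis by (simp add: cusp_weight_def local_prim_def)
next
  case False
  have p0: "p > 0" using assms(1) prime_gt_0_nat by blast
  define P' where "P' = p ^ (\<nu> - 1)"
  have P: "p ^ \<nu> = p * P'" using assms(2) unfolding P'_def by (cases \<nu>) auto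
  have P'0: "P' > 0" using p0 by (simp add: P'_def)
  have cm: "card {x. x < p * P' \<and> p dvd x} = P'" using p0 card_multiples by blast
  have s0: "(\<Sum>d<p * P'. if p dvd d then (1::real) else 0) = real P'"
    using cm by (simp add: sum.If_cases lessThan_def Int_def)
  have s1: "(\<Sum>d<p * P'. if p dvd d then 0 else (1::real)) = real (p * P' - P')"
  proof -
    have "(\<Sum>d<p * P'. if p dvd d then 0 else (1::real)) = (\<Sum>d<p * P'. 1 - (if p dvd d then 1 else 0))"
      by (intro sum.cong refl) auto
    then show ?thesis unfolding sum_subtractf s0 using p0 by (simp add: of_nat_diff)
  qed
  define n1 where "n1 = (if \<nu> = 1 then 1 else p)"
  have c1: "(\<Sum>c<p * P'. if p dvd c \<and> P' dvd c then (1::real) else 0) = real n1"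
  proof (cases "\<nu> = 1")
    case True
    then have "P' = 1" by (simp add: P'_def)
    then show ?thesis using s0 True by (simp add: n1_def)
  next
    case False
    then have "p dvd P'" using assms(2) by (simp add: P'_def)
    then have "p dvd c \<and> P' dvd c \<longleftrightarrow> P' dvd c" for c using dvd_trans by blast
    moreover have "card {x. x < P' * p \<and> P' dvd x} = p" using P'0 card_multiples by blast
    ultimately show ?thesis using False by (simp add: sum.If_cases lessThan_def Int_def mult.commute n1_def)
  qed
  have w: "cusp_weight s p \<nu> c = (if \<not> p dvd c then 1 / real (p * P') else if P' dvd c then 1 else 0)" for c
    using False P by (auto simp: cusp_weight_def P'_def simp flip: of_nat_power)
  have inner: "(\<Sum>d<p * P'. local_prim p c d * cusp_weight s p \<nu> c) =
     (if p dvd c then 0 else 1) + (if p dvd c \<and> P' dvd c then 1 else 0) * real (p * P' - P')" for c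
  proof (cases "p dvd c")
    case True
    then have "(\<Sum>d<p * P'. local_prim p c d * cusp_weight s p \<nu> c) = (\<Sum>d<p * P'. (if p dvd d then 0 else 1) * (if P' dvd c then 1 else 0))"
      by (intro sum.cong refl) (simp add: local_prim_def w)
    then show ?thesis unfolding sum_distrib_right[symmetric] s1 using True by simp
  next
    case False
    then show ?thesis using p0 P'0 by (simp add: local_prim_def w)
  qed
  have "(\<Sum>c<p * P'. \<Sum>d<p * P'. local_prim p c d * cusp_weight s p \<nu> c) =
     (\<Sum>c<p * P'. (if p dvd c then 0 else 1) + (if p dvd c \<and> P' dvd c then 1 else 0) * real (p * P' - P'))"
    by (simp only: inner)
  also have "\<dots> = real (p * P' - P') + real n1 * real (p * P' - P')"
    unfolding sum.distrib sum_distrib_right[symmetric] s1 c1 ..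
  also have "\<dots> = real (p * P' - P') * (1 + real n1)" by (simp add: algebra_simps)
  finally show ?thesis unfolding P P'_def[symmetric] by (simp add: n1_def add.commute)
qed

text \<open>Lower rows of matrices in SL_2(Z) modulo N, by \<open>primitive_pair_lift\<close>; they
  index the cosets of \<Gamma>1(N).\<close>

definition primitive_pairs :: "nat \<Rightarrow> (nat \<times> nat) set" where
  "primitive_pairs N = {(c, d). c < N \<and> d < N \<and> (\<forall>p\<in>prime_factors N. \<not> (p dvd c \<and> p dvd d))}"

lemma finite_primitive_pairs: "finite (primitive_pairs N)"
  by (rule finite_subset[of _ "{..<N} \<times> {..<N}"]) (auto simp: primitive_pairs_def)

lemma sum_primitive_pairs:
  assumes N: "N > 0"
    and h: "\<And>p c. p \<in> prime_factors N \<Longrightarrow> h p (c mod p ^ multiplicity p N) = (h p c :: real)"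
  shows "(\<Sum>(c, d)\<in>primitive_pairs N. \<Prod>p\<in>prime_factors N. h p c) =
    (\<Prod>p\<in>prime_factors N. \<Sum>c<p ^ multiplicity p N. \<Sum>d<p ^ multiplicity p N. local_prim p c d * h p c)"
proof -
  have NN: "N = (\<Prod>p\<in>prime_factors N. p ^ multiplicity p N)"
    using N by (simp add: prod_prime_factors)
  have per: "local_prim p (c mod p ^ multiplicity p N) (d mod p ^ multiplicity p N) * h p (c mod p ^ multiplicity p N)
     = local_prim p c d * h p c" if p: "p \<in> prime_factors N" for p c d
  proof -
    have "p dvd p ^ multiplicity p N" using p N by (auto simp: in_prime_factors_iff prime_multiplicity_gt_zero_iff)
    then have "p dvd x mod p ^ multiplicity p N \<longleftrightarrow> p dvd x" for x by (simp add: dvd_mod_iff)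
    then show ?thesis using h[OF p] by (simp add: local_prim_def)
  qed
  have ind: "(\<Prod>p\<in>prime_factors N. local_prim p c d * h p c) =
     (if (\<forall>p\<in>prime_factors N. \<not> (p dvd c \<and> p dvd d)) then \<Prod>p\<in>prime_factors N. h p c else 0)" for c d
  proof (cases "\<forall>p\<in>prime_factors N. \<not> (p dvd c \<and> p dvd d)")
    case True
    then show ?thesis by (auto simp: local_prim_def intro!: prod.cong)
  next
    case False
    then show ?thesis by (auto simp: local_prim_def intro!: prod_zero)
  qed
  have "(\<Sum>(c, d)\<in>primitive_pairs N. \<Prod>p\<in>prime_factors N. h p c) =
     (\<Sum>(c, d)\<in>{..<N} \<times> {..<N}. \<Prod>p\<in>prime_factors N. local_prim p c d * h p c)"
    by (rule sum.mono_neutral_cong_left) (auto simp: primitive_pairs_def ind split: if_splits)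
  also have "\<dots> = (\<Sum>c<N. \<Sum>d<N. \<Prod>p\<in>prime_factors N. local_prim p c d * h p c)"
    by (simp add: sum.cartesian_product)
  also have "\<dots> = (\<Prod>p\<in>prime_factors N. \<Sum>c<p ^ multiplicity p N. \<Sum>d<p ^ multiplicity p N. local_prim p c d * h p c)"
    using sum_residue_pairs_prod[of "prime_factors N" "\<lambda>p c d. local_prim p c d * h p c" "\<lambda>p. multiplicity p N"] per
    unfolding NN[symmetric] by auto
  finally show ?thesis .
qed

text \<open>Both sides are products over the primes of N with a common positive factor D. After
  cancelling it, \<open>mu p N\<close> remains on the left, and on the right a factor 2 for each
  prime that divides N exactly once.\<close>

lemma counting_inequality:
  assumes N: "N > 0"
    and le: "x * real (card (primitive_pairs N)) \<le>
      (\<Sum>(c, d)\<in>primitive_pairs N. \<Prod>p\<in>prime_factors N. cusp_weight s p (multiplicity p N) c)"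
  shows "x * (\<Prod>p\<in>prime_factors N. real (mu p N)) \<le> 2 ^ hall_omega N"
proof -
  let ?\<nu> = "\<lambda>p. multiplicity p N" and ?A = "prime_factors N"
  have \<nu>1: "?\<nu> p \<ge> 1" if "p \<in> ?A" for p
    using that N by (auto simp: in_prime_factors_iff prime_multiplicity_gt_zero_iff Suc_le_eq)
  define \<phi> where "\<phi> p = real (p ^ ?\<nu> p - p ^ (?\<nu> p - 1))" for p
  define t where "t p = (if ?\<nu> p = 1 then 1 else real p + 1)" for p
  have card: "real (card (primitive_pairs N)) = (\<Prod>p\<in>?A. \<phi> p * (real (mu p N) * t p))"
  proof -
    have "real (card (primitive_pairs N)) = (\<Sum>(c, d)\<in>primitive_pairs N. \<Prod>p\<in>?A. 1)"
      by (simp add: case_prod_unfold)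
    also have "\<dots> = (\<Prod>p\<in>?A. \<Sum>c<p ^ ?\<nu> p. \<Sum>d<p ^ ?\<nu> p. local_prim p c d * 1)"
      by (rule sum_primitive_pairs[OF N]) simp
    also have "\<dots> = (\<Prod>p\<in>?A. \<phi> p * (real (mu p N) * t p))"
    proof (rule prod.cong[OF refl])
      fix p assume p: "p \<in> ?A"
      then have "p > 0" by (auto intro: prime_gt_0_nat)
      then have "(\<Sum>c<p ^ ?\<nu> p. \<Sum>d<p ^ ?\<nu> p. local_prim p c d * 1) = \<phi> p * (real (p ^ (?\<nu> p - 1)) * (real p + 1))"
        using sum_local_prim[of p "?\<nu> p"] \<nu>1[OF p] by (simp add: \<phi>_def)
      also have "real (p ^ (?\<nu> p - 1)) * (real p + 1) = real (mu p N) * t p"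
        using \<nu>1[OF p] by (auto simp: mu_def t_def)
      finally show "(\<Sum>c<p ^ ?\<nu> p. \<Sum>d<p ^ ?\<nu> p. local_prim p c d * 1) = \<phi> p * (real (mu p N) * t p)" .
    qed
    finally show ?thesis .
  qed
  have wt: "(\<Sum>(c, d)\<in>primitive_pairs N. \<Prod>p\<in>?A. cusp_weight s p (?\<nu> p) c) =
     (\<Prod>p\<in>?A. \<phi> p * ((if ?\<nu> p = 1 then 2 else 1) * t p))"
  proof -
    have "(\<Sum>(c, d)\<in>primitive_pairs N. \<Prod>p\<in>?A. cusp_weight s p (?\<nu> p) c) =
       (\<Prod>p\<in>?A. \<Sum>c<p ^ ?\<nu> p. \<Sum>d<p ^ ?\<nu> p. local_prim p c d * cusp_weight s p (?\<nu> p) c)"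
      using \<nu>1 by (intro sum_primitive_pairs[OF N] cusp_weight_mod) auto
    also have "\<dots> = (\<Prod>p\<in>?A. \<phi> p * ((if ?\<nu> p = 1 then 2 else 1) * t p))"
    proof (rule prod.cong[OF refl])
      fix p assume p: "p \<in> ?A"
      then have "prime p" by auto
      from sum_local_weight[OF this \<nu>1[OF p], of s]
      show "(\<Sum>c<p ^ ?\<nu> p. \<Sum>d<p ^ ?\<nu> p. local_prim p c d * cusp_weight s p (?\<nu> p) c) =
          \<phi> p * ((if ?\<nu> p = 1 then 2 else 1) * t p)"
        by (simp only: \<phi>_def t_def) simp
    qed
    finally show ?thesis .
  qed
  define D where "D = (\<Prod>p\<in>?A. \<phi> p * t p)"
  have D0: "D > 0" unfolding D_def
  proof (rule prod_pos)
    fix p assume p: "p \<in> ?A"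
    then have "prime p" by auto
    then have p1: "p > 1" by (rule prime_gt_1_nat)
    then have "p ^ (?\<nu> p - 1) < p ^ ?\<nu> p" using \<nu>1[OF p] by (intro power_strict_increasing) auto
    then show "\<phi> p * t p > 0" using p1 by (simp add: \<phi>_def t_def)
  qed
  have "(\<Prod>p\<in>?A. \<phi> p * (real (mu p N) * t p)) = D * (\<Prod>p\<in>?A. real (mu p N))"
    unfolding D_def prod.distrib[symmetric] by (simp add: mult_ac)
  moreover have "(\<Prod>p\<in>?A. \<phi> p * ((if ?\<nu> p = 1 then 2 else 1) * t p)) = D * 2 ^ hall_omega N"
  proof -
    have "(\<Prod>p\<in>?A. if ?\<nu> p = 1 then 2 else 1 :: real) = 2 ^ card {p\<in>?A. ?\<nu> p = 1}"
      by (simp add: prod.If_cases Int_def)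
    also have "{p\<in>?A. ?\<nu> p = 1} = {p. prime p \<and> p dvd N \<and> \<not> p ^ 2 dvd N}"
    proof -
      have "?\<nu> p = 1 \<longleftrightarrow> \<not> p ^ 2 dvd N" if p: "p \<in> ?A" for p
      proof -
        have "prime p" using p by auto
        then have "p ^ 2 dvd N \<longleftrightarrow> 2 \<le> ?\<nu> p"
          using N prime_gt_1_nat[of p] by (intro power_dvd_iff_le_multiplicity) auto
        then show ?thesis using \<nu>1[OF p] by linarith
      qed
      then show ?thesis using N by (auto simp: in_prime_factors_iff)
    qed
    finally show ?thesis unfolding D_def hall_omega_def prod.distrib by (simp add: mult_ac)
  qed
  ultimately have "D * (x * (\<Prod>p\<in>?A. real (mu p N))) \<le> D * 2 ^ hall_omega N"
    using le unfolding card wt by (simp add: mult_ac)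
  then show ?thesis using D0 by simp
qed

section \<open>Growth of expansions at the cusp\<close>

lemma norm_ee_div: "cmod (ee (of_int m * \<tau> / of_nat N)) = exp (- (2 * pi * of_int m / of_nat N) * Im \<tau>)"
  by (simp add: ee_def)

text \<open>The expansion converges absolutely at \<tau> = i. Going up from height 1 to height y
  multiplies the modulus of every term with m >= -k by at most e^(2 pi (k/N) (y - 1)), uniformly in
  m.\<close>

lemma q_expansion_bound:
  assumes q: "q_expansion N f a" and N: "N > 0" and a: "\<And>m. m < - k \<Longrightarrow> a m = 0"
  shows "\<exists>C. \<forall>\<tau>. Im \<tau> \<ge> 1 \<longrightarrow> cmod (f \<tau>) \<le> C * exp (2 * pi * (of_int k / of_nat N) * Im \<tau>)"
proof -
  define b where "b m = cmod (a m * ee (of_int m * \<i> / of_nat N))" for m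
  have "((\<lambda>m. a m * ee (of_int m * \<i> / of_nat N)) has_sum f \<i>) UNIV"
    using q unfolding q_expansion_def upper_half_plane_def by simp
  then have "(\<lambda>m. a m * ee (of_int m * \<i> / of_nat N)) summable_on UNIV" by (rule has_sum_imp_summable)
  then have sb: "b summable_on UNIV"
    unfolding summable_on_iff_abs_summable_on_complex b_def .
  define C where "C = infsum b UNIV * exp (- (2 * pi * of_int k / of_nat N))"
  have "cmod (f \<tau>) \<le> C * exp (2 * pi * (of_int k / of_nat N) * Im \<tau>)" if y: "Im \<tau> \<ge> 1" for \<tau>
  proof -
    define e where "e = exp (2 * pi * of_int k / of_nat N * (Im \<tau> - 1))"
    have hs: "((\<lambda>m. a m * ee (of_int m * \<tau> / of_nat N)) has_sum f \<tau>) UNIV"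
      using q y unfolding q_expansion_def upper_half_plane_def by auto
    have le: "cmod (a m * ee (of_int m * \<tau> / of_nat N)) \<le> e * b m" for m
    proof (cases "m < - k")
      case True
      then show ?thesis using a by (simp add: b_def)
    next
      case False
      have "- (2 * pi * of_int m / of_nat N) * Im \<tau>
          = - (2 * pi * of_int m / of_nat N) * (Im \<tau> - 1) + - (2 * pi * of_int m / of_nat N)"
        by (simp only: right_diff_distrib mult_1_right diff_add_cancel)
      also have "\<dots> \<le> 2 * pi * of_int k / of_nat N * (Im \<tau> - 1) + - (2 * pi * of_int m / of_nat N)"
      proof (intro add_right_mono mult_right_mono)
        have "- real_of_int m \<le> of_int k" using False by linarith
        then have "2 * pi * (- real_of_int m) / of_nat N \<le> 2 * pi * of_int k / of_nat N"
          by (intro divide_right_mono mult_left_mono) auto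
        then show "- (2 * pi * of_int m / of_nat N) \<le> 2 * pi * of_int k / of_nat N" by simp
      qed (use y in simp)
      finally have "exp (- (2 * pi * of_int m / of_nat N) * Im \<tau>) \<le> e * exp (- (2 * pi * of_int m / of_nat N))"
        unfolding e_def exp_add[symmetric] by simp
      then have "cmod (a m) * exp (- (2 * pi * of_int m / of_nat N) * Im \<tau>) \<le> cmod (a m) * (e * exp (- (2 * pi * of_int m / of_nat N)))"
        by (intro mult_left_mono) auto
      then show ?thesis unfolding b_def norm_mult norm_ee_div by (simp add: mult_ac)
    qed
    have "cmod (f \<tau>) \<le> e * infsum b UNIV"
      using norm_infsum_le[OF hs has_sum_cmult_right[OF has_sum_infsum[OF sb]] le] .
    also have "e * infsum b UNIV = C * exp (2 * pi * (of_int k / of_nat N) * Im \<tau>)"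
    proof -
      define z where "z = 2 * pi * of_int k / of_nat N"
      have "exp (z * (Im \<tau> - 1)) = exp (- z) * exp (z * Im \<tau>)"
        unfolding exp_add[symmetric] by (simp add: algebra_simps)
      then show ?thesis by (simp add: e_def C_def z_def)
    qed
    finally show ?thesis .
  qed
  then show ?thesis by blast
qed

text \<open>Without its lowest term the expansion grows with an exponent smaller by at least 1/N, so
  the lowest term dominates. In terms of growth a pole can be confronted with estimates that do not
  refer to coefficients.\<close>

lemma q_expansion_pole_unbounded:
  assumes q: "q_expansion N f a" and N: "N > 0" and m: "m < 0" "a m \<noteq> 0"
  shows "\<not> (\<forall>\<tau>. Im \<tau> \<ge> 1 \<longrightarrow> cmod (f \<tau>) \<le> C)"
proof
  assume C: "\<forall>\<tau>. Im \<tau> \<ge> 1 \<longrightarrow> cmod (f \<tau>) \<le> C"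
  obtain m0 where m0: "\<And>m. m < m0 \<Longrightarrow> a m = 0" using q by (auto simp: q_expansion_def)
  \<comment> \<open>The lowest exponent is found as an offset from \<open>m0\<close>, because
    \<open>LEAST\<close> requires a well-ordered range.\<close>
  define j where "j = (LEAST j. a (m0 + int j) \<noteq> 0)"
  have ex: "a (m0 + int (nat (m - m0))) \<noteq> 0" using m m0[of m] by (cases "m < m0") auto
  define m1 where "m1 = m0 + int j"
  have m1: "a m1 \<noteq> 0" unfolding m1_def j_def using ex by (rule LeastI)
  have jle: "j \<le> nat (m - m0)" unfolding j_def using ex by (rule Least_le)
  have "m \<ge> m0" using m m0[of m] by force
  then have m1neg: "m1 < 0" using jle m unfolding m1_def by linarith
  have low: "a i = 0" if "i < m1" for i
  proof (cases "i < m0")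
    case False
    then have "nat (i - m0) < j" using that by (simp add: m1_def)
    then have "\<not> a (m0 + int (nat (i - m0))) \<noteq> 0" unfolding j_def by (rule not_less_Least)
    then show ?thesis using False by simp
  qed (use m0 in auto)
  define f1 where "f1 \<tau> = f \<tau> - a m1 * ee (of_int m1 * \<tau> / of_nat N)" for \<tau>
  have "q_expansion N f1 (a(m1 := 0))"
    unfolding q_expansion_def
  proof (intro conjI ballI)
    show "\<exists>m0. \<forall>m<m0. (a(m1 := 0)) m = 0" using m0 by auto
    fix \<tau> assume t: "\<tau> \<in> upper_half_plane"
    have 1: "((\<lambda>m. a m * ee (of_int m * \<tau> / of_nat N)) has_sum f \<tau>) UNIV"
      using q t unfolding q_expansion_def by auto
    have "((\<lambda>m. a m * ee (of_int m * \<tau> / of_nat N)) has_sum (a m1 * ee (of_int m1 * \<tau> / of_nat N))) {m1}"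
      using has_sum_finite[of "{m1}"] by simp
    then have "((\<lambda>m. a m * ee (of_int m * \<tau> / of_nat N)) has_sum f1 \<tau>) (UNIV - {m1})"
      unfolding f1_def using 1 by (intro has_sum_Diff) auto
    then show "((\<lambda>m. (a(m1 := 0)) m * ee (of_int m * \<tau> / of_nat N)) has_sum f1 \<tau>) UNIV"
      by (rule has_sum_cong_neutral[THEN iffD1, rotated -1]) auto
  qed
  moreover have "(a(m1 := 0)) i = 0" if "i < - (- m1 - 1)" for i using low[of i] that by auto
  ultimately obtain C' where C': "\<And>\<tau>. Im \<tau> \<ge> 1 \<Longrightarrow>
      cmod (f1 \<tau>) \<le> C' * exp (2 * pi * (of_int (- m1 - 1) / of_nat N) * Im \<tau>)"
    using q_expansion_bound[OF _ N, of f1 "a(m1 := 0)" "- m1 - 1"] by blast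
  have C0: "C \<ge> 0" using C[rule_format, of \<i>] norm_ge_zero[of "f \<i>"] by (simp del: norm_ge_zero)
  have bd: "cmod (a m1) * exp (2 * pi * y / of_nat N) \<le> C + C'" if y: "y \<ge> 1" for y
  proof -
    define \<tau> where "\<tau> = Complex 0 y"
    define e where "e = exp (2 * pi * (of_int (- m1 - 1) / of_nat N) * y)"
    have e1: "e \<ge> 1" unfolding e_def using m1neg y N by (intro one_le_exp_iff[THEN iffD2]) (auto intro!: mult_nonneg_nonneg divide_nonneg_nonneg)
    have "cmod (a m1 * ee (of_int m1 * \<tau> / of_nat N)) \<le> cmod (f \<tau>) + cmod (f1 \<tau>)"
      unfolding f1_def by (metis add.commute diff_add_cancel norm_triangle_sub norm_minus_commute)
    also have "\<dots> \<le> C + C' * e" using C C'[of \<tau>] y by (intro add_mono) (auto simp: \<tau>_def e_def)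
    also have "\<dots> \<le> C * e + C' * e" using C0 e1 by (simp add: mult_left_le_one_le mult_le_cancel_left1)
    finally have "cmod (a m1) * exp (- (2 * pi * of_int m1 / of_nat N) * y) \<le> (C + C') * e"
      unfolding norm_mult norm_ee_div by (simp add: \<tau>_def algebra_simps)
    moreover have "exp (- (2 * pi * of_int m1 / of_nat N) * y) = exp (2 * pi * y / of_nat N) * e"
      unfolding e_def exp_add[symmetric] using N by (simp add: field_simps)
    ultimately have "(cmod (a m1) * exp (2 * pi * y / of_nat N)) * e \<le> (C + C') * e" by (simp add: mult_ac)
    then show ?thesis using e1 by simp
  qed
  define y where "y = max 1 ((C + C') / cmod (a m1) * of_nat N)"
  have y1: "y \<ge> 1" by (simp add: y_def)
  have "(C + C') / cmod (a m1) \<le> y / of_nat N" using N by (simp add: y_def pos_le_divide_eq)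
  also have "\<dots> \<le> 2 * pi * y / of_nat N" using y1 pi_ge_two N by (intro divide_right_mono) auto
  also have "\<dots> < exp (2 * pi * y / of_nat N)" using exp_ge_add_one_self[of "2 * pi * y / of_nat N"] by linarith
  finally have "C + C' < cmod (a m1) * exp (2 * pi * y / of_nat N)" using m1 by (simp add: field_simps)
  then show False using bd[OF y1] by linarith
qed

section \<open>The modular group on the upper half plane\<close>

lemma autfactor_nonzero:
  assumes "M \<in> SL2Z" "Im \<tau> > 0"
  shows "autfactor M \<tau> \<noteq> 0"
proof
  assume 0: "autfactor M \<tau> = 0"
  then have "of_int (M$2$1) * Im \<tau> = 0" by (simp add: autfactor_def complex_eq_iff)
  then have "M$2$1 = 0" using assms(2) by simp
  moreover from this 0 have "M$2$2 = 0" by (simp add: autfactor_def)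
  ultimately show False using assms(1) by (simp add: SL2Z_def det_2)
qed

lemma Im_mobius:
  assumes "M \<in> SL2Z" "Im \<tau> > 0"
  shows "Im (mobius M \<tau>) > 0"
proof -
  obtain a b c d where M: "M = mat2 a b c d" using mat2_eta by blast
  have det: "real_of_int a * of_int d - of_int b * of_int c = 1"
    using assms(1) unfolding M mat2_SL2Z by (metis of_int_1 of_int_diff of_int_mult)
  have n0: "cmod (autfactor M \<tau>) > 0" using autfactor_nonzero[OF assms] by simp
  have "Im (mobius M \<tau>) = ((of_int a * Im \<tau>) * (of_int c * Re \<tau> + of_int d) - (of_int a * Re \<tau> + of_int b) * (of_int c * Im \<tau>)) / (cmod (autfactor M \<tau>))\<^sup>2"
    unfolding mobius_def Im_divide cmod_power2 by (simp add: autfactor_def M)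
  also have "(of_int a * Im \<tau>) * (of_int c * Re \<tau> + of_int d) - (of_int a * Re \<tau> + of_int b) * (of_int c * Im \<tau>)
      = (real_of_int a * of_int d - of_int b * of_int c) * Im \<tau>" by (simp add: algebra_simps)
  finally show ?thesis using n0 assms(2) det by simp
qed

text \<open>If the enlarged product vanished identically, its new factor would be 0 on the non-empty
  open set where the old product is not, hence everywhere.\<close>

lemma prod_holomorphic_nonzero:
  assumes "finite A" "\<And>i. i \<in> A \<Longrightarrow> f i holomorphic_on S" "\<And>i. i \<in> A \<Longrightarrow> \<exists>z\<in>S. f i z \<noteq> 0"
    and S: "open S" "connected S" "S \<noteq> {}"
  shows "\<exists>z\<in>S. (\<Prod>i\<in>A. f i z) \<noteq> (0::complex)"
  using assms(1-3)
proof (induction A)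
  case (insert i A)
  show ?case
  proof (rule ccontr)
    assume "\<not> ?case"
    then have 0: "f i z * (\<Prod>i\<in>A. f i z) = 0" if "z \<in> S" for z using insert.hyps that by simp
    have hol: "(\<lambda>z. \<Prod>i\<in>A. f i z) holomorphic_on S" using insert.prems by (intro holomorphic_on_prod) auto
    have "open (S \<inter> (\<lambda>z. \<Prod>i\<in>A. f i z) -` (- {0}))"
      using S holomorphic_on_imp_continuous_on[OF hol] by (intro continuous_open_preimage) auto
    moreover have "S \<inter> (\<lambda>z. \<Prod>i\<in>A. f i z) -` (- {0}) \<noteq> {}" using insert by auto
    moreover have "f i z = 0" if "z \<in> S \<inter> (\<lambda>z. \<Prod>i\<in>A. f i z) -` (- {0})" for z using 0[of z] that by auto
    ultimately have "f i z = 0" if "z \<in> S" for z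
      using analytic_continuation_open[where f = "f i" and g = "\<lambda>_. 0", of "S \<inter> (\<lambda>z. \<Prod>i\<in>A. f i z) -` (- {0})" S z] S insert.prems that
      by auto
    then show False using insert.prems(2)[of i] by auto
  qed
qed (use S in auto)

lemma primitive_pair_lift:
  assumes "(c, d) \<in> primitive_pairs N"
  shows "\<exists>M\<in>SL2Z. int N dvd M$2$1 - int c \<and> int N dvd M$2$2 - int d"
proof -
  have cN: "c < N" and prim: "\<And>p. p \<in> prime_factors N \<Longrightarrow> \<not> (p dvd c \<and> p dvd d)"
    using assms by (auto simp: primitive_pairs_def)
  define c' where "c' = c + N"
  have c'0: "c' > 0" using cN by (simp add: c'_def)
  \<comment> \<open>Let p divide c' but not N. If p divides d, it does not divide t N; if not, it
    divides t. So p never divides d' = d + t N. The primes of N are excluded by primitivity.\<close>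
  define t where "t = \<Prod>{p \<in> prime_factors c'. \<not> p dvd d}"
  define d' where "d' = d + t * N"
  have "coprime c' d'"
  proof (rule ccontr)
    assume "\<not> coprime c' d'"
    then have "gcd c' d' \<noteq> 1" by (simp add: coprime_iff_gcd_eq_1)
    then obtain p where p: "prime p" "p dvd gcd c' d'" using prime_factor_nat by blast
    then have pc: "p dvd c'" and pd: "p dvd d'" by auto
    show False
    proof (cases "p dvd N")
      case True
      then have "p dvd c" using pc by (simp add: c'_def dvd_add_left_iff)
      moreover have "p dvd d" using pd True by (simp add: d'_def dvd_add_left_iff)
      moreover have "p \<in> prime_factors N" using p True cN by (auto simp: in_prime_factors_iff)
      ultimately show False using prim by blast
    next
      case False
      show False
      proof (cases "p dvd d")
        case True
        then have "p dvd t * N" using pd by (simp add: d'_def dvd_add_right_iff)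
        then have "p dvd t" using p(1) False by (simp add: prime_dvd_mult_iff)
        then obtain p' where p': "p' \<in> prime_factors c'" "\<not> p' dvd d" "p dvd p'"
          unfolding t_def using p(1) prime_dvd_prod_iff[of "{p \<in> prime_factors c'. \<not> p dvd d}" p "\<lambda>x. x"] by auto
        then have "p = p'" using p(1) by (auto intro: primes_dvd_imp_eq)
        then show False using p' True by simp
      next
        case False
        then have "p \<in> {p \<in> prime_factors c'. \<not> p dvd d}" using p(1) pc c'0 by (auto simp: in_prime_factors_iff)
        then have "p dvd t" unfolding t_def by (intro dvd_prodI) auto
        then show False using pd False by (simp add: d'_def dvd_add_left_iff)
      qed
    qed
  qed
  then have "gcd (int d') (int c') = 1" by (simp add: coprime_iff_gcd_eq_1 gcd.commute)
  then obtain x y where xy: "x * int d' + y * int c' = 1" using bezout_int[of "int d'" "int c'"] by auto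
  have "mat2 x (- y) (int c') (int d') \<in> SL2Z" using xy by (simp add: mat2_SL2Z)
  moreover have "int N dvd int c' - int c" "int N dvd int d' - int d" by (simp_all add: c'_def d'_def)
  ultimately show ?thesis by (intro bexI[of _ "mat2 x (- y) (int c') (int d')"]) auto
qed

section \<open>The norm of a weakly reflective form\<close>

context weil_vector
begin

text \<open>The flag decides which 2-adic phenomenon can occur when 8 exactly divides N. If
  \<open>even_four_torsion\<close> fails, \<delta> is even for c = 4 modulo 8 and divisible by 4 for
  c = 2 modulo 4, whence the weights 1/2 and 1/4. If it holds, \<open>odd_two_torsion\<close> fails,
  and c = 2 modulo 4 admits no pole at all.\<close>

lemma cusp_weight_bound:
  assumes sign: "even (disc_sign q)"
    and M: "M \<in> SL2Z" and p: "p \<in> prime_factors N" and c: "int N dvd M$2$1 - int c"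
    and \<gamma>: "act v M $ \<gamma> \<noteq> 0" and \<delta>: "\<delta> dvd N" "zmul (int \<delta>) \<gamma> = 0" "eq_mod1 (q \<gamma>) (1 / of_nat \<delta>)"
  shows "1 / real p ^ multiplicity p \<delta> \<le> cusp_weight (\<not> even_four_torsion) p (multiplicity p N) c"
proof -
  define \<nu> where "\<nu> = multiplicity p N"
  have pp: "prime p" and pN: "p dvd N" using p by (auto simp: in_prime_factors_iff)
  have p1: "real p > 1" using prime_gt_1_nat[OF pp] by simp
  have d0: "\<delta> > 0" using \<delta>(1) level_pos by (metis dvd_0_left not_gr_zero)
  have \<nu>1: "\<nu> \<ge> 1" using pp pN level_pos by (simp add: \<nu>_def prime_multiplicity_gt_zero_iff Suc_le_eq)
  have dvdc: "int (p ^ i) dvd M$2$1 \<longleftrightarrow> p ^ i dvd c" if "i \<le> \<nu>" for i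
  proof -
    have "p ^ i dvd N" using that unfolding \<nu>_def by (rule multiplicity_dvd')
    then have "int (p ^ i) dvd M$2$1 - int c" using c by (meson dvd_trans int_dvd_int_iff)
    then have "int (p ^ i) dvd M$2$1 \<longleftrightarrow> int (p ^ i) dvd int c"
      using dvd_add_left_iff[of "int (p ^ i)" "M$2$1 - int c" "int c"] by (metis diff_add_cancel dvd_add_right_iff)
    then show ?thesis by (simp only: int_dvd_int_iff)
  qed
  have le: "1 / real p ^ multiplicity p \<delta> \<le> 1 / real p ^ i" if "p ^ i dvd \<delta>" for i
  proof -
    have "i \<le> multiplicity p \<delta>" using that d0 prime_gt_1_nat[OF pp] by (intro multiplicity_geI) auto
    then show ?thesis using p1 by (intro divide_left_mono power_increasing mult_pos_pos) auto
  qed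
  have le1: "1 / real p ^ multiplicity p \<delta> \<le> 1" using le[of 0] by simp
  have coprime_case: "1 / real p ^ multiplicity p \<delta> \<le> 1 / real p ^ \<nu>" if "\<not> p dvd c"
  proof -
    have "\<not> int p dvd M$2$1" using dvdc[of 1] \<nu>1 that by simp
    then have "p ^ (\<nu> - 0) dvd \<delta>" unfolding \<nu>_def
      using prime_power_dvd_of_support[OF M p, of 0 "M$2$1" \<gamma> \<delta>] \<gamma> \<delta> by simp
    then show ?thesis using le by simp
  qed
  \<comment> \<open>Let p^j divide c exactly. The cusps with 1 <= j <= \<nu> - 2 carry a pole only
    if p = 2 and j = 1, and \<open>odd_component_cusp_2\<close> then limits \<nu> to 3.\<close>
  have middle: "p = 2 \<and> \<nu> = 3 \<and> (\<exists>c'. M$2$1 = 2 * c' \<and> odd c') \<and> odd_two_torsion" if "p dvd c" "\<not> p ^ (\<nu> - 1) dvd c"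
  proof -
    have nd: "\<not> int (p ^ (\<nu> - 1)) dvd M$2$1" using dvdc[of "\<nu> - 1"] that by simp
    then have m0: "M$2$1 \<noteq> 0" by auto
    have pd: "int (p ^ 1) dvd M$2$1" using dvdc[of 1] \<nu>1 that by simp
    define j where "j = multiplicity (int p) (M$2$1)"
    have "int p ^ j dvd M$2$1" unfolding j_def by (rule multiplicity_dvd)
    then obtain c' where c': "M$2$1 = int p ^ j * c'" by blast
    have unit: "\<not> is_unit (int p)" using prime_gt_1_nat[OF pp] by simp
    have nc': "\<not> int p dvd c'"
    proof
      assume "int p dvd c'"
      then have "int p ^ Suc j dvd M$2$1" unfolding c' by (auto simp: dvd_def mult_ac)
      then have "Suc j \<le> j" unfolding j_def using m0 unit by (intro multiplicity_geI) (auto simp: j_def)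
      then show False by simp
    qed
    have j1: "j \<ge> 1" unfolding j_def using pd m0 unit by (intro multiplicity_geI) auto
    have j2: "j + 2 \<le> \<nu>"
    proof (rule ccontr)
      assume "\<not> j + 2 \<le> \<nu>"
      then have "int p ^ (\<nu> - 1) dvd int p ^ j" by (intro le_imp_power_dvd) simp
      then show False using nd unfolding c' by (simp add: dvd_mult2)
    qed
    have c'': "M$2$1 = int (p ^ j) * c'" using c' by simp
    have pj: "p = 2 \<and> j = 1"
      using middle_cusp_imp_2[OF M p c'' nc' j1 j2[unfolded \<nu>_def] \<gamma> \<delta>] .
    then have \<nu>3: "\<nu> \<ge> 3" using j2 by simp
    then have "2 ^ 3 dvd N" unfolding \<nu>_def using pj by (intro multiplicity_dvd') simp
    then have N8: "8 dvd N" by simp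
    have 2: "M$2$1 = 2 * c'" "odd c'" using c' nc' pj by auto
    have *: "\<not> 16 dvd N \<and> \<not> 8 dvd \<delta> \<and> odd_two_torsion"
      by (rule odd_component_cusp_2[OF M N8 2 \<gamma> \<delta>])
    have "\<nu> < 4"
    proof (rule ccontr)
      assume "\<not> \<nu> < 4"
      then have "2 ^ 4 dvd N" unfolding \<nu>_def using pj by (intro multiplicity_dvd') simp
      then show False using * by simp
    qed
    then show ?thesis using pj \<nu>3 2 * by auto
  qed
  show ?thesis
  proof (cases "\<not> even_four_torsion \<and> p = 2 \<and> \<nu> = 3")
    case True
    then have p2: "p = 2" and \<nu>3: "\<nu> = 3" and ne: "\<not> even_four_torsion" by auto
    have N8: "8 dvd N" using multiplicity_dvd[of p N] p2 \<nu>3 by (simp add: \<nu>_def)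
    have d2: "int 2 dvd M$2$1 \<longleftrightarrow> 2 dvd c" "int 4 dvd M$2$1 \<longleftrightarrow> 4 dvd c" "int 8 dvd M$2$1 \<longleftrightarrow> 8 dvd c"
      using dvdc[of 1] dvdc[of 2] dvdc[of 3] p2 \<nu>3 by simp_all
    have w: "cusp_weight (\<not> even_four_torsion) p \<nu> c =
      (if \<not> 2 dvd c then 1 / 8 else if \<not> 4 dvd c then 1 / 4 else if \<not> 8 dvd c then 1 / 2 else 1)"
      using ne by (simp add: cusp_weight_def p2 \<nu>3)
    consider "\<not> 2 dvd c" | "2 dvd c" "\<not> 4 dvd c" | "4 dvd c" "\<not> 8 dvd c" | "8 dvd c" by blast
    then have "1 / real p ^ multiplicity p \<delta> \<le> cusp_weight (\<not> even_four_torsion) p \<nu> c"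
    proof cases
      case 1
      then show ?thesis using coprime_case p2 \<nu>3 unfolding w by simp
    next
      case 2
      then have "2 dvd M$2$1" "\<not> 4 dvd M$2$1" using d2 by simp_all
      then obtain c' where c'1: "M$2$1 = 2 * c'" by blast
      have c'2: "odd c'" using \<open>\<not> 4 dvd M$2$1\<close> unfolding c'1 by (auto elim!: evenE)
      note c' = c'1 c'2
      have "p ^ (\<nu> - 1) dvd \<delta>" unfolding \<nu>_def
        using prime_power_dvd_of_support[OF M p, of 1 c' \<gamma> \<delta>] c' \<gamma> \<delta> \<nu>3 p2 by (simp add: \<nu>_def)
      then show ?thesis using le[of 2] 2 p2 \<nu>3 unfolding w by simp
    next
      case 3
      then have "4 dvd M$2$1" "\<not> 8 dvd M$2$1" using d2 by simp_all
      then obtain c' where c'1: "M$2$1 = 4 * c'" by blast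
      have c'2: "odd c'" using \<open>\<not> 8 dvd M$2$1\<close> unfolding c'1 by (auto elim!: evenE)
      note c' = c'1 c'2
      have "even \<delta>"
      proof (rule ccontr)
        assume "odd \<delta>"
        then have even_four_torsion using even_component_cusp_4[OF M N8 c' \<gamma> _ \<delta>(2)] by blast
        then show False using ne by blast
      qed
      moreover have "2 dvd c" using 3 by (auto intro: dvd_trans[of _ 4])
      ultimately show ?thesis using le[of 1] 3 p2 unfolding w by simp
    next
      case 4
      then have "2 dvd c" "4 dvd c" by (auto intro: dvd_trans[of _ 8])
      then show ?thesis using le1 4 unfolding w by simp
    qed
    then show ?thesis by (simp add: \<nu>_def)
  next
    case False
    have w: "cusp_weight (\<not> even_four_torsion) p \<nu> c =
        (if \<not> p dvd c then 1 / real p ^ \<nu> else if p ^ (\<nu> - 1) dvd c then 1 else 0)"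
      unfolding cusp_weight_def using False by (simp only: if_False)
    have "p ^ (\<nu> - 1) dvd c" if pc: "p dvd c"
    proof (rule ccontr)
      assume n: "\<not> p ^ (\<nu> - 1) dvd c"
      have m: "p = 2" "\<nu> = 3" odd_two_torsion using middle[OF pc n] by auto
      then have e4: even_four_torsion using False by blast
      have "2 ^ 3 dvd N" using m unfolding \<nu>_def by (intro multiplicity_dvd') simp
      moreover have "\<not> 2 ^ 4 dvd N"
      proof
        assume "2 ^ 4 dvd N"
        then have "4 \<le> multiplicity 2 N" using level_pos by (intro multiplicity_geI) auto
        then show False using m by (simp add: \<nu>_def)
      qed
      ultimately have "8 dvd N" "\<not> 16 dvd N" by auto
      then show False using odd_even_torsion_contradiction[OF sign _ _ m(3) e4] by blast
    qed
    then show ?thesis using coprime_case le1 w by (auto simp: \<nu>_def)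
  qed
qed

end

section \<open>The functions <v|M, F> and their product\<close>

locale reflective_form = weil_vector q \<rho> \<mu> for q :: "'a::{ab_group_add,finite} \<Rightarrow> rat" and \<rho> \<mu> +
  fixes k :: int and F :: "complex \<Rightarrow> complex^('a::{ab_group_add,finite})"
  assumes sign: "even (disc_sign q)"
    and reflective: "weakly_reflective q \<rho> k F"
    and pole0: "pole_at_infinity (level q) (\<lambda>\<tau>. F \<tau> $ 0)"
begin

lemma F_holomorphic: "(\<lambda>\<tau>. F \<tau> $ g) holomorphic_on upper_half_plane"
  using reflective by (auto simp: weakly_reflective_def modular_form_def)

lemma F_mobius: "M \<in> SL2Z \<Longrightarrow> Im \<tau> > 0 \<Longrightarrow> F (mobius M \<tau>) = (autfactor M \<tau> powi k) *s (\<rho> M *v F \<tau>)"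
  using reflective by (auto simp: weakly_reflective_def modular_form_def upper_half_plane_def)

definition singular_of :: "'a \<Rightarrow> nat \<Rightarrow> bool" where
  "singular_of g \<delta> \<longleftrightarrow> \<delta> dvd N \<and> zmul (int \<delta>) g = 0 \<and> eq_mod1 (q g) (1 / of_nat \<delta>)"

text \<open>The pole condition in terms of growth. A component without a pole is bounded, because
  none of its expansions has a negative exponent.\<close>

lemma F_growth:
  "(\<exists>C. \<forall>\<tau>. Im \<tau> \<ge> 1 \<longrightarrow> cmod (F \<tau> $ g) \<le> C) \<or>
   (\<exists>\<delta> C. singular_of g \<delta> \<and> (\<forall>\<tau>. Im \<tau> \<ge> 1 \<longrightarrow> cmod (F \<tau> $ g) \<le> C * exp (2 * pi * (1 / real \<delta>) * Im \<tau>)))"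
proof (cases "pole_at_infinity N (\<lambda>\<tau>. F \<tau> $ g)")
  case True
  then obtain d a where d: "d dvd N" "g \<in> mult_kernel_norm q (int d) (1 / of_nat d)"
      "q_expansion N (\<lambda>\<tau>. F \<tau> $ g) a" "\<forall>m < - int (N div d). a m = 0"
    using reflective by (auto simp: weakly_reflective_def)
  obtain C where C: "\<And>\<tau>. Im \<tau> \<ge> 1 \<Longrightarrow> cmod (F \<tau> $ g) \<le> C * exp (2 * pi * (of_int (int (N div d)) / of_nat N) * Im \<tau>)"
    using q_expansion_bound[OF d(3) level_pos, of "int (N div d)"] d(4) by blast
  obtain e where e: "N = d * e" using d(1) by blast
  then have "of_int (int (N div d)) / of_nat N = 1 / real d" using level_pos by auto
  then have "\<forall>\<tau>. Im \<tau> \<ge> 1 \<longrightarrow> cmod (F \<tau> $ g) \<le> C * exp (2 * pi * (1 / real d) * Im \<tau>)" using C by simp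
  moreover have "singular_of g d" using d(1,2) by (simp add: singular_of_def mult_kernel_norm_def mult_kernel_def)
  ultimately show ?thesis by blast
next
  case False
  have "\<exists>a. q_expansion N (\<lambda>\<tau>. F \<tau> $ g) a"
    using reflective unfolding weakly_reflective_def modular_form_def by blast
  then obtain a where a: "q_expansion N (\<lambda>\<tau>. F \<tau> $ g) a" by blast
  then have "a m = 0" if "m < - 0" for m using False that unfolding pole_at_infinity_def by auto
  then have "\<exists>C. \<forall>\<tau>. Im \<tau> \<ge> 1 \<longrightarrow> cmod (F \<tau> $ g) \<le> C * exp (2 * pi * (of_int 0 / of_nat N) * Im \<tau>)"
    by (intro q_expansion_bound[OF a level_pos])
  then show ?thesis by simp
qed

definition fM :: "int^2^2 \<Rightarrow> complex \<Rightarrow> complex" where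
  "fM M \<tau> = (\<Sum>g\<in>UNIV. act v M $ g * F \<tau> $ g)"

lemma fM_holomorphic: "fM M holomorphic_on upper_half_plane"
  unfolding fM_def by (intro holomorphic_intros F_holomorphic)

lemma fM_mobius:
  assumes "M \<in> SL2Z" "L \<in> SL2Z" "Im \<tau> > 0"
  shows "fM M (mobius L \<tau>) = autfactor L \<tau> powi k * fM (M ** L) \<tau>"
proof -
  have "fM (M ** L) \<tau> = (\<Sum>j\<in>UNIV. (\<Sum>i\<in>UNIV. \<rho> L $ i $ j * act v M $ i) * F \<tau> $ j)"
    unfolding fM_def act_mult[OF assms(1,2)] by (simp add: act_def[of "act v M"] vector_matrix_mult_def mult.commute)
  also have "\<dots> = (\<Sum>i\<in>UNIV. act v M $ i * (\<Sum>j\<in>UNIV. \<rho> L $ i $ j * F \<tau> $ j))"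
    unfolding sum_distrib_right sum_distrib_left by (subst sum.swap) (simp add: mult_ac)
  also have "\<dots> = (\<Sum>i\<in>UNIV. act v M $ i * (\<rho> L *v F \<tau>) $ i)" by (simp add: matrix_vector_mult_def)
  finally show ?thesis
    unfolding fM_def F_mobius[OF assms(2,3)] by (simp add: sum_distrib_left mult_ac)
qed

lemma fM_cong:
  assumes "M \<in> SL2Z" "M' \<in> SL2Z" "int N dvd M$2$1 - M'$2$1" "int N dvd M$2$2 - M'$2$2"
  shows "cmod (fM M \<tau>) = cmod (fM M' \<tau>)"
proof -
  obtain \<omega> where w: "cmod \<omega> = 1" "act v M = \<omega> *s act v M'" using act_v_cong[OF assms] by blast
  then have "fM M \<tau> = \<omega> * fM M' \<tau>" by (simp add: fM_def sum_distrib_left mult_ac)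
  then show ?thesis using w by (simp add: norm_mult)
qed

lemma fM_growth:
  assumes E: "E \<ge> 0" and sing: "\<And>g \<delta>. act v M $ g \<noteq> 0 \<Longrightarrow> singular_of g \<delta> \<Longrightarrow> 1 / real \<delta> \<le> E"
  shows "\<exists>C. \<forall>\<tau>. Im \<tau> \<ge> 1 \<longrightarrow> cmod (fM M \<tau>) \<le> C * exp (2 * pi * E * Im \<tau>)"
proof -
  have "\<exists>C. \<forall>\<tau>. Im \<tau> \<ge> 1 \<longrightarrow> cmod (act v M $ g * F \<tau> $ g) \<le> C * exp (2 * pi * E * Im \<tau>)" for g
  proof (cases "act v M $ g = 0")
    case True
    then show ?thesis by (intro exI[of _ 0]) simp
  next
    case False
    have gen: ?thesis if e: "0 \<le> e" "e \<le> E" and C: "\<forall>\<tau>. Im \<tau> \<ge> 1 \<longrightarrow> cmod (F \<tau> $ g) \<le> C * exp (2 * pi * e * Im \<tau>)" for e C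
    proof (intro exI allI impI)
      fix \<tau> assume t: "Im \<tau> \<ge> 1"
      have "C * exp (2 * pi * e * Im \<tau>) \<ge> 0" using C[rule_format, OF t] norm_ge_zero order_trans by blast
      then have C0: "C \<ge> 0" by (simp add: zero_le_mult_iff)
      have "cmod (F \<tau> $ g) \<le> C * exp (2 * pi * e * Im \<tau>)" using C t by blast
      also have "\<dots> \<le> C * exp (2 * pi * E * Im \<tau>)" using C0 e t by (intro mult_left_mono) auto
      finally show "cmod (act v M $ g * F \<tau> $ g) \<le> (cmod (act v M $ g) * C) * exp (2 * pi * E * Im \<tau>)"
        unfolding norm_mult mult.assoc by (intro mult_left_mono) auto
    qed
    from F_growth[of g] show ?thesis
    proof
      assume "\<exists>C. \<forall>\<tau>. Im \<tau> \<ge> 1 \<longrightarrow> cmod (F \<tau> $ g) \<le> C"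
      then obtain C where "\<forall>\<tau>. Im \<tau> \<ge> 1 \<longrightarrow> cmod (F \<tau> $ g) \<le> C" by blast
      then show ?thesis using gen[of 0 C] E by simp
    next
      assume "\<exists>\<delta> C. singular_of g \<delta> \<and> (\<forall>\<tau>. Im \<tau> \<ge> 1 \<longrightarrow> cmod (F \<tau> $ g) \<le> C * exp (2 * pi * (1 / real \<delta>) * Im \<tau>))"
      then obtain \<delta> C where "singular_of g \<delta>" "\<forall>\<tau>. Im \<tau> \<ge> 1 \<longrightarrow> cmod (F \<tau> $ g) \<le> C * exp (2 * pi * (1 / real \<delta>) * Im \<tau>)" by blast
      then show ?thesis using gen[of "1 / real \<delta>" C] sing[OF False] by simp
    qed
  qed
  then obtain C where C: "\<And>g \<tau>. Im \<tau> \<ge> 1 \<Longrightarrow> cmod (act v M $ g * F \<tau> $ g) \<le> C g * exp (2 * pi * E * Im \<tau>)" by metis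
  have "cmod (fM M \<tau>) \<le> (\<Sum>g\<in>UNIV. C g) * exp (2 * pi * E * Im \<tau>)" if "Im \<tau> \<ge> 1" for \<tau>
    unfolding fM_def sum_distrib_right using C[OF that] by (intro sum_norm_le) auto
  then show ?thesis by blast
qed

text \<open>Otherwise F_0 would be a combination of components F_g with g a non-zero multiple of
  \<kappa>. Such g is isotropic, so a pole would require 1/\<delta> to be integral, hence \<delta> =
  1 and g = 0. These components are therefore bounded, but F_0 is not.\<close>

lemma fM_1_nonzero: "\<exists>\<tau>\<in>upper_half_plane. fM (mat 1) \<tau> \<noteq> 0"
proof (rule ccontr)
  assume "\<not> ?thesis"
  then have 0: "fM (mat 1) \<tau> = 0" if "Im \<tau> \<ge> 1" for \<tau> using that by (auto simp: upper_half_plane_def)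
  have bdd: "\<exists>C. \<forall>\<tau>. Im \<tau> \<ge> 1 \<longrightarrow> cmod (v $ g * F \<tau> $ g) \<le> C" if g: "g \<noteq> 0" for g
  proof (cases "v $ g = 0")
    case True
    then show ?thesis by (intro exI[of _ 0]) simp
  next
    case False
    then obtain n where "g = zmul n \<kappa>" using v_support by blast
    then have qg: "q g \<in> \<int>" using q_zmul_kappa by simp
    have "\<not> singular_of g \<delta>" for \<delta>
    proof
      assume s: "singular_of g \<delta>"
      then have "1 / of_nat \<delta> \<in> (\<int> :: rat set)" using qg eq_mod1_Ints_iff by (auto simp: singular_of_def)
      then obtain z where z: "1 / of_nat \<delta> = (of_int z :: rat)" by (auto elim: Ints_cases)
      have "\<delta> > 0" using s level_pos by (auto simp: singular_of_def intro: Nat.gr0I)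
      then have "(1::rat) = of_int (z * int \<delta>)" using z by (simp add: field_simps)
      then have "1 = z * int \<delta>" by (metis of_int_1 of_int_eq_iff)
      then have "int \<delta> dvd 1" by (metis dvd_triv_right)
      then have "\<delta> = 1" by simp
      then show False using s g by (simp add: singular_of_def)
    qed
    then obtain C where "\<forall>\<tau>. Im \<tau> \<ge> 1 \<longrightarrow> cmod (F \<tau> $ g) \<le> C" using F_growth[of g] by blast
    then show ?thesis by (intro exI[of _ "cmod (v $ g) * C"]) (simp add: norm_mult mult_left_mono)
  qed
  then obtain C where C: "\<And>g \<tau>. g \<noteq> 0 \<Longrightarrow> Im \<tau> \<ge> 1 \<Longrightarrow> cmod (v $ g * F \<tau> $ g) \<le> C g" by metis
  define B where "B = (\<Sum>g\<in>UNIV - {0}. C g) / cmod (v $ 0)"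
  have "cmod (F \<tau> $ 0) \<le> B" if t: "Im \<tau> \<ge> 1" for \<tau>
  proof -
    have "v $ 0 * F \<tau> $ 0 + (\<Sum>g\<in>UNIV - {0}. v $ g * F \<tau> $ g) = 0"
      using 0[OF t] unfolding fM_def act_1 by (subst (asm) sum.remove[of _ 0]) auto
    then have "cmod (v $ 0 * F \<tau> $ 0) = cmod (\<Sum>g\<in>UNIV - {0}. v $ g * F \<tau> $ g)"
      by (metis add_eq_0_iff norm_minus_cancel)
    also have "\<dots> \<le> (\<Sum>g\<in>UNIV - {0}. C g)" using C t by (intro sum_norm_le) auto
    finally show ?thesis using v_0_nonzero unfolding B_def norm_mult by (simp add: pos_le_divide_eq mult.commute)
  qed
  moreover obtain a m where "q_expansion N (\<lambda>\<tau>. F \<tau> $ 0) a" "m < 0" "a m \<noteq> 0"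
    using pole0 by (auto simp: pole_at_infinity_def)
  ultimately show False using q_expansion_pole_unbounded[OF _ level_pos, of "\<lambda>\<tau>. F \<tau> $ 0" a m B] by blast
qed

text \<open>The inverse of M carries the function for M back to the one for the identity, up to an
  automorphy factor without zeros.\<close>

lemma fM_nonzero:
  assumes "M \<in> SL2Z"
  shows "\<exists>\<tau>\<in>upper_half_plane. fM M \<tau> \<noteq> 0"
proof -
  obtain \<tau> where t: "Im \<tau> > 0" "fM (mat 1) \<tau> \<noteq> 0" using fM_1_nonzero by (auto simp: upper_half_plane_def)
  obtain a b c d where M: "M = mat2 a b c d" using mat2_eta by blast
  define L where "L = mat2 d (- b) (- c) a"
  have det: "a * d - b * c = 1" using assms by (simp add: M mat2_SL2Z)
  have L: "L \<in> SL2Z" using det by (simp add: L_def mat2_SL2Z algebra_simps)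
  have "M ** L = mat 1" using det by (simp add: M L_def mat2_mult mat_1_eq algebra_simps)
  then have "fM M (mobius L \<tau>) = autfactor L \<tau> powi k * fM (mat 1) \<tau>" using fM_mobius[OF assms L t(1)] by simp
  then have "fM M (mobius L \<tau>) \<noteq> 0" using t(2) autfactor_nonzero[OF L t(1)] by simp
  then show ?thesis using Im_mobius[OF L t(1)] by (auto simp: upper_half_plane_def)
qed

theorem valence_bound:
  "- real_of_int k / 12 * real (card (primitive_pairs N)) \<le>
     (\<Sum>(c, d)\<in>primitive_pairs N. \<Prod>p\<in>prime_factors N. cusp_weight (\<not> even_four_torsion) p (multiplicity p N) c)"
proof -
  define Y where "Y = primitive_pairs N"
  have finY: "finite Y" by (simp add: Y_def finite_primitive_pairs)
  have "\<forall>y\<in>Y. \<exists>M\<in>SL2Z. int N dvd M$2$1 - int (fst y) \<and> int N dvd M$2$2 - int (snd y)"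
    using primitive_pair_lift by (auto simp: Y_def)
  then obtain m where m: "\<And>y. y \<in> Y \<Longrightarrow> m y \<in> SL2Z"
    "\<And>y. y \<in> Y \<Longrightarrow> int N dvd m y $2$1 - int (fst y)" "\<And>y. y \<in> Y \<Longrightarrow> int N dvd m y $2$2 - int (snd y)" by metis
  \<comment> \<open>As \<delta> divides N, 1/\<delta> is the product over the primes of N of its
    p-parts, so the local bounds multiply to a bound for the pole order at the cusp of
    \<open>y\<close>.\<close>
  define e where "e y = (\<Prod>p\<in>prime_factors N. cusp_weight (\<not> even_four_torsion) p (multiplicity p N) (fst y))" for y :: "nat \<times> nat"
  have e0: "e y \<ge> 0" for y unfolding e_def by (intro prod_nonneg) (simp add: cusp_weight_nonneg)
  have "\<exists>C. \<forall>\<tau>. Im \<tau> \<ge> 1 \<longrightarrow> cmod (fM (m y) \<tau>) \<le> C * exp (2 * pi * e y * Im \<tau>)" if y: "y \<in> Y" for y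
  proof (rule fM_growth[OF e0])
    fix g \<delta> assume g: "act v (m y) $ g \<noteq> 0" and s: "singular_of g \<delta>"
    have d0: "\<delta> > 0" using s level_pos by (auto simp: singular_of_def intro: Nat.gr0I)
    have "real \<delta> = (\<Prod>p\<in>prime_factors N. real p ^ multiplicity p \<delta>)"
    proof -
      have "\<delta> = (\<Prod>p\<in>prime_factors \<delta>. p ^ multiplicity p \<delta>)" using d0 by (simp add: prod_prime_factors)
      also have "\<dots> = (\<Prod>p\<in>prime_factors N. p ^ multiplicity p \<delta>)"
        using s level_pos d0 by (intro prod.mono_neutral_left)
          (auto simp: singular_of_def in_prime_factors_iff not_dvd_imp_multiplicity_0 intro: dvd_trans)
      finally show ?thesis by (metis (no_types, lifting) of_nat_power of_nat_prod prod.cong)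
    qed
    then have "1 / real \<delta> = (\<Prod>p\<in>prime_factors N. 1 / real p ^ multiplicity p \<delta>)" by (simp add: prod_dividef)
    also have "\<dots> \<le> e y" unfolding e_def
      using cusp_weight_bound[OF sign m(1)[OF y] _ m(2)[OF y] g] s
      by (intro prod_mono) (auto simp: singular_of_def)
    finally show "1 / real \<delta> \<le> e y" .
  qed
  then obtain C where C: "\<And>y \<tau>. y \<in> Y \<Longrightarrow> Im \<tau> \<ge> 1 \<Longrightarrow> cmod (fM (m y) \<tau>) \<le> C y * exp (2 * pi * e y * Im \<tau>)" by metis
  define G where "G \<tau> = (\<Prod>y\<in>Y. fM (m y) \<tau>)" for \<tau>
  define K where "K = k * int (card Y)"

  \<comment> \<open>\<sigma> is right multiplication by L on pairs modulo N. The matrices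
    \<open>m y ** L\<close> and \<open>m (\<sigma> y)\<close> have the same lower row modulo N, so
    their functions have the same modulus, and the product is merely reordered.\<close>
  have perm: "cmod (\<Prod>y\<in>Y. fM (m y) (mobius L \<tau>)) = cmod (autfactor L \<tau>) powi K * cmod (G \<tau>)"
    if L: "L \<in> SL2Z" and t: "Im \<tau> > 0" and \<sigma>: "inj_on \<sigma> Y" "\<sigma> ` Y \<subseteq> Y"
      and \<sigma>1: "\<And>y. y \<in> Y \<Longrightarrow> int N dvd (int (fst y) * L$1$1 + int (snd y) * L$2$1) - int (fst (\<sigma> y))"
      and \<sigma>2: "\<And>y. y \<in> Y \<Longrightarrow> int N dvd (int (fst y) * L$1$2 + int (snd y) * L$2$2) - int (snd (\<sigma> y))"
    for L \<tau> \<sigma>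
  proof -
    have bij: "bij_betw \<sigma> Y Y" using \<sigma> finY by (simp add: bij_betw_def endo_inj_surj)
    have row: "(m y ** L) $ 2 $ i = m y $ 2 $ 1 * L $ 1 $ i + m y $ 2 $ 2 * L $ 2 $ i" for y i
      by (simp add: matrix_matrix_mult_def sum_2)
    have eq: "cmod (fM (m y ** L) \<tau>) = cmod (fM (m (\<sigma> y)) \<tau>)" if y: "y \<in> Y" for y
    proof (rule fM_cong)
      have sy: "\<sigma> y \<in> Y" using \<sigma> y by blast
      show "m y ** L \<in> SL2Z" "m (\<sigma> y) \<in> SL2Z" using SL2Z_mult[OF m(1)[OF y] L] m(1)[OF sy] .
      have dv: "int N dvd (m y $2$1 - int (fst y)) * a + (m y $2$2 - int (snd y)) * b + x - (z - w)"
        if "int N dvd x" "int N dvd z - w" for a b x z w using m(2,3)[OF y] that by (auto intro!: dvd_add dvd_diff)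
      have row1: "(m y ** L) $ 2 $ 1 - m (\<sigma> y) $ 2 $ 1 = (m y $2$1 - int (fst y)) * L$1$1 + (m y $2$2 - int (snd y)) * L$2$1
         + ((int (fst y) * L$1$1 + int (snd y) * L$2$1) - int (fst (\<sigma> y))) - (m (\<sigma> y) $2$1 - int (fst (\<sigma> y)))"
        unfolding row by (simp add: algebra_simps)
      show "int N dvd (m y ** L) $ 2 $ 1 - m (\<sigma> y) $ 2 $ 1"
        unfolding row1 by (rule dv[OF \<sigma>1[OF y] m(2)[OF sy]])
      have row2: "(m y ** L) $ 2 $ 2 - m (\<sigma> y) $ 2 $ 2 = (m y $2$1 - int (fst y)) * L$1$2 + (m y $2$2 - int (snd y)) * L$2$2
         + ((int (fst y) * L$1$2 + int (snd y) * L$2$2) - int (snd (\<sigma> y))) - (m (\<sigma> y) $2$2 - int (snd (\<sigma> y)))"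
        unfolding row by (simp add: algebra_simps)
      show "int N dvd (m y ** L) $ 2 $ 2 - m (\<sigma> y) $ 2 $ 2"
        unfolding row2 by (rule dv[OF \<sigma>2[OF y] m(3)[OF sy]])
    qed
    have fac: "cmod (fM (m y) (mobius L \<tau>)) = cmod (autfactor L \<tau>) powi k * cmod (fM (m (\<sigma> y)) \<tau>)" if y: "y \<in> Y" for y
      unfolding fM_mobius[OF m(1)[OF y] L t] norm_mult norm_power_int eq[OF y] ..
    have "cmod (\<Prod>y\<in>Y. fM (m y) (mobius L \<tau>)) = (\<Prod>y\<in>Y. cmod (autfactor L \<tau>) powi k * cmod (fM (m (\<sigma> y)) \<tau>))"
      unfolding prod_norm[symmetric] by (rule prod.cong[OF refl fac])
    also have "\<dots> = (cmod (autfactor L \<tau>) powi k) ^ card Y * (\<Prod>y\<in>Y. cmod (fM (m (\<sigma> y)) \<tau>))"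
      by (simp add: prod.distrib)
    also have "(\<Prod>y\<in>Y. cmod (fM (m (\<sigma> y)) \<tau>)) = (\<Prod>y\<in>Y. cmod (fM (m y) \<tau>))"
      using prod.reindex_bij_betw[OF bij, of "\<lambda>y. cmod (fM (m y) \<tau>)"] .
    finally show ?thesis by (simp add: G_def K_def prod_norm power_int_mult)
  qed

  have "- real_of_int K / 12 \<le> sum e Y"
  proof -
    have hol: "G holomorphic_on upper_half_plane" unfolding G_def by (intro holomorphic_on_prod fM_holomorphic)
    have "\<exists>\<tau>\<in>upper_half_plane. G \<tau> \<noteq> 0" unfolding G_def
    proof (rule prod_holomorphic_nonzero[OF finY])
      show "fM (m y) holomorphic_on upper_half_plane" for y by (rule fM_holomorphic)
      show "\<exists>z\<in>upper_half_plane. fM (m y) z \<noteq> 0" if "y \<in> Y" for y using fM_nonzero m(1) that by blast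
      show "connected upper_half_plane" by (simp add: convex_connected convex_upper_half_plane)
      show "upper_half_plane \<noteq> {}" by (auto simp: upper_half_plane_def intro: exI[of _ \<i>])
    qed (rule open_upper_half_plane)
    then obtain \<tau>1 where t1: "Im \<tau>1 > 0" "G \<tau>1 \<noteq> 0" by (auto simp: upper_half_plane_def)
    have pdvd: "p dvd N" if "p \<in> prime_factors N" for p using that by auto
    have N0: "N > 0" by (rule level_pos)
    show ?thesis
    proof (rule valence_inequality[OF hol _ _ _ _ t1])
      show "cmod (G (\<tau> + 1)) = cmod (G \<tau>)" if t: "Im \<tau> > 0" for \<tau>
      proof -
        have "cmod (\<Prod>y\<in>Y. fM (m y) (mobius T_mat \<tau>)) = cmod (autfactor T_mat \<tau>) powi K * cmod (G \<tau>)"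
        proof (rule perm[OF T_mat_SL2Z t, where \<sigma> = "\<lambda>y. (fst y, (fst y + snd y) mod N)"])
          show "inj_on (\<lambda>y. (fst y, (fst y + snd y) mod N)) Y"
          proof (rule inj_onI)
            fix y z assume yz: "y \<in> Y" "z \<in> Y" "(fst y, (fst y + snd y) mod N) = (fst z, (fst z + snd z) mod N)"
            then have f: "fst y = fst z" and "[fst y + snd y = fst y + snd z] (mod N)" by (auto simp: cong_def)
            then have "[snd y = snd z] (mod N)" by (simp add: cong_add_lcancel_nat)
            moreover have "snd y < N" "snd z < N" using yz by (auto simp: Y_def primitive_pairs_def)
            ultimately have "snd y = snd z" by (simp add: cong_def)
            then show "y = z" using f by (simp add: prod_eq_iff)
          qed
          show "(\<lambda>y. (fst y, (fst y + snd y) mod N)) ` Y \<subseteq> Y"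
            using N0 pdvd by (auto simp: Y_def primitive_pairs_def dvd_mod_iff) (metis dvd_add_right_iff)
          show "int N dvd int (fst y) * T_mat$1$1 + int (snd y) * T_mat$2$1 - int (fst (fst y, (fst y + snd y) mod N))" for y :: "nat \<times> nat"
            by (simp add: T_mat_eq)
          show "int N dvd int (fst y) * T_mat$1$2 + int (snd y) * T_mat$2$2 - int (snd (fst y, (fst y + snd y) mod N))" for y :: "nat \<times> nat"
            by (simp add: T_mat_eq zmod_int)
        qed
        moreover have "mobius T_mat \<tau> = \<tau> + 1" "autfactor T_mat \<tau> = 1" by (simp_all add: mobius_def autfactor_def T_mat_eq)
        ultimately show ?thesis by (simp add: G_def)
      qed
      show "cmod (G (- 1 / \<tau>)) = cmod \<tau> powi K * cmod (G \<tau>)" if t: "Im \<tau> > 0" for \<tau>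
      proof -
        have "cmod (\<Prod>y\<in>Y. fM (m y) (mobius S_mat \<tau>)) = cmod (autfactor S_mat \<tau>) powi K * cmod (G \<tau>)"
        proof (rule perm[OF S_mat_SL2Z t, where \<sigma> = "\<lambda>y. (snd y, (N - fst y) mod N)"])
          show "inj_on (\<lambda>y. (snd y, (N - fst y) mod N)) Y"
          proof (rule inj_onI)
            fix y z assume yz: "y \<in> Y" "z \<in> Y" "(snd y, (N - fst y) mod N) = (snd z, (N - fst z) mod N)"
            then have s: "snd y = snd z" and c: "(N - fst y) mod N = (N - fst z) mod N" by auto
            have lt: "fst y < N" "fst z < N" using yz by (auto simp: Y_def primitive_pairs_def)
            then have "fst y = fst z" using c by (cases "fst y = 0"; cases "fst z = 0") auto
            then show "y = z" using s by (simp add: prod_eq_iff)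
          qed
          show "(\<lambda>y. (snd y, (N - fst y) mod N)) ` Y \<subseteq> Y"
          proof clarify
            fix c d assume cd: "(c, d) \<in> Y"
            have "p dvd (N - c) mod N \<longleftrightarrow> p dvd c" if "p \<in> prime_factors N" for p
              using cd pdvd[OF that] by (simp add: Y_def primitive_pairs_def dvd_mod_iff) (metis dvd_diff_nat diff_diff_cancel less_imp_le_nat)
            then show "(snd (c, d), (N - fst (c, d)) mod N) \<in> Y"
              using cd N0 by (auto simp: Y_def primitive_pairs_def)
          qed
          show "int N dvd int (fst y) * S_mat$1$1 + int (snd y) * S_mat$2$1 - int (fst (snd y, (N - fst y) mod N))" for y :: "nat \<times> nat"
            by (simp add: S_mat_eq)
          show "int N dvd int (fst y) * S_mat$1$2 + int (snd y) * S_mat$2$2 - int (snd (snd y, (N - fst y) mod N))" if "y \<in> Y" for y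
          proof -
            have "fst y < N" using that by (auto simp: Y_def primitive_pairs_def)
            then have "int ((N - fst y) mod N) = (int N - int (fst y)) mod int N" by (simp add: zmod_int of_nat_diff)
            moreover have "int N dvd - int (fst y) - (int N - int (fst y)) mod int N"
              by (simp add: mod_eq_dvd_iff[symmetric])
            ultimately show ?thesis by (simp add: S_mat_eq)
          qed
        qed
        moreover have "mobius S_mat \<tau> = - 1 / \<tau>" "autfactor S_mat \<tau> = \<tau>" by (simp_all add: mobius_def autfactor_def S_mat_eq)
        ultimately show ?thesis by (simp add: G_def)
      qed
      show "cmod (G \<tau>) \<le> (\<Prod>y\<in>Y. C y) * exp (2 * pi * sum e Y * Im \<tau>)" if t: "Im \<tau> \<ge> 1" for \<tau>
      proof -
        have "cmod (G \<tau>) \<le> (\<Prod>y\<in>Y. C y * exp (2 * pi * e y * Im \<tau>))"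
          unfolding G_def prod_norm[symmetric] using C t by (intro prod_mono) auto
        also have "\<dots> = (\<Prod>y\<in>Y. C y) * exp (2 * pi * sum e Y * Im \<tau>)"
          using finY by (simp add: prod.distrib sum_distrib_left sum_distrib_right flip: exp_sum)
        finally show ?thesis .
      qed
      show "sum e Y \<ge> 0" using e0 by (intro sum_nonneg) auto
    qed
  qed
  then show ?thesis by (simp add: K_def Y_def e_def case_prod_unfold)
qed

end

section \<open>Isotropic elements from regularity\<close>

context disc_form
begin

lemma q_sum_isotropic:
  assumes "finite A" "\<And>x. x \<in> A \<Longrightarrow> q (f x) \<in> \<int>"
    and "\<And>x y. x \<in> A \<Longrightarrow> y \<in> A \<Longrightarrow> x \<noteq> y \<Longrightarrow> bl (f x) (f y) \<in> \<int>"
  shows "q (sum f A) \<in> \<int>"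
  using assms
proof (induction A)
  case empty
  then show ?case using q_0 by simp
next
  case (insert x A)
  note pair = insert.prems(2)[of x] and new = insert.hyps(2)
  have "bl (f x) (sum f B) \<in> \<int>" if "finite B" "B \<subseteq> A" for B
    using that
  proof (induction B)
    case empty
    show ?case using bl_0_left[of "f x"] by (simp add: bl_commute[of "f x" 0])
  next
    case (insert y B)
    have "bl (f x) (f y) \<in> \<int>" using insert.prems new by (intro pair) auto
    then show ?case using insert eq_mod1_Ints_iff[OF bl_add_right[of "f x" "f y" "sum f B"]] by simp
  qed
  then have "bl (f x) (sum f A) \<in> \<int>" using insert.hyps by blast
  moreover have "q (sum f A) \<in> \<int>" using insert by auto
  moreover have "q (f x) \<in> \<int>" using insert by auto
  ultimately show ?case using insert.hyps by (simp add: q_add)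
qed

text \<open>Regularity supplies for each p separately an x_p with (N/p) x_p non-zero and isotropic.
  Multiplying x_p by the prime-to-p part c_p of N moves it into the p-primary part of D, so the
  summands of \<mu> do not interfere: (N/p)\<mu> is c_p (N/p) x_p, and c_p is prime to p.\<close>

lemma exists_full_order_element:
  assumes "regular_form q"
  shows "\<exists>\<mu>. (\<forall>p\<in>prime_factors N. zmul (int (N div p)) \<mu> \<noteq> 0) \<and>
    q (zmul (int (N div \<Prod>(prime_factors N))) \<mu>) \<in> \<int>"
proof -
  let ?A = "prime_factors N"
  define r where "r = \<Prod>?A"
  have "\<exists>x. zmul (int (N div p)) x \<noteq> 0 \<and> q (zmul (int (N div p)) x) \<in> \<int>" if "p \<in> ?A" for p
    using assms that by (auto simp: regular_form_def mult_image_def eq_mod1_0_iff)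
  then obtain x where x: "\<And>p. p \<in> ?A \<Longrightarrow> zmul (int (N div p)) (x p) \<noteq> 0"
      "\<And>p. p \<in> ?A \<Longrightarrow> q (zmul (int (N div p)) (x p)) \<in> \<int>" by metis
  define P where "P p = p ^ multiplicity p N" for p
  define c where "c p = N div P p" for p
  have Nc: "N = P p * c p" for p unfolding c_def P_def using multiplicity_dvd[of p N] by simp
  have pr: "prime p" if "p \<in> ?A" for p using that by auto
  have ppos: "p > 0" if "p \<in> ?A" for p using pr[OF that] prime_gt_0_nat by blast
  have pP: "p dvd P p" if "p \<in> ?A" for p
    using that level_pos unfolding P_def by (auto simp: in_prime_factors_iff prime_multiplicity_gt_zero_iff)
  have ncp: "\<not> p dvd c p" if "p \<in> ?A" for p
    using multiplicity_decompose[of N p] pr[OF that] level_pos unfolding c_def P_def by (metis not_gr_zero not_prime_unit)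
  have dvdc: "P p' dvd c p" if "p \<in> ?A" "p' \<in> ?A" "p \<noteq> p'" for p p'
  proof -
    have "coprime (P p') (P p)" unfolding P_def using pr that by (simp add: primes_coprime)
    moreover have "P p' dvd P p * c p" using Nc[of p] Nc[of p'] by (metis dvd_triv_left)
    ultimately show ?thesis by (simp add: coprime_dvd_mult_right_iff)
  qed
  define \<mu> where "\<mu> = (\<Sum>p\<in>?A. zmul (int (c p)) (x p))"
  have "zmul (int (N div p)) \<mu> \<noteq> 0" if p: "p \<in> ?A" for p
  proof -
    have other: "zmul (int (N div p)) (zmul (int (c p')) (x p')) = 0" if p': "p' \<in> ?A" "p' \<noteq> p" for p'
    proof -
      obtain e where e: "N = p * e" using p by (auto simp: in_prime_factors_iff)
      have "p dvd c p'" using dvdc[OF p'(1) p] p'(2) pP[OF p] dvd_trans by blast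
      then obtain u where u: "c p' = p * u" by blast
      have "(N div p) * c p' = N * u" using e u ppos[OF p] by simp
      then have "int (N div p) * int (c p') = int N * int u" by (metis of_nat_mult)
      then show ?thesis unfolding zmul_mult[symmetric] by (simp add: zmul_level_dvd)
    qed
    have "zmul (int (N div p)) \<mu> = (\<Sum>p'\<in>?A. zmul (int (N div p)) (zmul (int (c p')) (x p')))"
      by (simp add: \<mu>_def zmul_sum_right)
    also have "\<dots> = zmul (int (N div p)) (zmul (int (c p)) (x p))"
      using p other by (subst sum.remove[of _ p]) (auto intro: sum.neutral)
    also have "\<dots> = zmul (int (c p)) (zmul (int (N div p)) (x p))"
      by (simp add: mult.commute flip: zmul_mult)
    finally have eq: "zmul (int (N div p)) \<mu> = zmul (int (c p)) (zmul (int (N div p)) (x p))" .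
    show ?thesis
    proof
      assume "zmul (int (N div p)) \<mu> = 0"
      then have 1: "zmul (int (c p)) (zmul (int (N div p)) (x p)) = 0" using eq by simp
      have "int p * int (N div p) = int N" using p by (auto simp: in_prime_factors_iff simp flip: of_nat_mult)
      then have 2: "zmul (int p) (zmul (int (N div p)) (x p)) = 0"
        unfolding zmul_mult[symmetric] by (simp add: level_zmul)
      have "coprime (c p) p" using ncp[OF p] pr[OF p] by (metis coprime_commute prime_imp_coprime)
      then have "gcd (int (c p)) (int p) = 1" by (simp add: coprime_iff_gcd_eq_1)
      then show False using zmul_gcd_eq_0[OF 1 2] x(1)[OF p] by simp
    qed
  qed
  moreover have "q (zmul (int (N div r)) \<mu>) \<in> \<int>"
  proof -
    \<comment> \<open>The summand y_p of (N/r)\<mu> is a multiple of (N/p) x_p, hence isotropic.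
      Different summands are killed by different primes, hence orthogonal.\<close>
    define y where "y p = zmul (int (N div r)) (zmul (int (c p)) (x p))" for p
    have r0: "r > 0" unfolding r_def using ppos by (intro prod_pos) auto
    have rsplit: "r = p * \<Prod>(?A - {p})" if "p \<in> ?A" for p
      unfolding r_def using that by (subst prod.remove[of _ p]) auto
    have dv: "\<Prod>B dvd c p" if "finite B" "B \<subseteq> ?A - {p}" "p \<in> ?A" for B p
      using that
    proof (induction B)
      case (insert b B)
      have "coprime b (\<Prod>B)" using insert pr by (auto intro!: prod_coprime_right primes_coprime)
      moreover have "b dvd c p" using insert.prems dvdc[of p b] pP[of b] by (auto intro: dvd_trans)
      ultimately show ?case using insert by (auto intro!: divides_mult)
    qed simp
    have yp: "\<exists>t. y p = zmul (int t) (zmul (int (N div p)) (x p))" if p: "p \<in> ?A" for p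
    proof -
      obtain t where t: "c p = \<Prod>(?A - {p}) * t" using dv[of "?A - {p}" p] p by auto
      have "r dvd N"
      proof -
        have "p * \<Prod>(?A - {p}) dvd P p * c p" using pP[OF p] t by (intro mult_dvd_mono) auto
        then show ?thesis using rsplit[OF p] Nc[of p] by simp
      qed
      then obtain s where s: "N = r * s" by blast
      have "(N div r) * c p = t * (N div p)"
      proof -
        have "N div r = s" using s r0 by simp
        moreover have "N div p = \<Prod>(?A - {p}) * s"
          using s rsplit[OF p] ppos[OF p] by (metis mult.assoc nonzero_mult_div_cancel_left not_gr_zero)
        ultimately show ?thesis using t by (simp only: mult_ac)
      qed
      then have "int (N div r) * int (c p) = int t * int (N div p)" by (metis of_nat_mult)
      then show ?thesis unfolding y_def zmul_mult[symmetric] by auto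
    qed
    have "q (sum y ?A) \<in> \<int>"
    proof (rule q_sum_isotropic)
      fix p assume p: "p \<in> ?A"
      then obtain t where "y p = zmul (int t) (zmul (int (N div p)) (x p))" using yp by blast
      then show "q (y p) \<in> \<int>"
        using eq_mod1_Ints_iff[OF q_zmul] int_mult_Ints[OF x(2)[OF p], of "(int t)\<^sup>2"] by simp
    next
      fix p p' assume p: "p \<in> ?A" "p' \<in> ?A" "p \<noteq> p'"
      have z: "zmul (int b) (y b) = 0" if b: "b \<in> ?A" for b
      proof -
        obtain t where t: "y b = zmul (int t) (zmul (int (N div b)) (x b))" using yp[OF b] by blast
        have "int b * (int t * int (N div b)) = int N * int t"
          using b by (auto simp: in_prime_factors_iff simp flip: of_nat_mult)
        then have "int N dvd int b * (int t * int (N div b))" by (metis dvd_triv_left)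
        then show ?thesis unfolding t zmul_mult[symmetric] by (rule zmul_level_dvd)
      qed
      have "coprime (int p) (int p')" using p pr by (simp add: primes_coprime)
      then obtain a b where ab: "a * int p + b * int p' = 1" using bezout_int[of "int p" "int p'"] by (auto simp: coprime_iff_gcd_eq_1)
      have "of_int (a * int p + b * int p') * bl (y p) (y p') = of_int a * (of_int (int p) * bl (y p) (y p')) + of_int b * (of_int (int p') * bl (y p') (y p))"
        by (simp add: algebra_simps bl_commute[of "y p'" "y p"])
      then show "bl (y p) (y p') \<in> \<int>"
        using bl_zmul_Ints[OF z[OF p(1)], of "y p'"] bl_zmul_Ints[OF z[OF p(2)], of "y p"] unfolding ab
        by (metis Ints_add int_mult_Ints mult_1 of_int_1)
    qed simp
    then show ?thesis by (simp add: \<mu>_def zmul_sum_right y_def)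
  qed
  ultimately show ?thesis unfolding r_def by blast
qed

end

theorem theorem3p6:
  fixes q :: "'a::{ab_group_add,finite} \<Rightarrow> rat"
    and \<rho> :: "int^2^2 \<Rightarrow> complex^('a::{ab_group_add,finite})^('a::{ab_group_add,finite})"
    and k :: int
    and F :: "complex \<Rightarrow> complex^('a::{ab_group_add,finite})"
    and N :: nat
  assumes "discriminant_form q"
    and "regular_form q"
    and "even (disc_sign q)"
    and "N = level q"
    and "weil_representation q \<rho>"
    and "weakly_reflective q \<rho> k F"
    and "pole_at_infinity N (\<lambda>\<tau>. F \<tau> $ 0)"
  shows "- real_of_int k / 12 * (\<Prod>p\<in>prime_factors N. real (mu p N)) \<le> 2 ^ hall_omega N"
proof -
  interpret disc_form q by unfold_locales (rule assms(1))
  obtain \<mu> where \<mu>: "\<And>p. p \<in> prime_factors (level q) \<Longrightarrow> zmul (int (level q div p)) \<mu> \<noteq> 0"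
      "q (zmul (int (level q div \<Prod>(prime_factors (level q)))) \<mu>) \<in> \<int>"
    using exists_full_order_element[OF assms(2)] by blast
  interpret reflective_form where q = q and \<rho> = \<rho> and \<mu> = \<mu> and r = "\<Prod>(prime_factors (level q))" and k = k and F = F
    using assms \<mu> by unfold_locales auto
  show ?thesis
    unfolding assms(4) by (rule counting_inequality[OF level_pos valence_bound])
qed

end
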